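(* Let $\mathcal R=(\lambda_i,\boldsymbol\rho^i)_{i\ge1}$ be a regular sequence of harmonic structures on the stretched fractal $K$, with $\lambda_i\le\lambda^*<1$ for all $i$, and suppose there is $\lambda\in(0,\lambda^*]$ with $\sum_{k=1}^\infty|\lambda-\lambda_k|<\infty$. Then the Hausdorff dimension of $K$ with respect to the resistance metric $R_{\mathcal R}$ is $$\dim_{H,R_{\mathcal R}}(K)=\max\Big\{1,\frac{\ln N}{-\ln\lambda}\Big\}.$$
   Context: GEOMETRY. Let $F\subset\mathbb R^d$ be a connected p.c.f. (post-critically finite, in Kigami's sense) self-similar set generated by contracting similitudes $F_1,\dots,F_N$ ($N\ge2$) with pairwise distinct fixed points $q_1,\dots,q_N$, so $F=\bigcup_{i=1}^N F_i(F)$. Put $\mathcal A=\{1,\dots,N\}$, $\mathcal A^*=\bigcup_{n\ge1}\mathcal A^n$, $\mathcal A^*_0=\bigcup_{n\ge0}\mathcal A^n$ (with the empty word), $|w|$ the length of $w$, $F_w=F_{w_1}\circ\dots\circ F_{w_n}$, $F_\emptyset=\mathrm{id}$ (same notation for other families of maps). Critical set $\mathcal C=\bigcup_{i\ne j}F_i(F)\cap F_j(F)$; post-critical set $\mathcal P=\{x\in F:\exists w\in\mathcal A^*,\ F_w(x)\in\mathcal C\}$, which is finite. Assume: every $p\in\mathcal P$ is of the form $p=F_w(q_i)$ with $w\in\mathcal A^*_0$ and a fixed point $q_i\in\mathcal P$; and $q_i\notin\mathcal C$ for all $i$. For $x\in F$ let $\rho(x)=\#\{i\in\mathcal A: x\in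 F_i(F)\}$. For each $c\in\mathcal C$ fix words $w^{c,1},\dots,w^{c,\rho(c)}\in\mathcal A^*$ with pairwise distinct first letters and fixed points $q^c_1,\dots,q^c_{\rho(c)}\in\mathcal P$ with $F_{w^{c,l}}(q^c_l)=c$. For $\alpha\in(0,1)$ let $G_i(x)=\alpha(F_i(x)-q_i)+q_i$ and $e_{c,l}=\{\lambda G_{w^{c,l}}(q^c_l)+(1-\lambda)c:\lambda\in[0,1]\}$, $e^w_{c,l}=G_w(e_{c,l})$ for $w\in\mathcal A_0^*$. The stretched fractal $K$ (with $\alpha$ fixed) is the unique nonempty compact set with $K=\bigcup_{i=1}^N G_i(K)\cup\bigcup_{c\in\mathcal C}\bigcup_{l=1}^{\rho(c)}e_{c,l}$, and $\Sigma$ is the unique nonempty compact set with $\Sigma=\bigcup_{i=1}^NG_i(\Sigma)$. Standing assumption (the copies are pulled apart): the sets $G_i(K)$ are pairwise disjoint and contain no point of $\mathcal C$; each $e_{c,l}$ is nondegenerate, meets $\bigcup_iG_i(K)$ only in the endpoint $G_{w^{c,l}}(q^c_l)$, and two different segments $e_{c,l},e_{c',l'}$ meet at most in the point $c$ (if $c=c'$). GRAPHS. For $p\in\mathcal P$ write $p=F_v(q_i)$ with $v\in\mathcal A_0^*$, $q_i\in\mathcal P$, and put $\hat p=G_v(q_i)$ (so $\hat p=p$ if $p$ is a fixed point). $V_0=\{\hat p:p\in\mathcal P\}$, $E_0=\{\{x,y\}:x,y\in V_0,x\ne y\}$. For $n\ge1$: $P_n=\bigcup_{w\in\mathcal A^n}G_w(V_0)$,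 $C_n=\bigcup_{k=1}^n\bigcup_{w\in\mathcal A^{k-1}}G_w(\mathcal C)$, $V_n=P_n\cup C_n$; $E_1^I=\{\{c,G_{w^{c,l}}(q^c_l)\}:c\in\mathcal C,1\le l\le\rho(c)\}$ (in bijection with the segments $e_{c,l}$). HARMONIC STRUCTURES. Let $r_0:E_0\to(0,\infty]$ (convention $1/\infty=0$), $\lambda\in(0,1)$, $\boldsymbol\rho=\{\rho_e\}_{e\in E_1^I}$ with $\rho_e\in(0,\infty)$. The triple $(r_0,\lambda,\boldsymbol\rho)$ is a harmonic structure if (1) any two points of $V_0$ are joined by a path of edges $e\in E_0$ with $r_0(e)<\infty$; (2) for all $g:V_0\to\mathbb R$, $\inf\{Q_1(f): f:V_1\to\mathbb R, f|_{V_0}=g\}=Q^\Sigma(g)$, where $Q^\Sigma(g)=\sum_{\{x,y\}\in E_0}\frac{(g(x)-g(y))^2}{r_0(x,y)}$ and $Q_1(f)=\frac1\lambda\sum_{i\in\mathcal A}Q^\Sigma(f\circ G_i)+\sum_{\{x,y\}\in E_1^I}\frac{(f(x)-f(y))^2}{\rho_{\{x,y\}}}$. A sequence of harmonic structures is $\mathcal R=(\lambda_i,\boldsymbol\rho^i)_{i\ge1}$ such that, for one fixed $r_0$, every $(r_0,\lambda_i,\boldsymbol\rho^i)$ is a harmonic structure; it is regular if there is $\lambda^*<1$ with $\lambda_i\le\lambda^*$ for all $i$, and $\rho^*:=\sup\{\rho:\rho\in\boldsymbol\rho^i,i\ge1\}<\infty$. FORM. Put $\delta_n=\lambda_1\cdots\lambda_n$,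 $\gamma_1=1$, $\gamma_k=\lambda_1\cdots\lambda_{k-1}$. For $\{x,y\}\in E_1^I$ let $\xi_{xy}(t)=tx+(1-t)y$ and $\mathcal D_{xy}(u)=\int_0^1\big(\tfrac{d(u\circ\xi_{xy})}{dz}\big)^2dz$; $\mathcal D_{\boldsymbol\rho}(u)=\sum_{\{x,y\}\in E_1^I}\frac1{\rho_{\{x,y\}}}\mathcal D_{xy}(u)$; $\mathcal D_{\boldsymbol\rho,k}(u)=\sum_{w\in\mathcal A^{k-1}}\mathcal D_{\boldsymbol\rho}(u\circ G_w)$. Let $\mathcal E_{\mathcal R,n}(u)=\frac1{\delta_n}\sum_{w\in\mathcal A^n}Q^\Sigma(u\circ G_w)+\sum_{k=1}^n\frac1{\gamma_k}\mathcal D_{\boldsymbol\rho^k,k}(u)$, which is non-decreasing in $n$. $H^1(e^w_{c,l})$ denotes the functions on $e^w_{c,l}$ that are in $H^1[0,1]$ after affine parametrization over $[0,1]$. $\mathcal E_{\mathcal R}(u)=\lim_n\mathcal E_{\mathcal R,n}(u)$ and $\mathcal F_{\mathcal R}=\{u\in C(K): u|_{e^w_{c,l}}\in H^1(e^w_{c,l})\ \forall c,l,w\in\mathcal A_0^*,\ \lim_n\mathcal E_{\mathcal R,n}(u)<\infty\}$. The resistance metric on $K$ is $R_{\mathcal R}(x,y)=\sup\{|u(x)-u(y)|^2/\mathcal E_{\mathcal R}(u):u\in\mathcal F_{\mathcal R},\mathcal E_{\mathcal R}(u)>0\}$. *)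

theory Defs
  imports "HOL-Analysis.Analysis"
begin

section \<open>Hausdorff dimension with respect to a distance function\<close>

definition diam_wrt :: "('a \<Rightarrow> 'a \<Rightarrow> real) \<Rightarrow> 'a set \<Rightarrow> real" where
  "diam_wrt d U = (if U = {} then 0 else SUP (x, y) \<in> U \<times> U. d x y)"

definition hausdorff_premeasure ::
  "('a \<Rightarrow> 'a \<Rightarrow> real) \<Rightarrow> real \<Rightarrow> real \<Rightarrow> 'a set \<Rightarrow> ennreal" where
  "hausdorff_premeasure d s \<delta> S =
    (INF U \<in> {U :: nat \<Rightarrow> 'a set. S \<subseteq> (\<Union>i. U i) \<and>
                (\<forall>i. U i \<subseteq> S \<and> (\<forall>x\<in>U i. \<forall>y\<in>U i. d x y \<le> \<delta>))}.
       \<Sum>i. ennreal (diam_wrt d (U i) powr s))"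

definition hausdorff_measure :: "('a \<Rightarrow> 'a \<Rightarrow> real) \<Rightarrow> real \<Rightarrow> 'a set \<Rightarrow> ennreal" where
  "hausdorff_measure d s S = (SUP \<delta> \<in> {0<..}. hausdorff_premeasure d s \<delta> S)"

text \<open>The exponent \<open>s = 0\<close> is left out because of the convention \<open>0 powr 0 = 0\<close>;
  this does not change the infimum.\<close>

definition hausdorff_dim :: "('a \<Rightarrow> 'a \<Rightarrow> real) \<Rightarrow> 'a set \<Rightarrow> ereal" where
  "hausdorff_dim d S = Inf {ereal s | s. s > 0 \<and> hausdorff_measure d s S = 0}"


section \<open>The Sobolev space $H^1[0,1]$\<close>

definition test_function :: "(real \<Rightarrow> real) \<Rightarrow> bool" where
  "test_function \<phi> \<longleftrightarrow>
    (\<forall>k x. (deriv ^^ k) \<phi> differentiable (at x)) \<and>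
    (\<exists>a b. 0 < a \<and> b < 1 \<and> (\<forall>x. x \<notin> {a..b} \<longrightarrow> \<phi> x = 0))"

definition L2_01 :: "(real \<Rightarrow> real) \<Rightarrow> bool" where
  "L2_01 f \<longleftrightarrow> set_borel_measurable lborel {0..1} f \<and>
                set_integrable lborel {0..1} (\<lambda>x. (f x)\<^sup>2)"

definition has_weak_deriv :: "(real \<Rightarrow> real) \<Rightarrow> (real \<Rightarrow> real) \<Rightarrow> bool" where
  "has_weak_deriv f g \<longleftrightarrow> L2_01 g \<and>
    (\<forall>\<phi>. test_function \<phi> \<longrightarrow>
      (LINT x:{0..1}|lborel. f x * deriv \<phi> x) = - (LINT x:{0..1}|lborel. g x * \<phi> x))"

definition H1_01 :: "(real \<Rightarrow> real) \<Rightarrow> bool" where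
  "H1_01 f \<longleftrightarrow> L2_01 f \<and> (\<exists>g. has_weak_deriv f g)"

text \<open>The weak derivative is unique up to null sets, so \<open>dirichlet_01\<close> does not depend
  on the chosen representative. It is only meaningful on \<open>H1_01\<close>.\<close>

definition dirichlet_01 :: "(real \<Rightarrow> real) \<Rightarrow> real" where
  "dirichlet_01 f = (LINT x:{0..1}|lborel. ((SOME g. has_weak_deriv f g) x)\<^sup>2)"


section \<open>Post-critically finite self-similar sets\<close>

definition word_map :: "(nat \<Rightarrow> 'a \<Rightarrow> 'a) \<Rightarrow> nat list \<Rightarrow> 'a \<Rightarrow> 'a" where
  "word_map F w = foldr (\<lambda>i h. F i \<circ> h) w id"

text \<open>\<open>X\<close> is the self-similar set usually also called \<open>F\<close>; here \<open>F\<close> denotes the family of maps.\<close>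

locale self_similar_set =
  fixes N :: nat
    and F :: "nat \<Rightarrow> 'a::euclidean_space \<Rightarrow> 'a"
    and q :: "nat \<Rightarrow> 'a"
    and X :: "'a set"
  assumes N_ge_2: "N \<ge> 2"
    and similitude: "\<And>i. i \<in> {1..N} \<Longrightarrow>
      \<exists>s. 0 < s \<and> s < 1 \<and> (\<forall>x y. dist (F i x) (F i y) = s * dist x y)"
    and fixed_point: "\<And>i. i \<in> {1..N} \<Longrightarrow> F i (q i) = q i"
    and fixed_points_distinct: "inj_on q {1..N}"
    and X_compact: "compact X"
    and X_nonempty: "X \<noteq> {}"
    and X_self_similar: "X = (\<Union>i\<in>{1..N}. F i ` X)"
    and X_connected: "connected X"
begin

definition words :: "nat \<Rightarrow> nat list set" where
  "words n = {w. length w = n \<and> set w \<subseteq> {1..N}}"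

definition all_words :: "nat list set" where
  "all_words = (\<Union>n. words n)"

definition nonempty_words :: "nat list set" where
  "nonempty_words = (\<Union>n\<in>{1..}. words n)"

definition critical :: "'a set" where
  "critical = (\<Union>i\<in>{1..N}. \<Union>j\<in>{1..N} - {i}. F i ` X \<inter> F j ` X)"

definition postcritical :: "'a set" where
  "postcritical = {x \<in> X. \<exists>w\<in>nonempty_words. word_map F w x \<in> critical}"

definition mult :: "'a \<Rightarrow> nat" where
  "mult x = card {i \<in> {1..N}. x \<in> F i ` X}"

text \<open>Kigami's post-critical set is a set of infinite words: the iterated shifts of the
  codes of critical points. \<open>is_code \<omega> x\<close> says that \<open>x\<close> is the point coded by \<open>\<omega>\<close>, that is,
  the unique point of the decreasing cells belonging to the prefixes of \<open>\<omega>\<close>.\<close>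

definition is_code :: "(nat \<Rightarrow> nat) \<Rightarrow> 'a \<Rightarrow> bool" where
  "is_code \<omega> x \<longleftrightarrow> range \<omega> \<subseteq> {1..N} \<and> (\<forall>n. x \<in> word_map F (map \<omega> [0..<n]) ` X)"

definition critical_codes :: "(nat \<Rightarrow> nat) set" where
  "critical_codes = {\<omega>. \<exists>x\<in>critical. is_code \<omega> x}"

definition postcritical_codes :: "(nat \<Rightarrow> nat) set" where
  "postcritical_codes = (\<Union>n\<in>{1..}. (\<lambda>\<omega> k. \<omega> (k + n)) ` critical_codes)"

end

locale pcf_set = self_similar_set +
  assumes post_critically_finite: "finite postcritical_codes"
    and postcritical_form: "\<And>p. p \<in> postcritical \<Longrightarrow>
      \<exists>w\<in>all_words. \<exists>i\<in>{1..N}. q i \<in> postcritical \<and> p = word_map F w (q i)"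
    and fixed_point_not_critical: "\<And>i. i \<in> {1..N} \<Longrightarrow> q i \<notin> critical"


section \<open>Stretched fractals\<close>

text \<open>\<open>cw c l\<close> and \<open>q (ci c l)\<close> are the word $w^{c,l}$ and the fixed point $q^c_l$ chosen for the
  critical point \<open>c\<close>; \<open>pw p\<close> and \<open>q (pj p)\<close> are the word and the fixed point chosen to represent
  the post-critical point \<open>p\<close>, from which $\hat p$ is formed.\<close>

locale stretching_data = pcf_set N F q X
  for N :: nat and F :: "nat \<Rightarrow> 'a::euclidean_space \<Rightarrow> 'a" and q :: "nat \<Rightarrow> 'a" and X :: "'a set" +
  fixes \<alpha> :: real
    and cw :: "'a \<Rightarrow> nat \<Rightarrow> nat list"
    and ci :: "'a \<Rightarrow> nat \<Rightarrow> nat"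
    and pw :: "'a \<Rightarrow> nat list"
    and pj :: "'a \<Rightarrow> nat"
  assumes alpha: "0 < \<alpha>" "\<alpha> < 1"
    and critical_choice: "\<And>c l. c \<in> critical \<Longrightarrow> l \<in> {1..mult c} \<Longrightarrow>
      cw c l \<in> nonempty_words \<and> ci c l \<in> {1..N} \<and> q (ci c l) \<in> postcritical \<and>
      word_map F (cw c l) (q (ci c l)) = c"
    and first_letters_distinct: "\<And>c. c \<in> critical \<Longrightarrow> inj_on (\<lambda>l. hd (cw c l)) {1..mult c}"
    and postcritical_choice: "\<And>p. p \<in> postcritical \<Longrightarrow>
      pw p \<in> all_words \<and> pj p \<in> {1..N} \<and> q (pj p) \<in> postcritical \<and>
      word_map F (pw p) (q (pj p)) = p"
begin

definition G :: "nat \<Rightarrow> 'a \<Rightarrow> 'a" where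
  "G i x = \<alpha> *\<^sub>R (F i x - q i) + q i"

definition attach :: "'a \<Rightarrow> nat \<Rightarrow> 'a" where
  "attach c l = word_map G (cw c l) (q (ci c l))"

definition seg :: "'a \<Rightarrow> nat \<Rightarrow> 'a set" where
  "seg c l = closed_segment (attach c l) c"

definition hat :: "'a \<Rightarrow> 'a" where
  "hat p = word_map G (pw p) (q (pj p))"

definition V0 :: "'a set" where
  "V0 = hat ` postcritical"

definition E0 :: "'a set set" where
  "E0 = {{x, y} | x y. x \<in> V0 \<and> y \<in> V0 \<and> x \<noteq> y}"

definition V1 :: "'a set" where
  "V1 = (\<Union>i\<in>{1..N}. G i ` V0) \<union> critical"

text \<open>Indices \<open>(c, l)\<close> of the segments; under the standing assumptions below they correspond
  bijectively to the edges $\{c, G_{w^{c,l}}(q^c_l)\}$ of $E_1^I$.\<close>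

definition edges1 :: "('a \<times> nat) set" where
  "edges1 = (SIGMA c:critical. {1..mult c})"

subsection \<open>Harmonic structures\<close>

text \<open>For \<open>e = {x, y}\<close> the difference \<open>Max (g ` e) - Min (g ` e)\<close> is \<open>\<bar>g x - g y\<bar>\<close>, and
  \<open>real_of_ereal (1 / \<infinity>) = 0\<close>.\<close>

definition Q_Sigma :: "('a set \<Rightarrow> ereal) \<Rightarrow> ('a \<Rightarrow> real) \<Rightarrow> real" where
  "Q_Sigma r0 g = (\<Sum>e\<in>E0. (Max (g ` e) - Min (g ` e))\<^sup>2 * real_of_ereal (1 / r0 e))"

definition Q1 :: "('a set \<Rightarrow> ereal) \<Rightarrow> real \<Rightarrow> ('a \<times> nat \<Rightarrow> real) \<Rightarrow> ('a \<Rightarrow> real) \<Rightarrow> real" where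
  "Q1 r0 lam rho f =
     1 / lam * (\<Sum>i\<in>{1..N}. Q_Sigma r0 (f \<circ> G i)) +
     (\<Sum>(c, l)\<in>edges1. (f c - f (attach c l))\<^sup>2 / rho (c, l))"

text \<open>\<open>f\<close> is a total function, but only its values on \<open>V1\<close> enter (see \<open>V0_in_V1\<close> and
  \<open>attach_in_V1\<close> below).\<close>

definition harmonic_structure ::
  "('a set \<Rightarrow> ereal) \<Rightarrow> real \<Rightarrow> ('a \<times> nat \<Rightarrow> real) \<Rightarrow> bool" where
  "harmonic_structure r0 lam rho \<longleftrightarrow>
     (\<forall>e\<in>E0. 0 < r0 e) \<and> 0 < lam \<and> lam < 1 \<and> (\<forall>e\<in>edges1. 0 < rho e) \<and>
     (\<forall>x\<in>V0. \<forall>y\<in>V0. (x, y) \<in> {(a, b). {a, b} \<in> E0 \<and> r0 {a, b} < \<infinity>}\<^sup>*) \<and>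
     (\<forall>g. Inf {Q1 r0 lam rho f | f. \<forall>x\<in>V0. f x = g x} = Q_Sigma r0 g)"

definition harmonic_sequence ::
  "('a set \<Rightarrow> ereal) \<Rightarrow> (nat \<Rightarrow> real) \<Rightarrow> (nat \<Rightarrow> 'a \<times> nat \<Rightarrow> real) \<Rightarrow> bool" where
  "harmonic_sequence r0 lam rho \<longleftrightarrow> (\<forall>i\<ge>1. harmonic_structure r0 (lam i) (rho i))"

definition regular_harmonic_sequence ::
  "('a set \<Rightarrow> ereal) \<Rightarrow> (nat \<Rightarrow> real) \<Rightarrow> (nat \<Rightarrow> 'a \<times> nat \<Rightarrow> real) \<Rightarrow> bool" where
  "regular_harmonic_sequence r0 lam rho \<longleftrightarrow>
     harmonic_sequence r0 lam rho \<and>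
     (\<exists>b<1. \<forall>i\<ge>1. lam i \<le> b) \<and>
     bdd_above {rho i e | i e. i \<ge> 1 \<and> e \<in> edges1}"

subsection \<open>The energy form and the resistance metric\<close>

definition param :: "'a \<Rightarrow> nat \<Rightarrow> real \<Rightarrow> 'a" where
  "param c l t = t *\<^sub>R c + (1 - t) *\<^sub>R attach c l"

definition D :: "('a \<times> nat \<Rightarrow> real) \<Rightarrow> ('a \<Rightarrow> real) \<Rightarrow> real" where
  "D rho u = (\<Sum>(c, l)\<in>edges1. 1 / rho (c, l) * dirichlet_01 (u \<circ> param c l))"

definition D_level :: "('a \<times> nat \<Rightarrow> real) \<Rightarrow> nat \<Rightarrow> ('a \<Rightarrow> real) \<Rightarrow> real" where
  "D_level rho k u = (\<Sum>w\<in>words (k - 1). D rho (u \<circ> word_map G w))"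

definition energy_n ::
  "('a set \<Rightarrow> ereal) \<Rightarrow> (nat \<Rightarrow> real) \<Rightarrow> (nat \<Rightarrow> 'a \<times> nat \<Rightarrow> real) \<Rightarrow> nat \<Rightarrow> ('a \<Rightarrow> real) \<Rightarrow> real" where
  "energy_n r0 lam rho n u =
     1 / (\<Prod>i=1..n. lam i) * (\<Sum>w\<in>words n. Q_Sigma r0 (u \<circ> word_map G w)) +
     (\<Sum>k=1..n. 1 / (\<Prod>i=1..<k. lam i) * D_level (rho k) k u)"

definition energy ::
  "('a set \<Rightarrow> ereal) \<Rightarrow> (nat \<Rightarrow> real) \<Rightarrow> (nat \<Rightarrow> 'a \<times> nat \<Rightarrow> real) \<Rightarrow> ('a \<Rightarrow> real) \<Rightarrow> real" where
  "energy r0 lam rho u = lim (\<lambda>n. energy_n r0 lam rho n u)"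

end

locale stretched_fractal = stretching_data N F q X \<alpha> cw ci pw pj
  for N :: nat and F :: "nat \<Rightarrow> 'a::euclidean_space \<Rightarrow> 'a" and q :: "nat \<Rightarrow> 'a" and X :: "'a set"
    and \<alpha> :: real and cw :: "'a \<Rightarrow> nat \<Rightarrow> nat list" and ci :: "'a \<Rightarrow> nat \<Rightarrow> nat"
    and pw :: "'a \<Rightarrow> nat list" and pj :: "'a \<Rightarrow> nat" +
  fixes K :: "'a set"
  assumes K_compact: "compact K"
    and K_nonempty: "K \<noteq> {}"
    and K_eq: "K = (\<Union>i\<in>{1..N}. G i ` K) \<union> (\<Union>c\<in>critical. \<Union>l\<in>{1..mult c}. seg c l)"
    and copies_disjoint: "\<And>i j. i \<in> {1..N} \<Longrightarrow> j \<in> {1..N} \<Longrightarrow> i \<noteq> j \<Longrightarrow> G i ` K \<inter> G j ` K = {}"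
    and copies_critical: "\<And>i. i \<in> {1..N} \<Longrightarrow> G i ` K \<inter> critical = {}"
    and seg_nondegenerate: "\<And>c l. c \<in> critical \<Longrightarrow> l \<in> {1..mult c} \<Longrightarrow> attach c l \<noteq> c"
    and seg_copies: "\<And>c l. c \<in> critical \<Longrightarrow> l \<in> {1..mult c} \<Longrightarrow>
      seg c l \<inter> (\<Union>i\<in>{1..N}. G i ` K) \<subseteq> {attach c l}"
    and seg_seg: "\<And>c l c' l'. (c, l) \<in> edges1 \<Longrightarrow> (c', l') \<in> edges1 \<Longrightarrow> (c, l) \<noteq> (c', l') \<Longrightarrow>
      seg c l \<inter> seg c' l' \<subseteq> (if c = c' then {c} else {})"
    \<comment> \<open>The chosen representations are coherent: \<open>V0\<close> and the endpoints of the edges of $E_1^I$ are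
      vertices of the first graph. This holds automatically if $\hat p$ does not depend on the
      representation of \<open>p\<close>, and is needed for \<open>Q1\<close> to be a form on functions on \<open>V1\<close>.\<close>
    and V0_in_V1: "V0 \<subseteq> V1"
    and attach_in_V1: "\<And>c l. (c, l) \<in> edges1 \<Longrightarrow> attach c l \<in> V1"
begin

text \<open>Functions on \<open>K\<close> are rendered as total functions; only their values on \<open>K\<close> matter.
  Since the approximating energies are non-decreasing in \<open>n\<close>, their limit is finite iff they converge
  in the reals.\<close>

definition domain ::
  "('a set \<Rightarrow> ereal) \<Rightarrow> (nat \<Rightarrow> real) \<Rightarrow> (nat \<Rightarrow> 'a \<times> nat \<Rightarrow> real) \<Rightarrow> ('a \<Rightarrow> real) set" where
  "domain r0 lam rho = {u. continuous_on K u \<and>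
     (\<forall>(c, l)\<in>edges1. \<forall>w\<in>all_words. H1_01 (u \<circ> (word_map G w \<circ> param c l))) \<and>
     convergent (\<lambda>n. energy_n r0 lam rho n u)}"

definition resistance ::
  "('a set \<Rightarrow> ereal) \<Rightarrow> (nat \<Rightarrow> real) \<Rightarrow> (nat \<Rightarrow> 'a \<times> nat \<Rightarrow> real) \<Rightarrow> 'a \<Rightarrow> 'a \<Rightarrow> real" where
  "resistance r0 lam rho x y =
     Sup {\<bar>u x - u y\<bar>\<^sup>2 / energy r0 lam rho u | u.
            u \<in> domain r0 lam rho \<and> energy r0 lam rho u > 0}"

end

end

theory Submission
  imports Defs
begin

text \<open>Upper bound: a function of energy at most one oscillates by at most a constant multiple of
  $\sqrt{\lambda_1\cdots\lambda_n}$ on an $n$-cell, because \<open>V1\<close> is connected as a resistance network, uniformly in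
  the level, and the contributions of finer levels decrease geometrically. So $K$ is covered by $N^n$ cells of diameter
  comparable to $\lambda^n$ and finitely many segments, each of which is rectifiable.

  Lower bound: a tent on one segment gives dimension at least one. For the other bound one needs, for
  an $n$-cell, a function that is one on it, zero on all $n$-cells except boundedly many, and of energy
  comparable to $\lambda^{-n}$. The resistances of the segments may tend to zero, so the function
  cannot fall off along segments; it is constant on every cluster of segments (a cluster corresponds to
  one point of the unstretched set) and harmonic inside the $n$-cells. The harmonic extension exists because energy
  minimizers for the harmonic structures can be iterated. A set of small diameter then meets boundedly many cells,
  and mass distribution over the $N^n$ cells finishes the proof.\<close>

section \<open>Smooth functions and weak derivatives on the unit interval\<close>

text \<open>A cell of level k sees only the sequence with its first k members dropped, so every
  estimate is proved for all such tails at once and its constant must not depend on k. Regularity is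
  what allows this: the common upper bound on the segment resistances keeps the first graph
  connected with uniform strength, and \<open>lam_max < 1\<close> makes the contributions of the
  levels summable. Summability of |lambda - lambda_k| enters through one fact: the product of the
  quotients lambda_k / lambda converges to a nonzero limit, so the products lambda_1 ... lambda_n
  and lambda^n agree up to constant factors. The form is built from weak derivatives picked by
  \<open>SOME\<close>. Hence the preliminary work: a continuous function is recovered by integrating
  its weak derivative, which yields both the square-root Hoelder bound along segments and the
  independence of the choice. Mass distribution is carried out on words, without constructing a
  measure on K: cells of total uniform weight less than one leave some infinite code untouched, and
  the point with this code is not covered.\<close>

definition differentiable_times :: "nat \<Rightarrow> (real \<Rightarrow> real) \<Rightarrow> bool" where
  "differentiable_times n f \<longleftrightarrow> (\<forall>k<n. \<forall>x. (deriv ^^ k) f differentiable (at x))"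

lemma differentiable_times_0 [simp]: "differentiable_times 0 f"
  by (simp add: differentiable_times_def)

text \<open>Splitting off the innermost derivative, not the outermost one, gives a recursion in
  which product and chain rules can be applied by induction on the order.\<close>

lemma differentiable_times_Suc:
  "differentiable_times (Suc n) f \<longleftrightarrow>
     (\<forall>x. f differentiable (at x)) \<and> differentiable_times n (deriv f)"
proof
  assume a: "differentiable_times (Suc n) f"
  have "(deriv ^^ k) (deriv f) differentiable at x" if "k < n" for k x
    using a that unfolding differentiable_times_def
    by (metis Suc_less_eq comp_apply funpow_Suc_right)
  moreover have "f differentiable at x" for x
    using a[unfolded differentiable_times_def, rule_format, of 0] by simp
  ultimately show "(\<forall>x. f differentiable (at x)) \<and> differentiable_times n (deriv f)"
    by (simp add: differentiable_times_def)
next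
  assume a: "(\<forall>x. f differentiable (at x)) \<and> differentiable_times n (deriv f)"
  show "differentiable_times (Suc n) f"
    unfolding differentiable_times_def
  proof (intro allI impI)
    fix k x assume "k < Suc n"
    then show "(deriv ^^ k) f differentiable at x"
      using a unfolding differentiable_times_def
      by (cases k) (auto simp: funpow_swap1 simp del: funpow.simps simp: funpow_Suc_right)
  qed
qed

lemma differentiable_times_SucI:
  assumes "\<And>x. (f has_real_derivative f' x) (at x)" and "differentiable_times n f'"
  shows "differentiable_times (Suc n) f"
proof -
  have "deriv f = f'"
    using assms(1) by (intro ext DERIV_imp_deriv)
  then show ?thesis
    using assms by (auto simp: differentiable_times_Suc real_differentiable_def)
qed

lemma differentiable_times_SucD:
  assumes "differentiable_times (Suc n) f"
  shows "(f has_real_derivative deriv f x) (at x)" "differentiable_times n (deriv f)"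
  using assms by (auto simp: differentiable_times_Suc DERIV_deriv_iff_real_differentiable)

lemma differentiable_times_le:
  "differentiable_times n f \<Longrightarrow> m \<le> n \<Longrightarrow> differentiable_times m f"
  by (auto simp: differentiable_times_def)

lemma differentiable_times_const: "differentiable_times n (\<lambda>_. c)"
proof (induction n arbitrary: c)
  case (Suc n)
  then show ?case
    by (intro differentiable_times_SucI[where f' = "\<lambda>_. 0"]) auto
qed simp

lemma differentiable_times_add:
  "differentiable_times n f \<Longrightarrow> differentiable_times n g \<Longrightarrow> differentiable_times n (\<lambda>x. f x + g x)"
proof (induction n arbitrary: f g)
  case (Suc n)
  show ?case
    by (rule differentiable_times_SucI[where f' = "\<lambda>x. deriv f x + deriv g x"])
      (auto intro!: derivative_eq_intros Suc.IH
        differentiable_times_SucD[OF Suc.prems(1)] differentiable_times_SucD[OF Suc.prems(2)])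
qed simp

lemma differentiable_times_mult:
  "differentiable_times n f \<Longrightarrow> differentiable_times n g \<Longrightarrow> differentiable_times n (\<lambda>x. f x * g x)"
proof (induction n arbitrary: f g)
  case (Suc n)
  have "differentiable_times n (\<lambda>x. deriv f x * g x + f x * deriv g x)"
    by (intro differentiable_times_add Suc.IH differentiable_times_SucD[OF Suc.prems(1)]
        differentiable_times_SucD[OF Suc.prems(2)] differentiable_times_le[OF Suc.prems(1)]
        differentiable_times_le[OF Suc.prems(2)]) auto
  then show ?case
    by (rule differentiable_times_SucI[rotated])
      (auto intro!: derivative_eq_intros
        differentiable_times_SucD[OF Suc.prems(1)] differentiable_times_SucD[OF Suc.prems(2)])
qed simp

lemma differentiable_times_affine:
  "differentiable_times n f \<Longrightarrow> differentiable_times n (\<lambda>x. f (a * x + b))"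
proof (induction n arbitrary: f)
  case (Suc n)
  have "differentiable_times n (\<lambda>x. a * deriv f (a * x + b))"
    by (intro differentiable_times_mult differentiable_times_const Suc.IH
        differentiable_times_SucD[OF Suc.prems])
  then show ?case
  proof (rule differentiable_times_SucI[rotated])
    fix x
    show "((\<lambda>x. f (a * x + b)) has_real_derivative a * deriv f (a * x + b)) (at x)"
      by (rule DERIV_chain'[OF _ differentiable_times_SucD(1)[OF Suc.prems], THEN DERIV_cong])
        (auto intro!: derivative_eq_intros)
  qed
qed simp

section \<open>Smooth steps and mollifiers from exp(-1/x)\<close>

definition flat_exp :: "nat \<Rightarrow> real \<Rightarrow> real" where
  "flat_exp k x = (if 0 < x then (1 / x) ^ k * exp (- (1 / x)) else 0)"

lemma flat_exp_tendsto_0: "(flat_exp k \<longlongrightarrow> 0) (at 0)"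
proof (rule filterlim_split_at_real)
  show "(flat_exp k \<longlongrightarrow> 0) (at_left 0)"
    by (rule tendsto_eventually)
      (auto simp: flat_exp_def eventually_at intro!: exI[of _ 1])
  have "((\<lambda>x::real. inverse x ^ k / exp (inverse x)) \<longlongrightarrow> 0) (at_right 0)"
    by (rule filterlim_compose[OF tendsto_power_div_exp_0 filterlim_inverse_at_top_right])
  then show "(flat_exp k \<longlongrightarrow> 0) (at_right 0)"
    by (rule Lim_transform_eventually)
      (auto simp: flat_exp_def eventually_at exp_minus field_simps intro!: exI[of _ 1])
qed

text \<open>The powers of 1/x are included in \<open>flat_exp\<close> for this formula: the family
  is closed under differentiation up to linear combinations, so smoothness of all members follows by
  one induction.\<close>

lemma flat_exp_deriv:
  "(flat_exp k has_real_derivative - real k * flat_exp (Suc k) x + flat_exp (k + 2) x) (at x)"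
proof (cases x "0::real" rule: linorder_cases)
  case less
  have "((\<lambda>_. 0) has_real_derivative - real k * flat_exp (Suc k) x + flat_exp (k + 2) x) (at x)"
    using less by (simp add: flat_exp_def)
  then show ?thesis
    by (rule has_field_derivative_transform_within_open[where S = "{..<0}"])
      (use less in \<open>auto simp: flat_exp_def\<close>)
next
  case equal
  \<comment> \<open>The difference quotient at the origin is the next member
    \<open>flat_exp (Suc k)\<close> of the family, which tends to 0.\<close>
  have "((\<lambda>h. flat_exp k (0 + h) / h) \<longlongrightarrow> 0) (at 0)"
    by (rule Lim_transform_eventually[OF flat_exp_tendsto_0[of "Suc k"]])
      (auto simp: flat_exp_def eventually_at intro!: exI[of _ 1])
  then show ?thesis
    using equal by (simp add: DERIV_def flat_exp_def)
next
  case greater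
  \<comment> \<open>In the case \<open>k = 0\<close> the truncated exponent \<open>k - 1\<close>
    does no harm because of the factor \<open>real k\<close>.\<close>
  have k: "real k * (1 / x) ^ (k - 1) * (1 / x ^ 2) = real k * (1 / x) ^ Suc k" 
    using greater by (cases k) (auto simp: power2_eq_square)
  have "((\<lambda>x. (1 / x) ^ k * exp (- (1 / x))) has_real_derivative
      - real k * (1 / x) ^ Suc k * exp (- (1 / x)) + (1 / x) ^ (k + 2) * exp (- (1 / x))) (at x)"
    apply (rule derivative_eq_intros refl | use greater in force)+
    using k greater by (simp add: power2_eq_square algebra_simps)
  then have "((\<lambda>x. (1 / x) ^ k * exp (- (1 / x))) has_real_derivative
      - real k * flat_exp (Suc k) x + flat_exp (k + 2) x) (at x)"
    using greater by (simp add: flat_exp_def mult.assoc)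
  then show ?thesis
    by (rule has_field_derivative_transform_within_open[where S = "{0<..}"])
      (use greater in \<open>auto simp: flat_exp_def\<close>)
qed

lemma flat_exp_smooth: "differentiable_times n (flat_exp k)"
proof (induction n arbitrary: k)
  case (Suc n)
  have "differentiable_times n (\<lambda>x. - real k * flat_exp (Suc k) x + flat_exp (k + 2) x)"
    by (intro differentiable_times_add differentiable_times_mult differentiable_times_const Suc.IH)
  then show ?case
    by (rule differentiable_times_SucI[OF flat_exp_deriv])
qed simp

text \<open>A normalised primitive of the bump exp(-1/x) exp(-1/(1-x)) on the unit interval.
  Rescaled copies of the step approximate indicators of half-lines, and their derivatives
  approximate point masses.\<close>

lemma smooth_step_exists:
  obtains B :: "real \<Rightarrow> real" where
    "\<And>n. differentiable_times n B" "\<And>x. x \<le> 0 \<Longrightarrow> B x = 0" "\<And>x. 1 \<le> x \<Longrightarrow> B x = 1"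
    "\<And>x. 0 \<le> deriv B x"
proof -
  define b where "b x = flat_exp 0 x * flat_exp 0 (-1 * x + 1)" for x
  have b_smooth: "differentiable_times n b" for n
    unfolding b_def by (intro differentiable_times_mult flat_exp_smooth differentiable_times_affine)
  have b0: "b x = 0" if "x \<le> 0 \<or> 1 \<le> x" for x
    using that by (auto simp: b_def flat_exp_def)
  have b1: "0 < b x" if "0 < x" "x < 1" for x
    using that by (auto simp: b_def flat_exp_def)
  have b_nonneg: "0 \<le> b x" for x
    by (auto simp: b_def flat_exp_def)
  have b_cont: "isCont b x" for x
    using differentiable_times_SucD(1)[OF b_smooth] DERIV_isCont by blast
  obtain C where C: "\<And>x. (C has_real_derivative b x) (at x)"
    using einterval_antiderivative[of "-\<infinity>" "\<infinity>" b] b_cont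
    by (auto simp: has_real_derivative_iff_has_vector_derivative)
  have C01: "C 0 < C 1"
  proof -
    have "\<exists>z. 0 < z \<and> z < 1 \<and> C 1 - C 0 = (1 - 0) * b z"
      by (rule MVT2) (use C in auto)
    then obtain z where "0 < z" "z < 1" "C 1 - C 0 = b z" by auto
    then show ?thesis using b1[of z] by auto
  qed
  have C0: "C x = C 0" if "x \<le> 0" for x
  proof (cases "x < 0")
    case True
    have "\<exists>z. x < z \<and> z < 0 \<and> C 0 - C x = (0 - x) * b z"
      by (rule MVT2) (use C True in auto)
    then show ?thesis using b0 by force
  qed (use that in auto)
  have C1: "C x = C 1" if "1 \<le> x" for x
  proof (cases "1 < x")
    case True
    have "\<exists>z. 1 < z \<and> z < x \<and> C x - C 1 = (x - 1) * b z"
      by (rule MVT2) (use C True in auto)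
    then show ?thesis using b0 by force
  qed (use that in auto)
  define B where "B x = 1 / (C 1 - C 0) * (C x + - C 0)" for x
  have B': "(B has_real_derivative 1 / (C 1 - C 0) * b x) (at x)" for x
    unfolding B_def using C01 by (auto intro!: derivative_eq_intros C)
  have "differentiable_times (Suc n) B" for n
    by (rule differentiable_times_SucI[OF B'])
      (intro differentiable_times_mult differentiable_times_const b_smooth)
  then have "differentiable_times n B" for n
    by (rule differentiable_times_le[of "Suc n"]) simp
  moreover have "deriv B x = 1 / (C 1 - C 0) * b x" for x
    using B' by (rule DERIV_imp_deriv)
  ultimately show ?thesis
  proof (intro that[of B])
    show "B x = 0" if "x \<le> 0" for x
      using C0[OF that] by (simp add: B_def)
    show "B x = 1" if "1 \<le> x" for x
      using C1[OF that] C01 by (simp add: B_def)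
  qed (use C01 b_nonneg in simp_all)
qed

lemma test_function_iff:
  "test_function \<phi> \<longleftrightarrow> (\<forall>n. differentiable_times n \<phi>) \<and>
     (\<exists>a b. 0 < a \<and> b < 1 \<and> (\<forall>x. x \<notin> {a..b} \<longrightarrow> \<phi> x = 0))"
  unfolding test_function_def differentiable_times_def by blast

lemma test_function_DERIV:
  assumes "test_function \<phi>"
  shows "(\<phi> has_real_derivative deriv \<phi> x) (at x)" "isCont (deriv \<phi>) x"
proof -
  have 2: "differentiable_times (Suc (Suc 0)) \<phi>"
    using assms by (simp add: test_function_iff)
  then show "(\<phi> has_real_derivative deriv \<phi> x) (at x)"
    by (rule differentiable_times_SucD)
  show "isCont (deriv \<phi>) x"
    using differentiable_times_SucD(1)[OF differentiable_times_SucD(2)[OF 2]] by (rule DERIV_isCont)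
qed

section \<open>Recovering a continuous function from its weak derivative\<close>

lemma L2_01_imp_set_integrable:
  assumes "L2_01 g"
  shows "set_integrable lborel {0..1} g"
proof -
  have meas: "(\<lambda>x. indicator {0..1} x *\<^sub>R g x) \<in> borel_measurable lborel"
    and sq: "set_integrable lborel {0..1} (\<lambda>x. (g x)\<^sup>2)"
    using assms by (auto simp: L2_01_def set_borel_measurable_def)
  have "set_integrable lborel {0..1} (\<lambda>x. 1 + (g x)\<^sup>2)"
    by (intro set_integral_add sq borel_integrable_atLeastAtMost') auto
  then have "integrable lborel (\<lambda>x. indicator {0..1} x *\<^sub>R (1 + (g x)\<^sup>2))"
    by (simp add: set_integrable_def)
  moreover have "\<bar>y\<bar> \<le> 1 + y\<^sup>2" for y :: real
    using zero_le_power2[of "\<bar>y\<bar> - 1 / 2"] by (simp add: power2_eq_square algebra_simps abs_mult_self_eq)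
  then have "AE x in lborel. norm (indicator {0..1} x *\<^sub>R g x) \<le> norm (indicator {0..1} x *\<^sub>R (1 + (g x)\<^sup>2))"
    by (intro AE_I2) (auto simp: indicator_def intro: order_trans[OF _ abs_ge_self])
  ultimately show ?thesis
    unfolding set_integrable_def by (rule Bochner_Integration.integrable_bound[OF _ meas])
qed

lemma set_integral_FTC_Icc:
  fixes F f :: "real \<Rightarrow> real"
  assumes "a \<le> b" "\<And>x. (F has_real_derivative f x) (at x)" "\<And>x. isCont f x"
  shows "set_integrable lborel {a..b} f" "(LINT x:{a..b}|lborel. f x) = F b - F a"
proof -
  show "set_integrable lborel {a..b} f"
    using assms(3) by (intro borel_integrable_atLeastAtMost' continuous_at_imp_continuous_on) auto
  have "(\<integral>x. f x * indicator {a..b} x \<partial>lborel) = F b - F a"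
    by (rule integral_FTC_Icc_real) (use assms in auto)
  then show "(LINT x:{a..b}|lborel. f x) = F b - F a"
    by (simp add: set_lebesgue_integral_def mult.commute)
qed

lemma DERIV_shift_scale:
  fixes B B' :: "real \<Rightarrow> real"
  assumes "\<And>x. (B has_real_derivative B' x) (at x)" and "h \<noteq> 0"
  shows "((\<lambda>x. B ((x - r) / h)) has_real_derivative B' ((x - r) / h) / h) (at x)"
proof -
  have "((\<lambda>x. (x - r) / h) has_real_derivative 1 / h) (at x)"
    using assms(2) by (auto intro!: derivative_eq_intros)
  then show ?thesis
    using DERIV_chain'[OF _ assms(1), of "\<lambda>x. (x - r) / h" "1 / h" x UNIV] by simp
qed

text \<open>The kernel is nonnegative, has integral one and lives on the interval from
  \<open>r\<close> to \<open>r + h n\<close>, so the integral is an average of \<open>f\<close> over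
  a short interval to the right of \<open>r\<close>.\<close>

lemma mollifier_tendsto:
  fixes f :: "real \<Rightarrow> real"
  assumes f: "continuous_on {0..1} f" and r: "0 < r"
    and h: "\<And>n. 0 < h n" "\<And>n. r + h n < 1" "h \<longlonglongrightarrow> 0"
    and B: "\<And>n. differentiable_times n B" "\<And>x. x \<le> 0 \<Longrightarrow> B x = 0" "\<And>x. 1 \<le> x \<Longrightarrow> B x = 1"
      "\<And>x. 0 \<le> deriv B x"
  shows "(\<lambda>n. LINT x:{0..1}|lborel. f x * (deriv B ((x - r) / h n) / h n)) \<longlonglongrightarrow> f r"
    "set_integrable lborel {0..1} (\<lambda>x. f x * (deriv B ((x - r) / h n) / h n))"
proof -
  define k where "k n x = deriv B ((x - r) / h n) / h n" for n x
  have B': "(B has_real_derivative deriv B x) (at x)" for x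
    using differentiable_times_SucD(1)[OF B(1)] .
  have B'_cont: "isCont (deriv B) x" for x
    using differentiable_times_SucD(1)[OF differentiable_times_SucD(2)[OF B(1)]]
    by (rule DERIV_isCont)
  have k_nonneg: "0 \<le> k n x" for n x
    using B(4) h(1) by (simp add: k_def less_imp_le)
  have k0: "k n x = 0" if "x < r \<or> r + h n < x" for n x
  proof -
    have "(B has_real_derivative 0) (at y)" if "y < 0 \<or> 1 < y" for y
      using that
    proof
      assume "y < 0"
      have "((\<lambda>_. 0) has_real_derivative 0) (at y)" by simp
      then show ?thesis
        by (rule has_field_derivative_transform_within_open[where S = "{..<0}"])
          (use \<open>y < 0\<close> B(2) in auto)
    next
      assume "1 < y"
      have "((\<lambda>_. 1) has_real_derivative 0) (at y)" by simp
      then show ?thesis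
        by (rule has_field_derivative_transform_within_open[where S = "{1<..}"])
          (use \<open>1 < y\<close> B(3) in auto)
    qed
    then have "deriv B y = 0" if "y < 0 \<or> 1 < y" for y
      using that by (meson DERIV_imp_deriv)
    then show ?thesis
      using that h(1)[of n] by (auto simp: k_def field_simps)
  qed
  have k_cont: "isCont (k n) x" for n x
    unfolding k_def using h(1)[of n]
    by (intro continuous_intros isCont_o2[OF _ B'_cont]) auto
  have k_deriv: "((\<lambda>x. B ((x - r) / h n)) has_real_derivative k n x) (at x)" for n x
    unfolding k_def using h(1)[of n] by (intro DERIV_shift_scale B') simp
  have k_int: "set_integrable lborel {0..1} (k n)" "(LINT x:{0..1}|lborel. k n x) = 1" for n
  proof -
    show "set_integrable lborel {0..1} (k n)"
      by (rule set_integral_FTC_Icc[OF _ k_deriv k_cont]) simp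
    have "B ((1 - r) / h n) = 1" "B ((0 - r) / h n) = 0"
      using h(1,2)[of n] r by (auto intro!: B simp: field_simps)
    then show "(LINT x:{0..1}|lborel. k n x) = 1"
      by (subst set_integral_FTC_Icc(2)[OF _ k_deriv k_cont]) auto
  qed
  have fk_int: "set_integrable lborel {0..1} (\<lambda>x. f x * k n x)" for n
    by (intro borel_integrable_atLeastAtMost' continuous_intros f
        continuous_at_imp_continuous_on ballI k_cont)
  then show "set_integrable lborel {0..1} (\<lambda>x. f x * (deriv B ((x - r) / h n) / h n))"
    by (simp add: k_def)
  have "(\<lambda>n. LINT x:{0..1}|lborel. f x * k n x) \<longlonglongrightarrow> f r"
  proof (rule LIMSEQ_I)
    fix e :: real assume "0 < e"
    have "r \<in> {0..1}" using h(1,2)[of 0] r by auto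
    then obtain d where d: "0 < d" "\<And>x. x \<in> {0..1} \<Longrightarrow> dist x r < d \<Longrightarrow> dist (f x) (f r) < e / 2"
      using f \<open>0 < e\<close> unfolding continuous_on_iff by (meson half_gt_zero)
    obtain n0 where n0: "\<And>n. n \<ge> n0 \<Longrightarrow> h n < d"
      using order_tendstoD(2)[OF h(3) d(1)] by (auto simp: eventually_sequentially)
    have "norm ((LINT x:{0..1}|lborel. f x * k n x) - f r) < e" if n: "n \<ge> n0" for n
    proof -
      \<comment> \<open>Where the kernel vanishes all three expressions are zero; on its support
        \<open>f\<close> is within \<open>e / 2\<close> of \<open>f r\<close>. Integration then
        traps the average, as the kernel has integral one.\<close>
      have bd: "(f r - e / 2) * k n x \<le> f x * k n x \<and> f x * k n x \<le> (f r + e / 2) * k n x"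
        if "x \<in> {0..1}" for x
      proof (cases "x < r \<or> r + h n < x")
        case False
        then have "dist (f x) (f r) < e / 2"
          using n0[OF n] that by (intro d(2)) (auto simp: dist_real_def)
        then show ?thesis
          using k_nonneg[of n x] by (intro conjI mult_right_mono) (auto simp: dist_real_def abs_if split: if_splits)
      qed (simp add: k0)
      have ck: "set_integrable lborel {0..1} (\<lambda>x. c * k n x)"
        "(LINT x:{0..1}|lborel. c * k n x) = c" for c
        using k_int[of n] by simp_all
      have "f r - e / 2 \<le> (LINT x:{0..1}|lborel. f x * k n x)"
        using set_integral_mono[OF ck(1) fk_int] bd by (metis (no_types, lifting) ck(2))
      moreover have "(LINT x:{0..1}|lborel. f x * k n x) \<le> f r + e / 2"
        using set_integral_mono[OF fk_int ck(1)] bd by (metis (no_types, lifting) ck(2))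
      ultimately show ?thesis
        using \<open>0 < e\<close> by (simp add: abs_if)
    qed
    then show "\<exists>no. \<forall>n\<ge>no. norm ((LINT x:{0..1}|lborel. f x * k n x) - f r) < e" by blast
  qed
  then show "(\<lambda>n. LINT x:{0..1}|lborel. f x * (deriv B ((x - r) / h n) / h n)) \<longlonglongrightarrow> f r"
    by (simp add: k_def)
qed

text \<open>Test with \<open>p n\<close>, a smooth version of the indicator of the interval from
  \<open>s\<close> to \<open>t\<close>. Its derivative is a difference of approximate point masses
  at \<open>s\<close> and \<open>t\<close>, so the side of \<open>f\<close> tends to
  \<open>f s - f t\<close>; the side of \<open>g\<close> converges by domination, as
  \<open>p n\<close> is bounded by one.\<close>

lemma weak_deriv_integral_interior:
  fixes f g :: "real \<Rightarrow> real"
  assumes fg: "has_weak_deriv f g" and f: "continuous_on {0..1} f"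
    and st: "0 < s" "s < t" "t < 1"
  shows "(LINT x:{s<..t}|lborel. g x) = f t - f s"
proof -
  obtain B :: "real \<Rightarrow> real" where B: "\<And>n. differentiable_times n B" "\<And>x. x \<le> 0 \<Longrightarrow> B x = 0"
    "\<And>x. 1 \<le> x \<Longrightarrow> B x = 1" "\<And>x. 0 \<le> deriv B x"
    by (rule smooth_step_exists) blast
  have B': "(B has_real_derivative deriv B x) (at x)" for x
    using differentiable_times_SucD(1)[OF B(1)] .
  have B01: "0 \<le> B x" "B x \<le> 1" for x
  proof -
    have mono: "B x \<le> B y" if "x \<le> y" for x y
      by (rule DERIV_nonneg_imp_nondecreasing[OF that]) (use B' B(4) in blast)
    show "0 \<le> B x" using mono[of "min 0 x" x] B(2) by auto
    show "B x \<le> 1" using mono[of x "max 1 x"] B(3) by auto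
  qed
  \<comment> \<open>The denominator \<open>n + 2\<close> keeps the support of the step at
    \<open>t\<close> strictly inside the unit interval already for \<open>n = 0\<close>.\<close>
  define h where "h n = (1 - t) / real (n + 2)" for n
  have h0: "0 < h n" for n using st by (simp add: h_def)
  have h1: "t + h n < 1" for n
  proof -
    have "(1 - t) / real (n + 2) < (1 - t) / 1"
      by (rule divide_strict_left_mono) (use st in auto)
    then show ?thesis by (simp add: h_def)
  qed
  have hlim: "h \<longlonglongrightarrow> 0"
    unfolding h_def by (rule LIMSEQ_ignore_initial_segment[OF lim_const_over_n])
  define p where "p n x = B ((x - s) / h n) - B ((x - t) / h n)" for n x
  have p_deriv: "(p n has_real_derivative
      (deriv B ((x - s) / h n) / h n - deriv B ((x - t) / h n) / h n)) (at x)" for n x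
    unfolding p_def using h0[of n] by (intro DERIV_diff DERIV_shift_scale B') simp_all
  have p_test: "test_function (p n)" for n
  proof -
    have "p n = (\<lambda>x. B (1 / h n * x + (- s / h n)) + (-1) * B (1 / h n * x + (- t / h n)))"
      by (auto simp: p_def diff_divide_distrib)
    then have "differentiable_times m (p n)" for m
      by (simp only:) (intro differentiable_times_add differentiable_times_mult
          differentiable_times_const differentiable_times_affine B(1))
    moreover have "p n x = 0" if "x \<notin> {s..t + h n}" for x
      using that st h0[of n] unfolding p_def
      by (cases "x < s") (auto simp: B field_simps)
    ultimately show ?thesis
      using st h1[of n] by (auto simp: test_function_iff)
  qed
  have sh: "s + h n < 1" for n using h1[of n] st by linarith
  have "0 < t" using st by simp
  note ms = mollifier_tendsto[OF f st(1) h0 sh hlim B]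
  note mt = mollifier_tendsto[OF f \<open>0 < t\<close> h0 h1 hlim B]
  have eq: "(LINT x:{0..1}|lborel. f x * deriv (p n) x) =
      (LINT x:{0..1}|lborel. f x * (deriv B ((x - s) / h n) / h n)) -
      (LINT x:{0..1}|lborel. f x * (deriv B ((x - t) / h n) / h n))" for n
  proof -
    have "deriv (p n) x = deriv B ((x - s) / h n) / h n - deriv B ((x - t) / h n) / h n" for x
      using p_deriv by (rule DERIV_imp_deriv)
    then show ?thesis
      by (simp only: right_diff_distrib) (rule set_integral_diff(2)[OF ms(2) mt(2)])
  qed
  have lim1: "(\<lambda>n. LINT x:{0..1}|lborel. f x * deriv (p n) x) \<longlonglongrightarrow> f s - f t"
    unfolding eq by (intro tendsto_diff ms(1) mt(1))
  have g_int: "set_integrable lborel {0..1} g"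
    using fg by (auto simp: has_weak_deriv_def intro: L2_01_imp_set_integrable)
  have p_meas: "p n \<in> borel_measurable lborel" for n
  proof -
    have "continuous_on UNIV (p n)"
      using p_deriv by (intro continuous_at_imp_continuous_on) (auto intro: DERIV_isCont)
    then show ?thesis
      by (simp add: borel_measurable_continuous_onI)
  qed
  have "(\<lambda>n. LINT x|lborel. indicator {0..1} x *\<^sub>R g x * p n x) \<longlonglongrightarrow>
      (LINT x|lborel. indicator {s<..t} x *\<^sub>R g x)"
  proof (rule integral_dominated_convergence)
    show "integrable lborel (\<lambda>x. norm (indicator {0..1} x *\<^sub>R g x))"
      using g_int by (simp add: set_integrable_def)
    show "(\<lambda>x. indicator {s<..t} x *\<^sub>R g x) \<in> borel_measurable lborel"
    proof -
      have "{s<..t} \<subseteq> {0..1}" using st by auto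
      then show ?thesis
        using set_integrable_subset[OF g_int, of "{s<..t}"] unfolding set_integrable_def
        by (intro borel_measurable_integrable) simp
    qed
    show "(\<lambda>x. indicator {0..1} x *\<^sub>R g x * p n x) \<in> borel_measurable lborel" for n
      using g_int p_meas by (intro borel_measurable_times) (auto simp: set_integrable_def)
    show "AE x in lborel. norm (indicator {0..1} x *\<^sub>R g x * p n x) \<le> norm (indicator {0..1} x *\<^sub>R g x)" for n
    proof (intro AE_I2)
      fix x
      have "\<bar>p n x\<bar> \<le> 1"
        using B01[of "(x - s) / h n"] B01[of "(x - t) / h n"] by (auto simp: p_def)
      then show "norm (indicator {0..1} x *\<^sub>R g x * p n x) \<le> norm (indicator {0..1} x *\<^sub>R g x)"
        by (auto simp: abs_mult indicator_def mult_left_le)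
    qed
    show "AE x in lborel. (\<lambda>n. indicator {0..1} x *\<^sub>R g x * p n x) \<longlonglongrightarrow> indicator {s<..t} x *\<^sub>R g x"
    proof (intro AE_I2)
      fix x
      \<comment> \<open>The rescaled step is 0 at and to the left of \<open>r\<close> and eventually
        1 at each point to the right. This is the origin of the half-open interval in the
        limit.\<close>
      have step: "(\<lambda>n. B ((x - r) / h n)) \<longlonglongrightarrow> indicator {r<..} x" for r
      proof (cases "r < x")
        case True
        then have "eventually (\<lambda>n. h n < x - r) sequentially"
          using order_tendstoD(2)[OF hlim, of "x - r"] by simp
        then have "eventually (\<lambda>n. B ((x - r) / h n) = 1) sequentially"
          by eventually_elim (use h0 in \<open>auto intro!: B(3) simp: field_simps less_imp_le\<close>)
        then show ?thesis using True by (auto intro: tendsto_eventually)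
      next
        case False
        then have "B ((x - r) / h n) = 0" for n
          using h0[of n] by (intro B(2)) (auto simp: field_simps)
        then show ?thesis using False by simp
      qed
      have "(\<lambda>n. p n x) \<longlonglongrightarrow> indicator {s<..} x - indicator {t<..} x"
        unfolding p_def by (intro tendsto_diff step)
      also have "indicator {s<..} x - indicator {t<..} x = (indicator {s<..t} x :: real)"
        using st by (auto simp: indicator_def)
      finally have "(\<lambda>n. indicator {0..1} x *\<^sub>R g x * p n x) \<longlonglongrightarrow>
          indicator {0..1} x *\<^sub>R g x * indicator {s<..t} x"
        by (intro tendsto_intros)
      moreover have "indicator {0..1} x *\<^sub>R g x * indicator {s<..t} x = indicator {s<..t} x *\<^sub>R g x"
        using st by (auto simp: indicator_def)
      ultimately show "(\<lambda>n. indicator {0..1} x *\<^sub>R g x * p n x) \<longlonglongrightarrow> indicator {s<..t} x *\<^sub>R g x"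
        by (simp only:)
    qed
  qed
  then have lim2: "(\<lambda>n. LINT x:{0..1}|lborel. g x * p n x) \<longlonglongrightarrow> (LINT x:{s<..t}|lborel. g x)"
    by (simp add: set_lebesgue_integral_def mult.assoc)
  have "(LINT x:{0..1}|lborel. f x * deriv (p n) x) = - (LINT x:{0..1}|lborel. g x * p n x)" for n
    using fg p_test by (auto simp: has_weak_deriv_def)
  with lim1 have "(\<lambda>n. - (LINT x:{0..1}|lborel. g x * p n x)) \<longlonglongrightarrow> f s - f t"
    by simp
  moreover have "(\<lambda>n. - (LINT x:{0..1}|lborel. g x * p n x)) \<longlonglongrightarrow> - (LINT x:{s<..t}|lborel. g x)"
    by (intro tendsto_intros lim2)
  ultimately show ?thesis
    using LIMSEQ_unique by fastforce
qed

text \<open>Test functions vanish near 0 and 1, so these endpoints are reached only in the limit: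
  shrink the interval on both sides and use continuity of \<open>f\<close> and dominated convergence
  for \<open>g\<close>.\<close>

lemma weak_deriv_integral:
  fixes f g :: "real \<Rightarrow> real"
  assumes fg: "has_weak_deriv f g" and f: "continuous_on {0..1} f"
    and st: "0 \<le> s" "s \<le> t" "t \<le> 1"
  shows "(LINT x:{s<..<t}|lborel. g x) = f t - f s"
proof (cases "s = t")
  case False
  then have "s < t" using st by simp
  \<comment> \<open>With \<open>n + 3\<close> the two removed pieces together stay shorter than the
    interval for every \<open>n\<close>.\<close>
  define d where "d n = (t - s) / real (n + 3)" for n
  have d0: "0 < d n" and d1: "2 * d n < t - s" for n
  proof -
    show "0 < d n" using \<open>s < t\<close> by (simp add: d_def)
    have "(t - s) / real (n + 3) < (t - s) / 2"
      by (rule divide_strict_left_mono) (use \<open>s < t\<close> in auto)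
    then show "2 * d n < t - s" by (simp add: d_def algebra_simps)
  qed
  have dlim: "d \<longlonglongrightarrow> 0"
    unfolding d_def by (rule LIMSEQ_ignore_initial_segment[OF lim_const_over_n])
  have st_n: "0 < s + d n" "s + d n < t - d n" "t - d n < 1" for n
    using d0[of n] d1[of n] st by auto
  have eq: "(LINT x:{s + d n<..t - d n}|lborel. g x) = f (t - d n) - f (s + d n)" for n
    by (rule weak_deriv_integral_interior[OF fg f st_n])
  have mem: "t - d n \<in> {0..1}" "s + d n \<in> {0..1}" for n
    using st_n[of n] by auto
  have "(\<lambda>n. t - d n) \<longlonglongrightarrow> t - 0" "(\<lambda>n. s + d n) \<longlonglongrightarrow> s + 0"
    by (intro tendsto_intros dlim)+
  then have "(\<lambda>n. f (t - d n)) \<longlonglongrightarrow> f t" "(\<lambda>n. f (s + d n)) \<longlonglongrightarrow> f s"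
    using st by (auto intro!: continuous_on_tendsto_compose[OF f] eventuallyI mem)
  then have lim1: "(\<lambda>n. LINT x:{s + d n<..t - d n}|lborel. g x) \<longlonglongrightarrow> f t - f s"
    unfolding eq by (intro tendsto_diff)
  have g_int: "set_integrable lborel {0..1} g"
    using fg by (auto simp: has_weak_deriv_def intro: L2_01_imp_set_integrable)
  have "(\<lambda>n. LINT x|lborel. indicator {s + d n<..t - d n} x *\<^sub>R g x) \<longlonglongrightarrow>
      (LINT x|lborel. indicator {s<..<t} x *\<^sub>R g x)"
  proof (rule integral_dominated_convergence)
    show "integrable lborel (\<lambda>x. norm (indicator {0..1} x *\<^sub>R g x))"
      using g_int by (simp add: set_integrable_def)
    have "set_integrable lborel A g" if "A \<in> sets borel" "A \<subseteq> {0..1}" for A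
      using set_integrable_subset[OF g_int] that by simp
    then have meas: "(\<lambda>x. indicator A x *\<^sub>R g x) \<in> borel_measurable lborel"
      if "A \<in> sets borel" "A \<subseteq> {0..1}" for A
      using that by (auto simp: set_integrable_def)
    show "(\<lambda>x. indicator {s<..<t} x *\<^sub>R g x) \<in> borel_measurable lborel"
      by (rule meas) (use st in auto)
    show "(\<lambda>x. indicator {s + d n<..t - d n} x *\<^sub>R g x) \<in> borel_measurable lborel" for n
      by (rule meas) (use st_n[of n] in auto)
    show "AE x in lborel. norm (indicator {s + d n<..t - d n} x *\<^sub>R g x) \<le> norm (indicator {0..1} x *\<^sub>R g x)" for n
      using st_n[of n] by (intro AE_I2) (auto simp: indicator_def)
    show "AE x in lborel. (\<lambda>n. indicator {s + d n<..t - d n} x *\<^sub>R g x) \<longlonglongrightarrow> indicator {s<..<t} x *\<^sub>R g x"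
    proof (intro AE_I2)
      fix x
      show "(\<lambda>n. indicator {s + d n<..t - d n} x *\<^sub>R g x) \<longlonglongrightarrow> indicator {s<..<t} x *\<^sub>R g x"
      proof (cases "x \<in> {s<..<t}")
        case True
        then have "eventually (\<lambda>n. d n < min (x - s) (t - x)) sequentially"
          using order_tendstoD(2)[OF dlim, of "min (x - s) (t - x)"] by simp
        then have "eventually (\<lambda>n. indicator {s + d n<..t - d n} x *\<^sub>R g x = indicator {s<..<t} x *\<^sub>R g x) sequentially"
          by eventually_elim (use True in \<open>auto simp: indicator_def\<close>)
        then show ?thesis by (rule tendsto_eventually)
      next
        case False
        then have "indicator {s + d n<..t - d n} x *\<^sub>R g x = indicator {s<..<t} x *\<^sub>R g x" for n
          using d0[of n] by (auto simp: indicator_def)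
        then show ?thesis by (simp only: tendsto_const)
      qed
    qed
  qed
  then show ?thesis
    using LIMSEQ_unique[OF _ lim1] by (simp add: set_lebesgue_integral_def)
qed (simp add: set_lebesgue_integral_def)

text \<open>Cauchy-Schwarz on the interval, obtained by integrating
  \<open>0 \<le> (g x - a)^2\<close> with \<open>a\<close> the mean value of \<open>g\<close>
  there.\<close>

lemma weak_deriv_square_bound:
  fixes f g :: "real \<Rightarrow> real"
  assumes fg: "has_weak_deriv f g" and f: "continuous_on {0..1} f"
    and st: "0 \<le> s" "s \<le> t" "t \<le> 1"
  shows "(f t - f s)\<^sup>2 \<le> (t - s) * (LINT x:{0..1}|lborel. (g x)\<^sup>2)"
proof (cases "s = t")
  case False
  then have lt: "s < t" using st by simp
  define a where "a = (f t - f s) / (t - s)"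
  have L2: "L2_01 g" using fg by (simp add: has_weak_deriv_def)
  have sub: "{s<..<t} \<subseteq> {0..1}" using st by auto
  have g_int: "set_integrable lborel {s<..<t} g"
    by (rule set_integrable_subset[OF L2_01_imp_set_integrable[OF L2]]) (use sub in auto)
  have sq_int1: "set_integrable lborel {0..1} (\<lambda>x. (g x)\<^sup>2)"
    using L2 by (simp add: L2_01_def)
  have sq_int: "set_integrable lborel {s<..<t} (\<lambda>x. (g x)\<^sup>2)"
    by (rule set_integrable_subset[OF sq_int1]) (use sub in auto)
  have c_int: "set_integrable lborel {s<..<t} (\<lambda>x. c)" "(LINT x:{s<..<t}|lborel. c) = c * (t - s)" for c :: real
    using lt by (auto simp: set_integrable_def set_lebesgue_integral_def)
  have "(LINT x:{s<..<t}|lborel. 2 * a * g x - a\<^sup>2) \<le> (LINT x:{s<..<t}|lborel. (g x)\<^sup>2)"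
  proof (rule set_integral_mono[OF _ sq_int])
    show "set_integrable lborel {s<..<t} (\<lambda>x. 2 * a * g x - a\<^sup>2)"
      by (intro set_integral_diff set_integrable_mult_right g_int c_int)
    show "2 * a * g x - a\<^sup>2 \<le> (g x)\<^sup>2" for x
      using zero_le_power2[of "g x - a"] by (simp add: power2_eq_square algebra_simps)
  qed
  moreover have "(LINT x:{s<..<t}|lborel. 2 * a * g x - a\<^sup>2) = 2 * a * (f t - f s) - a\<^sup>2 * (t - s)"
    using weak_deriv_integral[OF fg f st]
    by (subst set_integral_diff(2)) (auto intro: g_int c_int simp: c_int)
  moreover have "2 * a * (f t - f s) - a\<^sup>2 * (t - s) = (f t - f s)\<^sup>2 / (t - s)"
  proof -
    have *: "2 * (e / d) * e - (e / d)\<^sup>2 * d = e\<^sup>2 / d" if "d \<noteq> 0" for d e :: real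
      using that by (simp add: power2_eq_square field_simps)
    show ?thesis
      unfolding a_def by (rule *) (use lt in simp)
  qed
  moreover have "(LINT x:{s<..<t}|lborel. (g x)\<^sup>2) \<le> (LINT x:{0..1}|lborel. (g x)\<^sup>2)"
    using sq_int sq_int1 sub unfolding set_integrable_def set_lebesgue_integral_def
    by (intro integral_mono) (auto simp: indicator_def)
  ultimately have "(f t - f s)\<^sup>2 / (t - s) \<le> (LINT x:{0..1}|lborel. (g x)\<^sup>2)"
    by linarith
  then show ?thesis
    using lt by (simp add: field_simps)
qed simp

lemma dirichlet_01_nonneg: "0 \<le> dirichlet_01 f"
  unfolding dirichlet_01_def set_lebesgue_integral_def by (rule Bochner_Integration.integral_nonneg) simp

text \<open>The link between energy and pointwise values: all control of a function along a segment
  goes through this bound.\<close>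

lemma dirichlet_01_bound:
  assumes "H1_01 f" "continuous_on {0..1} f" "s \<in> {0..1}" "t \<in> {0..1}"
  shows "(f t - f s)\<^sup>2 \<le> \<bar>t - s\<bar> * dirichlet_01 f"
proof -
  have w: "has_weak_deriv f (SOME g. has_weak_deriv f g)"
    using assms(1) unfolding H1_01_def by (metis someI_ex)
  show ?thesis
  proof (cases "s \<le> t")
    case True
    then show ?thesis
      using weak_deriv_square_bound[OF w assms(2), of s t] assms unfolding dirichlet_01_def by simp
  next
    case False
    then show ?thesis
      using weak_deriv_square_bound[OF w assms(2), of t s] assms unfolding dirichlet_01_def
      by (simp add: power2_commute)
  qed
qed

text \<open>The positive and the negative part of \<open>h\<close> are densities of two finite
  measures that agree on all right half-lines, hence everywhere; densities are unique up to null
  sets.\<close>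

lemma AE_zero_if_tail_integrals_zero:
  fixes h :: "real \<Rightarrow> real"
  assumes h: "integrable lborel h" and 0: "\<And>x. (LINT y:{x<..}|lborel. h y) = 0"
  shows "AE x in lborel. h x = 0"
proof -
  define p where "p x = ennreal (max (h x) 0)" for x
  define m where "m x = ennreal (max (- h x) 0)" for x
  have [measurable]: "h \<in> borel_measurable borel"
    using h by auto
  have [measurable]: "p \<in> borel_measurable lborel" "m \<in> borel_measurable lborel"
    unfolding p_def m_def by measurable
  have tail: "emeasure (density lborel p) {x<..} = ennreal (LINT y:{x<..}|lborel. max (h y) 0)"
    "emeasure (density lborel m) {x<..} = ennreal (LINT y:{x<..}|lborel. max (- h y) 0)" for x
  proof -
    have int: "integrable lborel (\<lambda>y. indicator {x<..} y *\<^sub>R max (k y) 0)" if "integrable lborel k" for k :: "real \<Rightarrow> real"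
      using that by (intro integrable_mult_indicator integrable_max) auto
    have "emeasure (density lborel p) {x<..} = (\<integral>\<^sup>+y. ennreal (indicator {x<..} y *\<^sub>R max (h y) 0) \<partial>lborel)"
      by (subst emeasure_density) (auto intro!: nn_integral_cong simp: p_def indicator_def)
    also have "\<dots> = ennreal (LINT y:{x<..}|lborel. max (h y) 0)"
      unfolding set_lebesgue_integral_def by (rule nn_integral_eq_integral[OF int[OF h]]) auto
    finally show "emeasure (density lborel p) {x<..} = ennreal (LINT y:{x<..}|lborel. max (h y) 0)" .
    have "integrable lborel (\<lambda>y. - h y)" using h by simp
    have "emeasure (density lborel m) {x<..} = (\<integral>\<^sup>+y. ennreal (indicator {x<..} y *\<^sub>R max (- h y) 0) \<partial>lborel)"
      by (subst emeasure_density) (auto intro!: nn_integral_cong simp: m_def indicator_def)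
    also have "\<dots> = ennreal (LINT y:{x<..}|lborel. max (- h y) 0)"
      unfolding set_lebesgue_integral_def by (rule nn_integral_eq_integral[OF int[OF \<open>integrable lborel (\<lambda>y. - h y)\<close>]]) auto
    finally show "emeasure (density lborel m) {x<..} = ennreal (LINT y:{x<..}|lborel. max (- h y) 0)" .
  qed
  have eq: "(LINT y:{x<..}|lborel. max (h y) 0) = (LINT y:{x<..}|lborel. max (- h y) 0)" for x
  proof -
    have i: "set_integrable lborel {x<..} (\<lambda>y. max (h y) 0)" "set_integrable lborel {x<..} (\<lambda>y. max (- h y) 0)"
      unfolding set_integrable_def by (intro integrable_mult_indicator integrable_max; use h in simp)+
    have "(LINT y:{x<..}|lborel. h y) = (LINT y:{x<..}|lborel. max (h y) 0 - max (- h y) 0)"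
      by (rule set_lebesgue_integral_cong) auto
    also have "\<dots> = (LINT y:{x<..}|lborel. max (h y) 0) - (LINT y:{x<..}|lborel. max (- h y) 0)"
      by (rule set_integral_diff(2)[OF i])
    finally show ?thesis using 0 by simp
  qed
  have "density lborel p = density lborel m"
    by (rule measure_eqI_lessThan) (auto simp: tail eq)
  then have "AE x in lborel. p x = m x"
    by (rule sigma_finite_measure.density_unique[OF sigma_finite_lborel, rotated 2]) auto
  then show ?thesis
    by eventually_elim (auto simp: p_def m_def max_def split: if_splits)
qed

text \<open>Makes \<open>dirichlet_01\<close> computable although it uses a derivative picked by
  \<open>SOME\<close>. Two weak derivatives have equal integrals over all subintervals, so their
  difference has vanishing tail integrals.\<close>

lemma weak_deriv_unique:
  assumes g: "has_weak_deriv f g" and k: "has_weak_deriv f k" and f: "continuous_on {0..1} f"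
  shows "(LINT x:{0..1}|lborel. (g x)\<^sup>2) = (LINT x:{0..1}|lborel. (k x)\<^sup>2)"
proof -
  have gi: "set_integrable lborel {0..1} g" and ki: "set_integrable lborel {0..1} k"
    using g k by (auto simp: has_weak_deriv_def intro: L2_01_imp_set_integrable)
  define h where "h x = indicator {0..1} x * (g x - k x)" for x :: real
  have h_int: "integrable lborel h"
    using set_integral_diff(1)[OF gi ki] by (simp add: h_def[abs_def] set_integrable_def)
  have "(LINT y:{x<..}|lborel. h y) = 0" for x
  proof (cases "x < 1")
    case True
    define s where "s = max 0 x"
    have s: "0 \<le> s" "s \<le> 1" using True by (auto simp: s_def)
    have i: "set_integrable lborel {s<..<1} g" "set_integrable lborel {s<..<1} k"
      using s by (auto intro: set_integrable_subset[OF gi] set_integrable_subset[OF ki])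
    have "AE y in lborel. y \<noteq> (1::real) \<and> y \<noteq> 0"
      by (intro AE_conjI AE_lborel_singleton)
    then have "(LINT y:{x<..}|lborel. h y) = (LINT y:{s<..<1}|lborel. g y - k y)"
      unfolding set_lebesgue_integral_def
    proof (intro integral_cong_AE)
      show "(\<lambda>y. indicator {x<..} y *\<^sub>R h y) \<in> borel_measurable lborel"
        using h_int by measurable
      show "(\<lambda>y. indicator {s<..<1} y *\<^sub>R (g y - k y)) \<in> borel_measurable lborel"
        using set_integral_diff(1)[OF i] by (auto simp: set_integrable_def)
      assume "AE y in lborel. y \<noteq> (1::real) \<and> y \<noteq> 0"
      then show "AE y in lborel. indicator {x<..} y *\<^sub>R h y = indicator {s<..<1} y *\<^sub>R (g y - k y)"
        by eventually_elim (auto simp: s_def h_def indicator_def)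
    qed
    also have "\<dots> = 0"
      using weak_deriv_integral[OF g f s(1) s(2)] weak_deriv_integral[OF k f s(1) s(2)]
      by (subst set_integral_diff(2)[OF i]) simp
    finally show ?thesis .
  next
    case False
    then have "(\<lambda>y. indicator {x<..} y *\<^sub>R h y) = (\<lambda>_. 0)"
      by (auto simp: h_def indicator_def)
    then show ?thesis unfolding set_lebesgue_integral_def by simp
  qed
  then have "AE x in lborel. h x = 0"
    by (intro AE_zero_if_tail_integrals_zero h_int)
  moreover have "(\<lambda>x. indicator {0..1} x *\<^sub>R (g x)\<^sup>2) \<in> borel_measurable lborel"
    "(\<lambda>x. indicator {0..1} x *\<^sub>R (k x)\<^sup>2) \<in> borel_measurable lborel"
    using g k by (auto simp: has_weak_deriv_def L2_01_def set_integrable_def)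
  ultimately show ?thesis
    unfolding set_lebesgue_integral_def
    by (intro integral_cong_AE) (auto simp: h_def indicator_def split: if_splits elim!: eventually_mono)
qed

lemma dirichlet_01_eq:
  assumes "has_weak_deriv f g" "continuous_on {0..1} f"
  shows "dirichlet_01 f = (LINT x:{0..1}|lborel. (g x)\<^sup>2)"
  unfolding dirichlet_01_def
  using assms by (intro weak_deriv_unique[where f = f] someI[of "has_weak_deriv f" g])

section \<open>Explicit functions of finite Dirichlet energy\<close>

lemma set_integrable_bounded:
  fixes g :: "real \<Rightarrow> real"
  assumes "g \<in> borel_measurable borel" "\<And>x. x \<in> {0..1} \<Longrightarrow> \<bar>g x\<bar> \<le> C"
  shows "set_integrable lborel {0..1} g"
proof (rule set_integrable_bound[where f = "\<lambda>_. C"])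
  show "set_integrable lborel {0..1::real} (\<lambda>_. C)"
    by (intro borel_integrable_atLeastAtMost') auto
  show "set_borel_measurable lborel {0..1} g"
    using assms(1) unfolding set_borel_measurable_def by measurable
  show "AE x in lborel. x \<in> {0..1} \<longrightarrow> norm (g x) \<le> norm C"
    using assms(2) by (intro AE_I2) (auto intro: order_trans[OF _ abs_ge_self])
qed

text \<open>Integration by parts through the fundamental theorem with a finite exceptional set; the
  boundary terms vanish because a test function is zero at 0 and 1.\<close>

lemma H1_01_piecewise:
  fixes f g :: "real \<Rightarrow> real"
  assumes f: "continuous_on {0..1} f" and g: "g \<in> borel_measurable borel"
    and C: "\<And>x. x \<in> {0..1} \<Longrightarrow> \<bar>g x\<bar> \<le> C" and S: "finite S"
    and fg: "\<And>x. x \<in> {0<..<1} - S \<Longrightarrow> (f has_real_derivative g x) (at x)"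
  shows "H1_01 f" "dirichlet_01 f = (LINT x:{0..1}|lborel. (g x)\<^sup>2)"
proof -
  have f_int: "set_integrable lborel {0..1} f"
    by (rule borel_integrable_atLeastAtMost'[OF f])
  have "\<bar>(g x)\<^sup>2\<bar> \<le> C\<^sup>2" if "x \<in> {0..1}" for x
    using power_mono[OF C[OF that], of 2] by simp
  moreover have "set_borel_measurable lborel {0..1} g"
    using g unfolding set_borel_measurable_def by measurable
  ultimately have "L2_01 g"
    unfolding L2_01_def using g by (auto intro!: set_integrable_bounded[of _ "C\<^sup>2"])
  moreover have "L2_01 f"
    unfolding L2_01_def
    using f_int by (auto simp: set_borel_measurable_def set_integrable_def[of _ _ f]
        intro!: borel_integrable_atLeastAtMost' continuous_intros f)
  moreover have "(LINT x:{0..1}|lborel. f x * deriv \<phi> x) = - (LINT x:{0..1}|lborel. g x * \<phi> x)"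
    if \<phi>: "test_function \<phi>" for \<phi>
  proof -
    note D = test_function_DERIV[OF \<phi>]
    have \<phi>_cont: "continuous_on A \<phi>" and \<phi>'_cont: "continuous_on A (deriv \<phi>)" for A
      using D(2) DERIV_isCont[OF D(1)] by (auto intro!: continuous_at_imp_continuous_on)
    have i1: "set_integrable lborel {0..1} (\<lambda>x. f x * deriv \<phi> x)"
      by (intro borel_integrable_atLeastAtMost' continuous_intros f \<phi>'_cont)
    obtain M where M: "\<forall>x\<in>{0..1}. \<bar>\<phi> x\<bar> \<le> M"
      using compact_imp_bounded[OF compact_continuous_image[OF \<phi>_cont compact_Icc[of 0 1]]]
      by (auto simp: bounded_iff)
    have "\<phi> \<in> borel_measurable borel"
      by (rule borel_measurable_continuous_onI[OF \<phi>_cont])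
    moreover have "\<bar>g x * \<phi> x\<bar> \<le> C * M" if "x \<in> {0..1}" for x
      unfolding abs_mult using C[OF that] M that by (intro mult_mono) force+
    ultimately have i2: "set_integrable lborel {0..1} (\<lambda>x. g x * \<phi> x)"
      using g by (intro set_integrable_bounded) auto
    have z: "\<phi> 0 = 0" "\<phi> 1 = 0"
      using \<phi> by (auto simp: test_function_def)
    have "((\<lambda>x. f x * deriv \<phi> x + g x * \<phi> x) has_integral f 1 * \<phi> 1 - f 0 * \<phi> 0) {0..1}"
    proof (rule fundamental_theorem_of_calculus_interior_strong[OF S])
      show "continuous_on {0..1} (\<lambda>x. f x * \<phi> x)"
        by (intro continuous_intros f \<phi>_cont)
      show "((\<lambda>x. f x * \<phi> x) has_vector_derivative f x * deriv \<phi> x + g x * \<phi> x) (at x)"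
        if "x \<in> {0<..<1} - S" for x
        using DERIV_mult[OF fg[OF that] D(1)[of x]]
        by (simp add: has_real_derivative_iff_has_vector_derivative algebra_simps)
    qed simp
    then have "integral {0..1} (\<lambda>x. f x * deriv \<phi> x + g x * \<phi> x) = 0"
      using z by (simp add: integral_unique)
    then have "(LINT x:{0..1}|lborel. f x * deriv \<phi> x + g x * \<phi> x) = 0"
      using set_borel_integral_eq_integral(2)[OF set_integral_add(1)[OF i1 i2]] by simp
    then show ?thesis
      using set_integral_add(2)[OF i1 i2] by simp
  qed
  ultimately show "H1_01 f"
    and "dirichlet_01 f = (LINT x:{0..1}|lborel. (g x)\<^sup>2)"
    using dirichlet_01_eq[OF _ f, of g] by (auto simp: H1_01_def has_weak_deriv_def)
qed

lemma H1_01_affine: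
  assumes "\<And>x. x \<in> {0..1} \<Longrightarrow> f x = a + b * x"
  shows "H1_01 f" "dirichlet_01 f = b\<^sup>2"
proof -
  have c: "continuous_on {0..1} f"
    by (rule continuous_on_eq[of _ "\<lambda>x. a + b * x"]) (auto simp: assms intro!: continuous_intros)
  have d: "(f has_real_derivative b) (at x)" if "x \<in> {0<..<1} - {}" for x
    by (rule has_field_derivative_transform_within_open[where S = "{0<..<1}" and f = "\<lambda>x. a + b * x"])
      (use that assms in \<open>auto intro!: derivative_eq_intros\<close>)
  note p = H1_01_piecewise[OF c _ _ finite.emptyI d, of "\<bar>b\<bar>"]
  show "H1_01 f" by (rule p) auto
  have "dirichlet_01 f = (LINT x:{0..1::real}|lborel. b\<^sup>2)" by (rule p) auto
  then show "dirichlet_01 f = b\<^sup>2" by (simp add: set_lebesgue_integral_def)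
qed

lemma H1_01_cong:
  assumes "\<And>x. x \<in> {0..1} \<Longrightarrow> f x = g x"
  shows "H1_01 f = H1_01 g" "dirichlet_01 f = dirichlet_01 g"
proof -
  have "(\<lambda>x. indicator {0..1} x *\<^sub>R f x) = (\<lambda>x. indicator {0..1} x *\<^sub>R g x)"
    "(\<lambda>x. indicator {0..1} x *\<^sub>R (f x)\<^sup>2) = (\<lambda>x. indicator {0..1} x *\<^sub>R (g x)\<^sup>2)"
    using assms by (auto simp: indicator_def)
  then have "L2_01 f = L2_01 g"
    unfolding L2_01_def set_borel_measurable_def set_integrable_def by simp
  moreover have "has_weak_deriv f = has_weak_deriv g"
  proof -
    have "(LINT x:{0..1}|lborel. f x * k x) = (LINT x:{0..1}|lborel. g x * k x)" for k
      by (rule set_lebesgue_integral_cong) (auto simp: assms)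
    then show ?thesis
      by (intro ext) (simp add: has_weak_deriv_def)
  qed
  ultimately show "H1_01 f = H1_01 g" "dirichlet_01 f = dirichlet_01 g"
    by (auto simp: H1_01_def dirichlet_01_def)
qed

text \<open>The function climbs from \<open>s\<close> to \<open>t\<close>, stays at one until 3/4
  and descends with slope 4 to zero at 1. Vanishing at both ends, it can be continued by zero off
  its segment. The slopes contribute \<open>1 / (t - s)\<close> and 4, which is at most
  \<open>5 / (t - s)\<close> as \<open>t - s < 1\<close>.\<close>

lemma trapezoid_01:
  fixes s t :: real
  assumes st: "0 \<le> s" "s < t" "t \<le> 3 / 4"
  obtains f where "continuous_on {0..1} f" "H1_01 f" "dirichlet_01 f \<le> 5 / (t - s)"
    "f 0 = 0" "f 1 = 0" "f s = 0" "f t = 1"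
proof -
  define f where "f x = max 0 (min ((x - s) / (t - s)) (min 1 (4 * (1 - x))))" for x
  define g where "g x = (1 / (t - s)) * indicator {s<..<t} x - 4 * indicator {3/4<..1} x" for x :: real
  have c: "continuous_on A f" for A
    unfolding f_def using st by (intro continuous_intros) auto
  have d: "(f has_real_derivative g x) (at x)" if x: "x \<in> {0<..<1} - {s, t, 3/4}" for x
  proof -
    have *: "(f has_real_derivative g x) (at x)"
      if "open T" "x \<in> T" "\<And>y. y \<in> T \<Longrightarrow> a + g x * (y - x) = f y" for T a
      by (rule has_field_derivative_transform_within_open[OF _ that]) (auto intro!: derivative_eq_intros)
    consider "x < s" | "s < x" "x < t" | "t < x" "x < 3/4" | "3/4 < x" "x < 1"
      using x by fastforce
    then show ?thesis
    proof cases
      case 1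
      show ?thesis
        by (rule *[where T = "{..<s}" and a = 0])
          (use 1 st in \<open>auto simp: f_def g_def max_def min_def field_simps\<close>)
    next
      case 2
      show ?thesis
      proof (rule *[where T = "{s<..<t}" and a = "(x - s) / (t - s)"])
        fix y assume y: "y \<in> {s<..<t}"
        then have "0 \<le> (y - s) / (t - s)" "(y - s) / (t - s) \<le> 1" "1 \<le> 4 * (1 - y)"
          using st by (auto simp: field_simps)
        then have "f y = (y - s) / (t - s)"
          by (simp add: f_def)
        then show "(x - s) / (t - s) + g x * (y - x) = f y"
          using 2 st by (simp add: g_def diff_divide_distrib)
      qed (use 2 in auto)
    next
      case 3
      show ?thesis
        by (rule *[where T = "{t<..<3/4}" and a = 1])
          (use 3 st in \<open>auto simp: f_def g_def max_def min_def field_simps\<close>)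
    next
      case 4
      show ?thesis
      proof (rule *[where T = "{3/4<..<1}" and a = "4 * (1 - x)"])
        fix y :: real assume y: "y \<in> {3/4<..<1}"
        then have "1 \<le> (y - s) / (t - s)"
          using st by (auto simp: field_simps)
        then have "f y = 4 * (1 - y)"
          using y by (auto simp: f_def)
        moreover have "g x = - 4"
          using 4 st by (auto simp: g_def)
        ultimately show "4 * (1 - x) + g x * (y - x) = f y"
          by (simp add: algebra_simps)
      qed (use 4 in auto)
    qed
  qed
  have gm: "g \<in> borel_measurable borel"
    unfolding g_def by measurable
  have gb: "\<bar>g x\<bar> \<le> 1 / (t - s) + 4" if "x \<in> {0..1}" for x
    using st by (auto simp: g_def indicator_def)
  have fin: "finite {s, t, 3/4}" by simp
  note p = H1_01_piecewise[OF c gm gb fin d]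
  have "(LINT x:{0..1}|lborel. (g x)\<^sup>2) =
      (LINT x|lborel. (1 / (t - s))\<^sup>2 * indicator {s<..<t} x + 16 * indicator {3/4<..1} x)"
    unfolding set_lebesgue_integral_def
    using st by (intro Bochner_Integration.integral_cong) (auto simp: g_def indicator_def)
  also have "\<dots> = (1 / (t - s))\<^sup>2 * (t - s) + 4"
    using st by (subst Bochner_Integration.integral_add) auto
  also have "\<dots> \<le> 5 / (t - s)"
    using st by (simp add: power2_eq_square field_simps)
  finally have "dirichlet_01 f \<le> 5 / (t - s)"
    using p(2) by simp
  moreover have "- (s / (t - s)) \<le> 0" using st by simp
  then have "f 0 = 0" by (simp add: f_def)
  ultimately show thesis
    using st by (intro that[of f] c p(1)) (auto simp: f_def)
qed

section \<open>Codes and cells of the self-similar set\<close>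

lemma word_map_Nil [simp]: "word_map F [] = id"
  by (simp add: word_map_def)

lemma word_map_Cons [simp]: "word_map F (i # w) x = F i (word_map F w x)"
  by (simp add: word_map_def)

lemma word_map_append: "word_map F (v @ w) x = word_map F v (word_map F w x)"
  by (induction v) auto

context self_similar_set
begin

lemma mem_all_words: "w \<in> all_words \<longleftrightarrow> set w \<subseteq> {1..N}"
  by (auto simp: all_words_def words_def)

lemma mem_nonempty_words: "w \<in> nonempty_words \<longleftrightarrow> w \<noteq> [] \<and> set w \<subseteq> {1..N}"
proof
  assume "w \<noteq> [] \<and> set w \<subseteq> {1..N}"
  then have "w \<in> words (length w)" "length w \<in> {1..}"
    by (auto simp: words_def Suc_le_eq)
  then show "w \<in> nonempty_words" unfolding nonempty_words_def by blast
qed (auto simp: nonempty_words_def words_def)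

lemma words_0 [simp]: "words 0 = {[]}"
  by (auto simp: words_def)

lemma words_Suc: "words (Suc n) = (\<lambda>(i, w). i # w) ` ({1..N} \<times> words n)"
  by (auto simp: words_def length_Suc_conv image_iff)

lemma words_subset: "words n \<subseteq> all_words"
  by (auto simp: all_words_def)

lemma finite_words [simp]: "finite (words n)"
  by (induction n) (auto simp: words_Suc)

lemma inj_on_Cons_pair: "inj_on (\<lambda>(i, w). i # w) A"
  by (auto simp: inj_on_def)

lemma card_words: "card (words n) = N ^ n"
  by (induction n) (auto simp: words_Suc card_image inj_on_Cons_pair card_cartesian_product)

lemma sum_words_Suc:
  "(\<Sum>w\<in>words (Suc n). f w) = (\<Sum>i\<in>{1..N}. \<Sum>w\<in>words n. f (i # w))"
  unfolding words_Suc by (subst sum.reindex[OF inj_on_Cons_pair])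
    (simp add: sum.cartesian_product comp_def case_prod_unfold)

lemma F_inj: "i \<in> {1..N} \<Longrightarrow> F i x = F i y \<longleftrightarrow> x = y"
  by (metis dist_eq_0_iff mult_eq_0_iff order_less_irrefl similitude)

lemma F_in_X: "i \<in> {1..N} \<Longrightarrow> x \<in> X \<Longrightarrow> F i x \<in> X"
  by (subst X_self_similar) blast

lemma X_cases:
  assumes "x \<in> X"
  obtains i y where "i \<in> {1..N}" "y \<in> X" "x = F i y"
  using assms X_self_similar by blast

lemma word_map_F_in_X: "w \<in> all_words \<Longrightarrow> x \<in> X \<Longrightarrow> word_map F w x \<in> X"
  by (induction w) (auto simp: mem_all_words intro!: F_in_X)

lemma F_contraction:
  obtains s where "0 \<le> s" "s < 1"
    "\<And>w x y. w \<in> all_words \<Longrightarrow> dist (word_map F w x) (word_map F w y) \<le> s ^ length w * dist x y"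
proof -
  obtain r where r: "\<And>i. i \<in> {1..N} \<Longrightarrow> 0 < r i \<and> r i < 1 \<and> (\<forall>x y. dist (F i x) (F i y) = r i * dist x y)"
    using similitude by metis
  define s where "s = Max (r ` {1..N})"
  have ne: "{1..N} \<noteq> {}" using N_ge_2 by auto
  have s: "r i \<le> s" if "i \<in> {1..N}" for i
    unfolding s_def using that by auto
  have "s \<in> r ` {1..N}"
    unfolding s_def using ne by (intro Max_in) auto
  then have s01: "0 \<le> s" "s < 1" using r by (auto simp: less_imp_le)
  have "dist (word_map F w x) (word_map F w y) \<le> s ^ length w * dist x y" if "w \<in> all_words" for w x y
    using that
  proof (induction w)
    case (Cons i w)
    then have i: "i \<in> {1..N}" "w \<in> all_words" by (auto simp: mem_all_words)
    have "dist (word_map F (i # w) x) (word_map F (i # w) y) = r i * dist (word_map F w x) (word_map F w y)"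
      using r[OF i(1)] by simp
    also have "\<dots> \<le> s * (s ^ length w * dist x y)"
      using Cons.IH[OF i(2)] s[OF i(1)] r[OF i(1)] s01 by (intro mult_mono) auto
    finally show ?case by simp
  qed simp
  then show ?thesis using s01 that by blast
qed

lemma critical_subset_X: "critical \<subseteq> X"
  unfolding critical_def by (auto intro: F_in_X)

lemma criticalI: "i \<in> {1..N} \<Longrightarrow> j \<in> {1..N} \<Longrightarrow> i \<noteq> j \<Longrightarrow> x \<in> F i ` X \<Longrightarrow> x \<in> F j ` X \<Longrightarrow> x \<in> critical"
  unfolding critical_def by blast

text \<open>Otherwise the cells inside and outside \<open>A\<close> would split X into two disjoint
  nonempty closed sets. Connectedness of X thus becomes connectedness of the intersection graph of
  the first-level cells.\<close>

lemma cells_connected: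
  assumes A: "A \<subseteq> {1..N}" "A \<noteq> {}"
    and step: "\<And>i j. i \<in> A \<Longrightarrow> j \<in> {1..N} \<Longrightarrow> F i ` X \<inter> F j ` X \<noteq> {} \<Longrightarrow> j \<in> A"
  shows "A = {1..N}"
proof (rule ccontr)
  assume "A \<noteq> {1..N}"
  then have B: "{1..N} - A \<noteq> {}" using A by auto
  have cont: "continuous_on X (F i)" if i: "i \<in> {1..N}" for i
  proof -
    obtain s where s: "0 < s" "\<And>x y. dist (F i x) (F i y) = s * dist x y"
      using similitude[OF i] by metis
    show ?thesis
      unfolding continuous_on_iff
    proof (intro ballI allI impI)
      fix x :: 'a and e :: real assume "0 < e"
      then show "\<exists>d>0. \<forall>x'\<in>X. dist x' x < d \<longrightarrow> dist (F i x') (F i x) < e"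
        using s by (intro exI[of _ "e / s"]) (auto simp: field_simps)
    qed
  qed
  have clo: "closed (\<Union>i\<in>C. F i ` X)" if "C \<subseteq> {1..N}" for C
    by (intro closed_UN ballI compact_imp_closed compact_continuous_image cont X_compact finite_subset[OF that])
      (use that in auto)
  have "closed (\<Union>i\<in>A. F i ` X)" "closed (\<Union>i\<in>{1..N} - A. F i ` X)"
    using clo[OF A(1)] clo[of "{1..N} - A"] by blast+
  moreover have "X \<subseteq> (\<Union>i\<in>A. F i ` X) \<union> (\<Union>i\<in>{1..N} - A. F i ` X)"
  proof
    fix x assume "x \<in> X"
    then obtain i y where "i \<in> {1..N}" "y \<in> X" "x = F i y" by (rule X_cases)
    then show "x \<in> (\<Union>i\<in>A. F i ` X) \<union> (\<Union>i\<in>{1..N} - A. F i ` X)"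
      by (cases "i \<in> A") auto
  qed
  moreover have "(\<Union>i\<in>A. F i ` X) \<inter> (\<Union>i\<in>{1..N} - A. F i ` X) \<inter> X = {}"
    using step by blast
  moreover have "(\<Union>i\<in>A. F i ` X) \<inter> X \<noteq> {}" "(\<Union>i\<in>{1..N} - A. F i ` X) \<inter> X \<noteq> {}"
  proof -
    obtain x where "x \<in> X" using X_nonempty by blast
    moreover obtain i j where "i \<in> A" "j \<in> {1..N} - A" using A B by blast
    ultimately have "F i x \<in> (\<Union>i\<in>A. F i ` X) \<inter> X" "F j x \<in> (\<Union>i\<in>{1..N} - A. F i ` X) \<inter> X"
      using A F_in_X by auto
    then show "(\<Union>i\<in>A. F i ` X) \<inter> X \<noteq> {}" "(\<Union>i\<in>{1..N} - A. F i ` X) \<inter> X \<noteq> {}"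
      by auto
  qed
  ultimately show False
    using connected_closedD[OF X_connected] by metis
qed

lemma critical_nonempty: "critical \<noteq> {}"
proof
  assume "critical = {}"
  have "{1} = {1..N}"
  proof (rule cells_connected)
    fix i j assume "i \<in> {1 :: nat}" "j \<in> {1..N}" "F i ` X \<inter> F j ` X \<noteq> {}"
    then show "j \<in> {1}"
      using criticalI[of i j] N_ge_2 \<open>critical = {}\<close> by fastforce
  qed (use N_ge_2 in auto)
  moreover have "2 \<in> {1..N}" using N_ge_2 by simp
  ultimately have "2 \<in> {1 :: nat}" by simp
  then show False by simp
qed

lemma is_code_exists:
  assumes "x \<in> X"
  shows "\<exists>\<omega>. is_code \<omega> x"
proof -
  obtain i y where iy: "\<And>x. x \<in> X \<Longrightarrow> i x \<in> {1..N} \<and> y x \<in> X \<and> x = F (i x) (y x)"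
    by (metis X_cases)
  have yX: "(y ^^ n) x \<in> X" for n
    by (induction n) (use assms iy in auto)
  have "x = word_map F (map (\<lambda>k. i ((y ^^ k) x)) [0..<n]) ((y ^^ n) x)" for n
  proof (induction n)
    case (Suc n)
    have "(y ^^ n) x = F (i ((y ^^ n) x)) ((y ^^ Suc n) x)"
      using iy[OF yX[of n]] by simp
    then show ?case
      using Suc.IH by (simp add: word_map_append)
  qed simp
  then have "is_code (\<lambda>k. i ((y ^^ k) x)) x"
    unfolding is_code_def using yX iy by (auto intro!: image_eqI)
  then show ?thesis by blast
qed

lemma is_code_unique:
  assumes "is_code \<omega> x" "is_code \<omega> y"
  shows "x = y"
proof (rule ccontr)
  assume "x \<noteq> y"
  obtain s where s: "0 \<le> s" "s < 1"
    "\<And>w x y. w \<in> all_words \<Longrightarrow> dist (word_map F w x) (word_map F w y) \<le> s ^ length w * dist x y"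
    using F_contraction by blast
  have "dist x y \<le> s ^ n * diameter X" for n
  proof -
    have w: "map \<omega> [0..<n] \<in> all_words"
      using assms(1) by (auto simp: mem_all_words is_code_def)
    obtain x' y' where xy: "x' \<in> X" "y' \<in> X" "x = word_map F (map \<omega> [0..<n]) x'" "y = word_map F (map \<omega> [0..<n]) y'"
      using assms unfolding is_code_def by blast
    have "dist x y \<le> s ^ n * dist x' y'"
      using s(3)[OF w] xy by simp
    also have "\<dots> \<le> s ^ n * diameter X"
      using xy s by (intro mult_left_mono diameter_bounded_bound compact_imp_bounded X_compact) auto
    finally show ?thesis .
  qed
  moreover have "(\<lambda>n. s ^ n * diameter X) \<longlonglongrightarrow> 0 * diameter X"
    by (intro tendsto_intros LIMSEQ_realpow_zero s)
  ultimately have "dist x y \<le> 0"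
    by (intro LIMSEQ_le_const) auto
  then show False using \<open>x \<noteq> y\<close> by simp
qed

text \<open>Every cell containing a point appears as a prefix of some code of that point, so cells
  at a point can be counted by counting codes.\<close>

lemma is_code_prepend:
  assumes "is_code \<omega> y" "v \<in> all_words"
  shows "\<exists>\<eta>. is_code \<eta> (word_map F v y) \<and> map \<eta> [0..<length v] = v \<and> (\<lambda>k. \<eta> (k + length v)) = \<omega>"
  using assms(2)
proof (induction v)
  case Nil
  then show ?case using assms(1) by auto
next
  case (Cons i v)
  then obtain \<eta> where \<eta>: "is_code \<eta> (word_map F v y)" "map \<eta> [0..<length v] = v" "(\<lambda>k. \<eta> (k + length v)) = \<omega>"
    by (auto simp: mem_all_words)
  have i: "i \<in> {1..N}" using Cons by (auto simp: mem_all_words)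
  have map: "map (case_nat i \<eta>) [0..<Suc n] = i # map \<eta> [0..<n]" for n
    by (simp add: upt_rec[of 0] map_Suc_upt[symmetric] comp_def del: upt_Suc)
  have cell: "word_map F (i # v) y \<in> word_map F (map (case_nat i \<eta>) [0..<n]) ` X" for n
  proof (cases n)
    case 0
    have "word_map F v y \<in> word_map F (map \<eta> [0..<0]) ` X"
      using \<eta>(1) unfolding is_code_def by blast
    then show ?thesis using 0 i by (auto intro: F_in_X)
  next
    case (Suc m)
    have "word_map F v y \<in> word_map F (map \<eta> [0..<m]) ` X"
      using \<eta>(1) unfolding is_code_def by blast
    then show ?thesis unfolding Suc map by auto
  qed
  have "range (case_nat i \<eta>) \<subseteq> {1..N}"
  proof -
    have "\<eta> k \<in> {1..N}" for k using \<eta>(1) unfolding is_code_def by blast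
    then show ?thesis using i by (force split: nat.splits)
  qed
  then have "is_code (case_nat i \<eta>) (word_map F (i # v) y)"
    unfolding is_code_def using cell by (intro conjI allI)
  moreover have "map (case_nat i \<eta>) [0..<length (i # v)] = i # v"
    using map[of "length v"] \<eta>(2) by simp
  moreover have "(\<lambda>k. (case_nat i \<eta>) (k + length (i # v))) = \<omega>"
    using \<eta>(3) by auto
  ultimately show ?case by (intro exI conjI)
qed

end

section \<open>Consequences of finitely many post-critical codes\<close>

context pcf_set
begin

text \<open>A code is determined by its first letter together with its shift, and the shift of a
  critical code is post-critical.\<close>

lemma finite_critical_codes: "finite critical_codes"
proof -
  have sub: "(\<lambda>\<omega>. (\<omega> 0, \<lambda>k. \<omega> (k + 1))) ` critical_codes \<subseteq> {1..N} \<times> postcritical_codes"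
  proof
    fix z assume "z \<in> (\<lambda>\<omega>. (\<omega> 0, \<lambda>k. \<omega> (k + 1))) ` critical_codes"
    then obtain \<omega> where \<omega>: "\<omega> \<in> critical_codes" "z = (\<omega> 0, \<lambda>k. \<omega> (k + 1))" by blast
    have "range \<omega> \<subseteq> {1..N}"
      using \<omega>(1) unfolding critical_codes_def is_code_def by blast
    moreover have "(\<lambda>k. \<omega> (k + 1)) \<in> postcritical_codes"
      unfolding postcritical_codes_def using \<omega>(1) by (intro UN_I[of 1] imageI) auto
    ultimately show "z \<in> {1..N} \<times> postcritical_codes"
      using \<omega>(2) by blast
  qed
  have "inj_on (\<lambda>\<omega>. (\<omega> 0, \<lambda>k. \<omega> (k + 1))) (critical_codes :: (nat \<Rightarrow> nat) set)"
  proof (rule inj_onI, rule ext)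
    fix \<omega> \<eta> :: "nat \<Rightarrow> nat" and k
    assume pair: "(\<omega> 0, \<lambda>k. \<omega> (k + 1)) = (\<eta> 0, \<lambda>k. \<eta> (k + 1))"
    have 0: "\<omega> 0 = \<eta> 0"
      using arg_cong[OF pair, of fst] by (simp only: fst_conv)
    have eq: "(\<lambda>k. \<omega> (k + 1)) = (\<lambda>k. \<eta> (k + 1))"
      using arg_cong[OF pair, of snd] by (simp only: snd_conv)
    show "\<omega> k = \<eta> k"
      using 0 fun_cong[OF eq, of "k - 1"] by (cases k) simp_all
  qed
  moreover have "finite ({1..N} \<times> postcritical_codes)"
    by (intro finite_cartesian_product finite_atLeastAtMost post_critically_finite)
  ultimately show ?thesis
    using finite_imageD[OF finite_subset[OF sub]] by (simp only:)
qed

lemma finite_coded: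
  assumes "finite C" "\<And>x. x \<in> A \<Longrightarrow> \<exists>\<omega>\<in>C. is_code \<omega> x"
  shows "finite A"
proof (rule finite_surj[OF assms(1)])
  show "A \<subseteq> (\<lambda>\<omega>. THE x. is_code \<omega> x) ` C"
  proof
    fix x assume "x \<in> A"
    then obtain \<omega> where "\<omega> \<in> C" "is_code \<omega> x" using assms(2) by blast
    then have "(THE x. is_code \<omega> x) = x"
      using is_code_unique by (intro the_equality) auto
    then show "x \<in> (\<lambda>\<omega>. THE x. is_code \<omega> x) ` C"
      using \<open>\<omega> \<in> C\<close> by force
  qed
qed

lemma finite_critical: "finite critical"
proof (rule finite_coded[OF finite_critical_codes])
  fix c assume "c \<in> critical"
  then show "\<exists>\<omega>\<in>critical_codes. is_code \<omega> c"
    using is_code_exists critical_subset_X unfolding critical_codes_def by blast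
qed

lemma finite_postcritical: "finite postcritical"
proof (rule finite_coded[OF post_critically_finite])
  fix x assume "x \<in> postcritical"
  then obtain w where w: "x \<in> X" "w \<in> nonempty_words" "word_map F w x \<in> critical"
    by (auto simp: postcritical_def)
  obtain \<omega> where \<omega>: "is_code \<omega> x" using is_code_exists w by blast
  have "w \<in> all_words" using w by (auto simp: mem_all_words mem_nonempty_words)
  then obtain \<eta> where \<eta>: "is_code \<eta> (word_map F w x)" "(\<lambda>k. \<eta> (k + length w)) = \<omega>"
    using is_code_prepend[OF \<omega>] by blast
  then have "\<eta> \<in> critical_codes" using w by (auto simp: critical_codes_def)
  moreover have "length w \<in> {1..}" using w by (auto simp: mem_nonempty_words Suc_le_eq)
  ultimately have "\<omega> \<in> postcritical_codes"
    unfolding postcritical_codes_def using \<eta>(2) by blast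
  then show "\<exists>\<omega>\<in>postcritical_codes. is_code \<omega> x" using \<omega> by blast
qed

text \<open>The bound is the same for all levels. If two of the words differ in the first letter,
  the point is critical and all the words are prefixes of its codes; otherwise the common first
  letter is stripped by injectivity of its map, which lowers the level. The 1 in the maximum
  accounts for level zero.\<close>

lemma card_cells_at_point:
  "card {v \<in> words n. x \<in> word_map F v ` X} \<le> max 1 (card critical_codes)"
proof (induction n arbitrary: x)
  case 0
  have "card {v \<in> words 0. x \<in> word_map F v ` X} \<le> card {[] :: nat list}"
    by (rule card_mono) auto
  then show ?case by simp
next
  case (Suc n)
  define W where "W = {v \<in> words (Suc n). x \<in> word_map F v ` X}"
  have Wcell: "hd v \<in> {1..N} \<and> x \<in> F (hd v) ` X" if vW: "v \<in> W" for v
  proof -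
    obtain i v' where "v = i # v'" "i \<in> {1..N}" "v' \<in> words n"
      using vW by (auto simp: W_def words_Suc)
    moreover obtain z where "z \<in> X" "x = word_map F v z"
      using vW by (auto simp: W_def)
    ultimately have v: "v = i # v'" "i \<in> {1..N}" "v' \<in> words n" "z \<in> X" "x = word_map F v z"
      by auto
    have "word_map F v' z \<in> X"
      using v(3,4) words_subset by (intro word_map_F_in_X) auto
    then show ?thesis using v by auto
  qed
  show ?case
  proof (cases "\<exists>v\<in>W. \<exists>v'\<in>W. hd v \<noteq> hd v'")
    case True
    then have x: "x \<in> critical"
      using Wcell criticalI by metis
    have "W \<subseteq> (\<lambda>\<omega>. map \<omega> [0..<Suc n]) ` critical_codes"
    proof
      fix v assume v: "v \<in> W"
      then obtain y where y: "y \<in> X" "x = word_map F v y" by (auto simp: W_def)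
      have v': "v \<in> all_words" "length v = Suc n" using v by (auto simp: W_def words_def mem_all_words)
      obtain \<omega> where "is_code \<omega> y" using is_code_exists y by blast
      then obtain \<eta> where "is_code \<eta> x" "map \<eta> [0..<length v] = v"
        using is_code_prepend[OF _ v'(1)] y by metis
      then show "v \<in> (\<lambda>\<omega>. map \<omega> [0..<Suc n]) ` critical_codes"
        using x v'(2) unfolding critical_codes_def by (intro image_eqI[of _ _ \<eta>]) auto
    qed
    then have "card W \<le> card critical_codes"
      by (rule surj_card_le[OF finite_critical_codes])
    then show ?thesis by (simp add: W_def)
  next
    case False
    show ?thesis
    proof (cases "W = {}")
      case False
      then obtain v0 where v0: "v0 \<in> W" by blast
      define i where "i = hd v0"
      obtain y where y: "y \<in> X" "x = F i y" and i: "i \<in> {1..N}"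
        using Wcell[OF v0] by (auto simp: i_def)
      have "W \<subseteq> (#) i ` {v \<in> words n. y \<in> word_map F v ` X}"
      proof
        fix v assume v: "v \<in> W"
        then have "hd v = i" using \<open>\<not> (\<exists>v\<in>W. \<exists>v'\<in>W. hd v \<noteq> hd v')\<close> v0 i_def by metis
        then obtain v' where v': "v = i # v'" "v' \<in> words n"
          using v by (auto simp: W_def words_Suc)
        obtain z where "z \<in> X" "x = word_map F v z" using v by (auto simp: W_def)
        then have "y = word_map F v' z" using v' y F_inj[OF i] by simp
        then show "v \<in> (#) i ` {v \<in> words n. y \<in> word_map F v ` X}"
          using v' \<open>z \<in> X\<close> by auto
      qed
      then have "card W \<le> card {v \<in> words n. y \<in> word_map F v ` X}"
        by (rule surj_card_le[rotated]) auto
      then show ?thesis using Suc.IH[of y] by (simp add: W_def)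
    qed (simp add: W_def[symmetric])
  qed
qed

end

section \<open>Cells and segments of the stretched fractal\<close>

context stretched_fractal
begin

lemma dist_G: "dist (G i x) (G i y) = \<alpha> * dist (F i x) (F i y)"
  using alpha by (simp add: G_def dist_norm scaleR_diff_right[symmetric])

lemma G_inj: "i \<in> {1..N} \<Longrightarrow> G i x = G i y \<longleftrightarrow> x = y"
  by (metis F_inj alpha(1) dist_G dist_eq_0_iff mult_eq_0_iff order_less_irrefl)

lemma dist_G_le:
  assumes "i \<in> {1..N}"
  shows "dist (G i x) (G i y) \<le> \<alpha> * dist x y"
proof -
  obtain s where s: "s < 1" "dist (F i x) (F i y) = s * dist x y"
    using similitude[OF assms] by blast
  have "s * dist x y \<le> 1 * dist x y"
    using s by (intro mult_right_mono) auto
  then show ?thesis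
    using alpha s by (simp add: dist_G)
qed

lemma G_continuous:
  assumes "i \<in> {1..N}"
  shows "continuous_on A (G i)"
  unfolding continuous_on_iff
proof (intro ballI allI impI)
  fix x :: 'a and e :: real assume "0 < e"
  have "dist (G i y) (G i x) \<le> dist y x" for y
  proof -
    have "\<alpha> * dist y x \<le> 1 * dist y x"
      using alpha by (intro mult_right_mono) auto
    then show ?thesis using dist_G_le[OF assms, of y x] by simp
  qed
  then show "\<exists>d>0. \<forall>y\<in>A. dist y x < d \<longrightarrow> dist (G i y) (G i x) < e"
    using \<open>0 < e\<close> le_less_trans by (intro exI[of _ e]) blast
qed

lemma G_q: "i \<in> {1..N} \<Longrightarrow> G i (q i) = q i"
  by (simp add: G_def fixed_point)

lemma G_in_K: "i \<in> {1..N} \<Longrightarrow> x \<in> K \<Longrightarrow> G i x \<in> K"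
  by (subst K_eq) blast

lemma word_map_G_in_K: "w \<in> all_words \<Longrightarrow> x \<in> K \<Longrightarrow> word_map G w x \<in> K"
  by (induction w) (auto simp: mem_all_words intro!: G_in_K)

lemma K_cases:
  assumes "x \<in> K"
  obtains (cell) i y where "i \<in> {1..N}" "y \<in> K" "x = G i y"
    | (segment) c l where "(c, l) \<in> edges1" "x \<in> seg c l"
proof -
  have "x \<in> (\<Union>i\<in>{1..N}. G i ` K) \<union> (\<Union>c\<in>critical. \<Union>l\<in>{1..mult c}. seg c l)"
    using assms K_eq by simp
  then show thesis
    using cell segment unfolding edges1_def by fast
qed

text \<open>Iterating the contraction \<open>G i\<close> from any point of the closed invariant set
  K converges to the fixed point.\<close>

lemma q_in_K:
  assumes i: "i \<in> {1..N}"
  shows "q i \<in> K"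
proof -
  obtain x where x: "x \<in> K" using K_nonempty by blast
  have inK: "(G i ^^ n) x \<in> K" for n
    by (induction n) (use x G_in_K[OF i] in auto)
  have "dist ((G i ^^ n) x) (q i) \<le> \<alpha> ^ n * dist x (q i)" for n
  proof (induction n)
    case (Suc n)
    have "dist ((G i ^^ Suc n) x) (q i) \<le> \<alpha> * dist ((G i ^^ n) x) (q i)"
      using dist_G_le[OF i, of "(G i ^^ n) x" "q i"] G_q[OF i] by simp
    also have "\<dots> \<le> \<alpha> * (\<alpha> ^ n * dist x (q i))"
      using Suc.IH alpha by (intro mult_left_mono) auto
    finally show ?case by simp
  qed simp
  then have le: "\<forall>\<^sub>F n in sequentially. dist ((G i ^^ n) x) (q i) \<le> \<alpha> ^ n * dist x (q i)"
    by (intro always_eventually allI)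
  have ge: "\<forall>\<^sub>F n in sequentially. 0 \<le> dist ((G i ^^ n) x) (q i)"
    by (intro always_eventually allI zero_le_dist)
  have "(\<lambda>n. \<alpha> ^ n * dist x (q i)) \<longlonglongrightarrow> 0 * dist x (q i)"
    using alpha by (intro tendsto_intros LIMSEQ_realpow_zero) auto
  then have lim: "(\<lambda>n. \<alpha> ^ n * dist x (q i)) \<longlonglongrightarrow> 0" by simp
  have "(\<lambda>n. dist ((G i ^^ n) x) (q i)) \<longlonglongrightarrow> 0"
    by (rule tendsto_sandwich[OF ge le tendsto_const lim])
  then have "(\<lambda>n. (G i ^^ n) x) \<longlonglongrightarrow> q i"
    by (rule iffD2[OF tendsto_dist_iff])
  then show ?thesis
    by (rule closed_sequentially[OF compact_imp_closed[OF K_compact] inK])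
qed

lemma cell_unique:
  assumes "i \<in> {1..N}" "j \<in> {1..N}" "x \<in> K" "y \<in> K" "G i x = G j y"
  shows "i = j" "x = y"
proof -
  show "i = j"
    using copies_disjoint[OF assms(1,2)] assms by blast
  then show "x = y" using assms G_inj by simp
qed

lemma word_cell_unique:
  assumes "v \<in> all_words" "w \<in> all_words" "length v = length w" "x \<in> K" "y \<in> K"
    "word_map G v x = word_map G w y"
  shows "v = w" "x = y"
proof -
  have "v = w \<and> x = y"
    using assms
  proof (induction v arbitrary: w)
    case (Cons i v)
    then obtain j w' where w: "w = j # w'" by (cases w) auto
    have ij: "i \<in> {1..N}" "j \<in> {1..N}" "v \<in> all_words" "w' \<in> all_words"
      using Cons.prems w by (auto simp: mem_all_words)
    have eq: "G i (word_map G v x) = G j (word_map G w' y)"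
      using Cons.prems w by simp
    note u = cell_unique[OF ij(1,2) word_map_G_in_K[OF ij(3)] word_map_G_in_K[OF ij(4)] eq]
    show ?case
      using Cons.IH[OF ij(3,4)] Cons.prems u w by auto
  qed auto
  then show "v = w" "x = y" by auto
qed

section \<open>Passing from stretched points to the points of X below them\<close>

lemma word_map_G_replicate: "i \<in> {1..N} \<Longrightarrow> word_map G (replicate k i) (q i) = q i"
  by (induction k) (auto simp: G_q)

lemma word_map_F_replicate: "i \<in> {1..N} \<Longrightarrow> word_map F (replicate k i) (q i) = q i"
  by (induction k) (auto simp: fixed_point)

text \<open>The code of a point of \<open>\<Sigma>\<close> is unique, so unstretching is well defined.\<close>

lemma unstretch:
  assumes "a \<in> all_words" "b \<in> all_words" "i \<in> {1..N}" "j \<in> {1..N}"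
    and "word_map G a (q i) = word_map G b (q j)"
  shows "word_map F a (q i) = word_map F b (q j)"
proof -
  have *: "word_map F a (q i) = word_map F b (q j)"
    if "length a \<le> length b" "a \<in> all_words" "b \<in> all_words" "i \<in> {1..N}" "j \<in> {1..N}"
      "word_map G a (q i) = word_map G b (q j)" for a b i j
  proof -
    \<comment> \<open>Padding with the letter \<open>i\<close> changes neither the stretched nor the
      unstretched point, since \<open>q i\<close> is fixed by both maps. With words of equal length,
      disjointness of the copies applies.\<close>
    define a' where "a' = a @ replicate (length b - length a) i"
    have a': "a' \<in> all_words" "length a' = length b"
      using that by (auto simp: a'_def mem_all_words)
    have "word_map G a' (q i) = word_map G b (q j)"
      using that by (simp add: a'_def word_map_append word_map_G_replicate)
    then have "a' = b" "q i = q j"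
      using word_cell_unique[OF a'(1) that(3) a'(2) q_in_K q_in_K] that by auto
    then have "word_map F a' (q i) = word_map F b (q j)" by simp
    then show ?thesis
      using that by (simp add: a'_def word_map_append word_map_F_replicate)
  qed
  show ?thesis
  proof (cases "length a \<le> length b")
    case False
    then show ?thesis using *[of b a j i] assms by auto
  qed (use * assms in auto)
qed

lemma postcritical_choice':
  assumes "p \<in> postcritical"
  shows "pw p \<in> all_words" "pj p \<in> {1..N}" "word_map F (pw p) (q (pj p)) = p"
  using postcritical_choice[OF assms] by auto

lemma postcritical_subset_X: "postcritical \<subseteq> X"
  by (auto simp: postcritical_def)

lemma edges1D:
  assumes "(c, l) \<in> edges1"
  shows "c \<in> critical" "l \<in> {1..mult c}" "cw c l \<noteq> []" "cw c l \<in> all_words" "ci c l \<in> {1..N}"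
    "q (ci c l) \<in> postcritical" "word_map F (cw c l) (q (ci c l)) = c"
proof -
  show 1: "c \<in> critical" "l \<in> {1..mult c}"
    using assms by (auto simp: edges1_def)
  show "cw c l \<noteq> []" "cw c l \<in> all_words" "ci c l \<in> {1..N}"
    "q (ci c l) \<in> postcritical" "word_map F (cw c l) (q (ci c l)) = c"
    using critical_choice[OF 1] by (auto simp: mem_nonempty_words mem_all_words)
qed

lemma finite_V0 [simp]: "finite V0"
  by (simp add: V0_def finite_postcritical)

lemma finite_E0 [simp]: "finite E0"
proof -
  have "E0 \<subseteq> Pow V0" by (auto simp: E0_def)
  then show ?thesis by (rule finite_subset) simp
qed

lemma finite_V1 [simp]: "finite V1"
  by (simp add: V1_def finite_critical)

lemma finite_edges1 [simp]: "finite edges1"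
  by (simp add: edges1_def finite_critical)

lemma hat_in_K: "p \<in> postcritical \<Longrightarrow> hat p \<in> K"
  unfolding hat_def by (intro word_map_G_in_K q_in_K postcritical_choice')

lemma V0_subset_K: "V0 \<subseteq> K"
  by (auto simp: V0_def hat_in_K)

lemma attach_in_cell:
  assumes "(c, l) \<in> edges1"
  shows "hd (cw c l) \<in> {1..N}" "attach c l \<in> G (hd (cw c l)) ` K"
proof -
  obtain i w where w: "cw c l = i # w" using edges1D(3)[OF assms] by (cases "cw c l") auto
  have iw: "i \<in> {1..N}" "w \<in> all_words" using edges1D(4)[OF assms] w by (auto simp: mem_all_words)
  have "word_map G w (q (ci c l)) \<in> K"
    by (intro word_map_G_in_K q_in_K iw edges1D(5)[OF assms])
  then show "hd (cw c l) \<in> {1..N}" "attach c l \<in> G (hd (cw c l)) ` K"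
    using w iw by (auto simp: attach_def)
qed

lemma seg_subset_K:
  assumes "(c, l) \<in> edges1"
  shows "seg c l \<subseteq> K"
proof -
  have "seg c l \<subseteq> (\<Union>c\<in>critical. \<Union>l\<in>{1..mult c}. seg c l)"
    using edges1D(1,2)[OF assms] by blast
  then show ?thesis by (subst K_eq) (rule le_supI2)
qed

lemma hat_in_cell:
  assumes "p \<in> postcritical"
  shows "\<exists>i\<in>{1..N}. hat p \<in> G i ` K"
proof (cases "pw p")
  case Nil
  then have "hat p = G (pj p) (q (pj p))"
    by (simp only: hat_def Nil G_q[OF postcritical_choice'(2)[OF assms]] word_map_Nil id_apply)
  then show ?thesis
    using postcritical_choice'(2)[OF assms] q_in_K[OF postcritical_choice'(2)[OF assms]] by blast
next
  case (Cons i w)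
  then have "i \<in> {1..N}" "w \<in> all_words" "hat p = G i (word_map G w (q (pj p)))"
    using postcritical_choice'[OF assms] by (auto simp: hat_def mem_all_words)
  moreover have "word_map G w (q (pj p)) \<in> K"
    by (intro word_map_G_in_K q_in_K postcritical_choice'(2)[OF assms]) fact
  ultimately show ?thesis by blast
qed

lemma V0_not_critical: "V0 \<inter> critical = {}"
proof -
  have "hat p \<notin> critical" if p: "p \<in> postcritical" for p
  proof -
    obtain i where "i \<in> {1..N}" "hat p \<in> G i ` K" using hat_in_cell[OF p] by blast
    then show ?thesis using copies_critical[of i] by blast
  qed
  then show ?thesis unfolding V0_def by blast
qed

text \<open>Coherence puts the vertex into \<open>V1\<close>, and lying in a copy of K it cannot be
  one of the critical points there. So the vertex set is contained in the union of its first-level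
  copies, which is what recursive constructions require.\<close>

lemma V0_cell:
  assumes "p \<in> postcritical"
  shows "\<exists>i\<in>{1..N}. \<exists>p'\<in>postcritical. hat p = G i (hat p')"
proof -
  have "hat p \<in> V0" using assms by (simp add: V0_def)
  then have "hat p \<in> (\<Union>i\<in>{1..N}. G i ` V0)"
    using V0_in_V1 V0_not_critical unfolding V1_def by blast
  then show ?thesis by (auto simp: V0_def)
qed

lemma attach_cell:
  assumes "(c, l) \<in> edges1"
  shows "\<exists>p'\<in>postcritical. attach c l = G (hd (cw c l)) (hat p')"
proof -
  note a = attach_in_cell[OF assms]
  have "attach c l \<notin> critical"
    using a(2) copies_critical[OF a(1)] by blast
  then have "attach c l \<in> (\<Union>i\<in>{1..N}. G i ` V0)"
    using attach_in_V1[OF assms] unfolding V1_def by blast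
  then obtain j p where j: "j \<in> {1..N}" "p \<in> postcritical" "attach c l = G j (hat p)"
    by (auto simp: V0_def)
  obtain y where "y \<in> K" "attach c l = G (hd (cw c l)) y" using a(2) by blast
  then have "j = hd (cw c l)"
    using cell_unique(1)[OF j(1) a(1) hat_in_K[OF j(2)], of y] j(3) by simp
  then show ?thesis using j by blast
qed

lemma hat_inj:
  assumes "p \<in> postcritical" "p' \<in> postcritical" "hat p = hat p'"
  shows "p = p'"
  using unstretch[OF postcritical_choice'(1)[OF assms(1)] postcritical_choice'(1)[OF assms(2)]
      postcritical_choice'(2)[OF assms(1)] postcritical_choice'(2)[OF assms(2)]] assms
  by (simp add: hat_def postcritical_choice')

lemma hat_G_hat:
  assumes "p \<in> postcritical" "p' \<in> postcritical" "i \<in> {1..N}" "hat p = G i (hat p')"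
  shows "p = F i p'"
proof -
  have iw: "i # pw p' \<in> all_words"
    using assms postcritical_choice'(1)[OF assms(2)] by (auto simp: mem_all_words)
  show ?thesis
    using unstretch[OF postcritical_choice'(1)[OF assms(1)] iw
        postcritical_choice'(2)[OF assms(1)] postcritical_choice'(2)[OF assms(2)]] assms
    by (simp add: hat_def postcritical_choice')
qed

text \<open>Both ends of a segment lie over the same point \<open>c\<close> of X. A function read
  off from points of X therefore takes equal values at the two ends.\<close>

lemma attach_G_hat:
  assumes "(c, l) \<in> edges1" "p \<in> postcritical" "i \<in> {1..N}" "attach c l = G i (hat p)"
  shows "c = F i p"
proof -
  have iw: "i # pw p \<in> all_words"
    using assms postcritical_choice'(1)[OF assms(2)] by (auto simp: mem_all_words)
  show ?thesis
    using unstretch[OF edges1D(4)[OF assms(1)] iw edges1D(5)[OF assms(1)] postcritical_choice'(2)[OF assms(2)]] assms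
    by (simp add: hat_def attach_def postcritical_choice' edges1D(7))
qed

text \<open>A count: the chosen first letters are distinct, belong to cells containing
  \<open>c\<close>, and are as many as these cells.\<close>

lemma critical_letter:
  assumes "c \<in> critical" "i \<in> {1..N}" "c \<in> F i ` X"
  obtains l where "(c, l) \<in> edges1" "hd (cw c l) = i"
proof -
  let ?I = "{i \<in> {1..N}. c \<in> F i ` X}"
  have sub: "(\<lambda>l. hd (cw c l)) ` {1..mult c} \<subseteq> ?I"
  proof
    fix i assume "i \<in> (\<lambda>l. hd (cw c l)) ` {1..mult c}"
    then obtain l where l: "l \<in> {1..mult c}" "i = hd (cw c l)" by blast
    then have e: "(c, l) \<in> edges1" using assms by (auto simp: edges1_def)
    obtain w where w: "cw c l = i # w" using edges1D(3)[OF e] l by (cases "cw c l") auto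
    have iw: "i \<in> {1..N}" "w \<in> all_words" using edges1D(4)[OF e] w by (auto simp: mem_all_words)
    have "c = F i (word_map F w (q (ci c l)))" using edges1D(7)[OF e] w by simp
    moreover have "word_map F w (q (ci c l)) \<in> X"
      using iw edges1D(6)[OF e] postcritical_subset_X by (intro word_map_F_in_X) auto
    ultimately show "i \<in> ?I" using iw by blast
  qed
  have "card ((\<lambda>l. hd (cw c l)) ` {1..mult c}) = mult c"
    using card_image[OF first_letters_distinct[OF assms(1)]] by simp
  then have "(\<lambda>l. hd (cw c l)) ` {1..mult c} = ?I"
    using sub by (intro card_subset_eq) (auto simp: mult_def)
  then have "i \<in> (\<lambda>l. hd (cw c l)) ` {1..mult c}" using assms by simp
  then show thesis using that assms(1) by (auto simp: edges1_def)
qed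

lemma critical_has_edge:
  assumes "c \<in> critical"
  obtains l where "(c, l) \<in> edges1"
proof -
  obtain i where "i \<in> {1..N}" "c \<in> F i ` X"
    using assms unfolding critical_def by blast
  then obtain l where "(c, l) \<in> edges1"
    by (rule critical_letter[OF assms])
  then show thesis by (rule that)
qed

lemma postcritical_nonempty: "postcritical \<noteq> {}"
proof -
  obtain c where "c \<in> critical" using critical_nonempty by blast
  then obtain l where "(c, l) \<in> edges1" by (rule critical_has_edge)
  then show ?thesis using edges1D(6) by blast
qed

lemma V0_nonempty: "V0 \<noteq> {}"
  using postcritical_nonempty by (simp add: V0_def)

section \<open>Where segments and copies meet\<close>

lemma param_0 [simp]: "param c l 0 = attach c l"
  by (simp add: param_def)

lemma param_1 [simp]: "param c l 1 = c"
  by (simp add: param_def)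

lemma seg_eq: "seg c l = param c l ` {0..1}"
  unfolding seg_def param_def closed_segment_image_interval by (auto simp: algebra_simps image_iff)

lemma param_in_K: "(c, l) \<in> edges1 \<Longrightarrow> t \<in> {0..1} \<Longrightarrow> param c l t \<in> K"
  using seg_subset_K[of c l] unfolding seg_eq by blast

lemma param_inj:
  assumes "(c, l) \<in> edges1"
  shows "param c l s = param c l t \<longleftrightarrow> s = t"
proof -
  have "attach c l \<noteq> c"
    using seg_nondegenerate edges1D(1,2)[OF assms] by blast
  moreover have "param c l s - param c l t = (s - t) *\<^sub>R (c - attach c l)"
    by (simp add: param_def algebra_simps)
  ultimately show ?thesis
    by (metis eq_iff_diff_eq_0 scaleR_eq_0_iff)
qed

lemma param_continuous: "continuous_on A (param c l)"
  unfolding param_def by (intro continuous_intros)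

lemma param_in_cell:
  assumes "(c, l) \<in> edges1" "t \<in> {0..1}" "i \<in> {1..N}" "param c l t \<in> G i ` K"
  shows "t = 0"
proof -
  have "param c l t \<in> seg c l" using assms(2) by (simp add: seg_eq)
  then have "param c l t = attach c l"
    using seg_copies[OF edges1D(1,2)[OF assms(1)]] assms(3,4) by blast
  then show ?thesis using param_inj[OF assms(1), of t 0] by simp
qed

text \<open>Distinct segments share at most their critical end, at parameter 1, whereas copies are
  met at parameter 0 only. These are all the overlaps that gluing has to respect.\<close>

lemma param_eq_param:
  assumes "(c, l) \<in> edges1" "(c', l') \<in> edges1" "s \<in> {0..1}" "t \<in> {0..1}"
    "param c l s = param c' l' t"
  shows "c = c' \<and> l = l' \<and> s = t \<or> c = c' \<and> s = 1 \<and> t = 1"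
proof (cases "(c, l) = (c', l')")
  case True
  then show ?thesis using param_inj assms by auto
next
  case False
  have "param c l s \<in> seg c l \<inter> seg c' l'"
    using assms unfolding seg_eq by (metis IntI imageI)
  then have "param c l s \<in> (if c = c' then {c} else {})"
    using seg_seg[OF assms(1,2) False] by blast
  then have "c = c'" "param c l s = c" "param c' l' t = c'"
    using assms(5) by (auto split: if_splits)
  then show ?thesis
    using param_inj[OF assms(1), of s 1] param_inj[OF assms(2), of t 1] by simp
qed

end

section \<open>Energies along a sequence of harmonic structures\<close>

lemma Max_minus_Min_pair: "Max (g ` {x, y}) - Min (g ` {x, y}) = \<bar>g x - g y :: real\<bar>"
  by (simp add: max_def min_def)

context stretching_data
begin

lemma E0_cases:
  assumes "e \<in> E0"
  obtains x y where "e = {x, y}" "x \<in> V0" "y \<in> V0" "x \<noteq> y"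
  using assms unfolding E0_def by blast

lemma osc_edge_le:
  assumes "e \<in> E0" "\<And>x y. x \<in> V0 \<Longrightarrow> y \<in> V0 \<Longrightarrow> \<bar>g x - g y\<bar> \<le> \<bar>h x - h y\<bar>"
  shows "(Max (g ` e) - Min (g ` e))\<^sup>2 \<le> (Max (h ` e) - Min (h ` e :: real set))\<^sup>2"
proof -
  obtain x y where e: "e = {x, y}" "x \<in> V0" "y \<in> V0" using assms(1) by (rule E0_cases)
  show ?thesis
    unfolding e(1) Max_minus_Min_pair using assms(2)[OF e(2,3)] by (simp add: abs_le_square_iff)
qed

lemma conductance_nonneg: "0 < r0 e \<Longrightarrow> 0 \<le> real_of_ereal (1 / (r0 e :: ereal))"
  by (intro real_of_ereal_pos) (simp add: ereal_divide_ereal less_imp_le)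

lemma Q_Sigma_nonneg: "\<forall>e\<in>E0. 0 < r0 e \<Longrightarrow> 0 \<le> Q_Sigma r0 g"
  unfolding Q_Sigma_def by (intro sum_nonneg mult_nonneg_nonneg conductance_nonneg) auto

lemma Q_Sigma_mono:
  assumes "\<forall>e\<in>E0. 0 < r0 e"
    and "\<And>x y. x \<in> V0 \<Longrightarrow> y \<in> V0 \<Longrightarrow> \<bar>g x - g y\<bar> \<le> \<bar>h x - h y\<bar>"
  shows "Q_Sigma r0 g \<le> Q_Sigma r0 h"
  unfolding Q_Sigma_def using assms
  by (intro sum_mono mult_right_mono osc_edge_le conductance_nonneg) auto

lemma Q_Sigma_cong:
  assumes "\<And>x. x \<in> V0 \<Longrightarrow> g x = h x"
  shows "Q_Sigma r0 g = Q_Sigma r0 h"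
  unfolding Q_Sigma_def
proof (rule sum.cong[OF refl])
  fix e assume "e \<in> E0"
  then obtain x y where "e = {x, y}" "x \<in> V0" "y \<in> V0" by (rule E0_cases)
  then have "g ` e = h ` e" using assms by auto
  then show "(Max (g ` e) - Min (g ` e))\<^sup>2 * real_of_ereal (1 / r0 e) =
      (Max (h ` e) - Min (h ` e))\<^sup>2 * real_of_ereal (1 / r0 e)" by simp
qed

lemma Q_Sigma_const: "(\<And>x. x \<in> V0 \<Longrightarrow> g x = c) \<Longrightarrow> Q_Sigma r0 g = 0"
proof -
  assume "\<And>x. x \<in> V0 \<Longrightarrow> g x = c"
  then have "Q_Sigma r0 g = Q_Sigma r0 (\<lambda>_. c)" by (rule Q_Sigma_cong)
  also have "\<dots> = 0"
    unfolding Q_Sigma_def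
  proof (rule sum.neutral, rule ballI)
    fix e assume "e \<in> E0"
    then obtain x y where "e = {x, y}" by (rule E0_cases)
    then show "(Max ((\<lambda>_. c) ` e) - Min ((\<lambda>_. c) ` e))\<^sup>2 * real_of_ereal (1 / r0 e) = 0"
      by simp
  qed
  finally show ?thesis .
qed

lemma Q_Sigma_indicator_le:
  assumes "\<forall>e\<in>E0. 0 < r0 e" "\<And>x. x \<in> V0 \<Longrightarrow> g x = 0 \<or> g x = 1"
  shows "Q_Sigma r0 g \<le> (\<Sum>e\<in>E0. real_of_ereal (1 / r0 e))"
  unfolding Q_Sigma_def
proof (rule sum_mono)
  fix e assume e: "e \<in> E0"
  then obtain x y where xy: "e = {x, y}" "x \<in> V0" "y \<in> V0" by (rule E0_cases)
  have "(Max (g ` e) - Min (g ` e))\<^sup>2 \<le> 1"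
    unfolding xy(1) Max_minus_Min_pair using assms(2)[OF xy(2)] assms(2)[OF xy(3)] by auto
  then show "(Max (g ` e) - Min (g ` e))\<^sup>2 * real_of_ereal (1 / r0 e) \<le> real_of_ereal (1 / r0 e)"
    using conductance_nonneg[of r0 e] assms(1) e by (intro mult_left_le_one_le) auto
qed

lemma Q1_nonneg:
  assumes "\<forall>e\<in>E0. 0 < r0 e" "0 < lam" "\<forall>e\<in>edges1. 0 < rho e"
  shows "0 \<le> Q1 r0 lam rho f"
  unfolding Q1_def using assms
  by (intro add_nonneg_nonneg mult_nonneg_nonneg sum_nonneg Q_Sigma_nonneg) (auto simp: less_imp_le)

lemma harmonic_structureD:
  assumes "harmonic_structure r0 lam rho"
  shows "\<forall>e\<in>E0. 0 < r0 e" "0 < lam" "lam < 1" "\<forall>e\<in>edges1. 0 < rho e"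
    "\<And>x y. x \<in> V0 \<Longrightarrow> y \<in> V0 \<Longrightarrow> (x, y) \<in> {(a, b). {a, b} \<in> E0 \<and> r0 {a, b} < \<infinity>}\<^sup>*"
    "\<And>g. Inf {Q1 r0 lam rho f | f. \<forall>x\<in>V0. f x = g x} = Q_Sigma r0 g"
  using assms unfolding harmonic_structure_def by blast+

text \<open>\<open>f\<close> itself competes in the minimisation with its own boundary
  values.\<close>

lemma Q_Sigma_le_Q1:
  assumes "harmonic_structure r0 lam rho"
  shows "Q_Sigma r0 f \<le> Q1 r0 lam rho f"
proof -
  have "Inf {Q1 r0 lam rho f' | f'. \<forall>x\<in>V0. f' x = f x} \<le> Q1 r0 lam rho f"
    using Q1_nonneg[OF harmonic_structureD(1,2,4)[OF assms]]
    by (intro cInf_lower bdd_belowI[of _ 0]) auto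
  then show ?thesis using harmonic_structureD(6)[OF assms] by simp
qed

lemma Q1_ge_cells:
  assumes "harmonic_structure r0 lam rho"
  shows "(\<Sum>i\<in>{1..N}. Q_Sigma r0 (f \<circ> G i)) \<le> lam * Q1 r0 lam rho f"
proof -
  note h = harmonic_structureD[OF assms]
  have "0 \<le> (\<Sum>(c, l)\<in>edges1. (f c - f (attach c l))\<^sup>2 / rho (c, l))"
    using h(4) by (intro sum_nonneg) (auto simp: less_imp_le)
  then show ?thesis
    unfolding Q1_def using h(2) by (simp add: distrib_left)
qed

lemma Q1_ge_cell:
  assumes "harmonic_structure r0 lam rho" "i \<in> {1..N}"
  shows "Q_Sigma r0 (f \<circ> G i) \<le> lam * Q1 r0 lam rho f"
proof -
  have "Q_Sigma r0 (f \<circ> G i) \<le> (\<Sum>i\<in>{1..N}. Q_Sigma r0 (f \<circ> G i))"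
    using assms(2) by (intro member_le_sum Q_Sigma_nonneg[OF harmonic_structureD(1)[OF assms(1)]]) auto
  then show ?thesis using Q1_ge_cells[OF assms(1), of f] by linarith
qed

text \<open>The regularity half of membership in the form domain, kept apart from finiteness of
  energy so that it passes to cells and to glued functions. \<open>K\<close> is an argument because
  this context does not fix it yet.\<close>

definition admissible :: "'a set \<Rightarrow> ('a \<Rightarrow> real) \<Rightarrow> bool" where
  "admissible K u \<longleftrightarrow> continuous_on K u \<and>
     (\<forall>(c, l)\<in>edges1. \<forall>w\<in>all_words. H1_01 (u \<circ> (word_map G w \<circ> param c l)))"

lemma energy_n_lessThan:
  "energy_n r0 lam rho n u =
     1 / (\<Prod>i<n. lam (Suc i)) * (\<Sum>w\<in>words n. Q_Sigma r0 (u \<circ> word_map G w)) +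
     (\<Sum>m<n. 1 / (\<Prod>i<m. lam (Suc i)) * (\<Sum>w\<in>words m. D (rho (Suc m)) (u \<circ> word_map G w)))"
proof -
  have "prod lam {Suc 0..<Suc m} = (\<Prod>i<m. lam (Suc i))" for m
    by (simp add: atLeastLessThanSuc_atLeastAtMost prod.atLeast1_atMost_eq)
  then show ?thesis
    unfolding energy_n_def D_level_def
    by (simp add: sum.atLeast1_atMost_eq prod.atLeast1_atMost_eq)
qed

lemma energy_n_0: "energy_n r0 lam rho 0 u = Q_Sigma r0 u"
  by (simp add: energy_n_lessThan)

lemma comp_word_map_Cons: "u \<circ> word_map G (i # w) = (u \<circ> G i) \<circ> word_map G w"
  by (auto simp: fun_eq_iff)

text \<open>Splitting words at the first letter expresses the energy through the first-level copies,
  each with the sequence shifted by one. Later inductions follow this recursion with the shift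
  generalised.\<close>

lemma energy_n_Suc:
  "energy_n r0 lam rho (Suc n) u =
     1 / lam 1 * (\<Sum>i\<in>{1..N}. energy_n r0 (\<lambda>i. lam (Suc i)) (\<lambda>i. rho (Suc i)) n (u \<circ> G i)) +
     D (rho 1) u"
proof -
  let ?P = "\<lambda>n. \<Prod>i<n. lam (Suc (Suc i))"
  let ?Q = "\<lambda>i. \<Sum>w\<in>words n. Q_Sigma r0 ((u \<circ> G i) \<circ> word_map G w)"
  let ?D = "\<lambda>i m. \<Sum>w\<in>words m. D (rho (Suc (Suc m))) ((u \<circ> G i) \<circ> word_map G w)"
  have P: "(\<Prod>i<Suc n. lam (Suc i)) = lam 1 * ?P n" for n
    by (simp only: prod.lessThan_Suc_shift) simp
  have "(\<Sum>m<Suc n. 1 / (\<Prod>i<m. lam (Suc i)) * (\<Sum>w\<in>words m. D (rho (Suc m)) (u \<circ> word_map G w)))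
      = D (rho 1) u + (\<Sum>m<n. 1 / (lam 1 * ?P m) * (\<Sum>i\<in>{1..N}. ?D i m))"
    by (simp only: sum.lessThan_Suc_shift P sum_words_Suc comp_word_map_Cons) simp
  moreover have "(\<Sum>m<n. 1 / (lam 1 * ?P m) * (\<Sum>i\<in>{1..N}. ?D i m)) =
      1 / lam 1 * (\<Sum>i\<in>{1..N}. \<Sum>m<n. 1 / ?P m * ?D i m)"
    by (subst sum.swap) (simp add: sum_distrib_left mult.assoc)
  moreover have "1 / (\<Prod>i<Suc n. lam (Suc i)) * (\<Sum>w\<in>words (Suc n). Q_Sigma r0 (u \<circ> word_map G w)) =
      1 / lam 1 * (\<Sum>i\<in>{1..N}. 1 / ?P n * ?Q i)"
    by (simp only: P sum_words_Suc comp_word_map_Cons) (simp add: sum_distrib_left mult.assoc)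
  ultimately show ?thesis
    unfolding energy_n_lessThan by (simp add: sum.distrib distrib_left)
qed

lemma D_nonneg: "\<forall>e\<in>edges1. 0 < rho e \<Longrightarrow> 0 \<le> D rho u"
  unfolding D_def by (intro sum_nonneg) (auto simp: dirichlet_01_nonneg less_imp_le)

lemma D_ge:
  assumes "finite edges1" "\<forall>e\<in>edges1. 0 < rho e" "(c, l) \<in> edges1"
  shows "dirichlet_01 (u \<circ> param c l) \<le> rho (c, l) * D rho u"
proof -
  have "(\<lambda>(c, l). 1 / rho (c, l) * dirichlet_01 (u \<circ> param c l)) (c, l) \<le> D rho u"
    unfolding D_def using assms
    by (intro member_le_sum) (auto simp: dirichlet_01_nonneg less_imp_le)
  moreover have "0 < rho (c, l)" using assms by blast
  ultimately show ?thesis by (simp add: field_simps)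
qed

lemma energy_n_cong:
  assumes "\<And>x. x \<in> K \<Longrightarrow> u x = v x" "V0 \<subseteq> K" "\<And>i x. i \<in> {1..N} \<Longrightarrow> x \<in> K \<Longrightarrow> G i x \<in> K"
    "\<And>c l t. (c, l) \<in> edges1 \<Longrightarrow> t \<in> {0..1} \<Longrightarrow> param c l t \<in> K"
  shows "energy_n r0 lam rho n u = energy_n r0 lam rho n v"
  using assms(1)
proof (induction n arbitrary: u v lam rho)
  case 0
  then show ?case
    using assms(2) by (auto simp: energy_n_0 intro!: Q_Sigma_cong)
next
  case (Suc n)
  have "D (rho 1) u = D (rho 1) v"
    unfolding D_def using Suc.prems assms(4)
    by (intro sum.cong) (auto intro!: H1_01_cong(2))
  moreover have "energy_n r0 (\<lambda>i. lam (Suc i)) (\<lambda>i. rho (Suc i)) n (u \<circ> G i) =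
      energy_n r0 (\<lambda>i. lam (Suc i)) (\<lambda>i. rho (Suc i)) n (v \<circ> G i)" if "i \<in> {1..N}" for i
    using Suc.prems assms(3)[OF that] by (intro Suc.IH) simp
  ultimately show ?case
    by (simp add: energy_n_Suc)
qed

end

context stretched_fractal
begin

lemma admissible_G:
  assumes "admissible K u" "i \<in> {1..N}"
  shows "admissible K (u \<circ> G i)"
  unfolding admissible_def
proof (intro conjI ballI)
  have "G i ` K \<subseteq> K" using G_in_K[OF assms(2)] by blast
  then have "continuous_on (G i ` K) u"
    using assms(1) continuous_on_subset unfolding admissible_def by blast
  then show "continuous_on K (u \<circ> G i)"
    by (intro continuous_on_compose G_continuous assms(2))
  fix e assume e: "e \<in> edges1"
  obtain c l where cl: "e = (c, l)" by (cases e)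
  have "H1_01 ((u \<circ> G i) \<circ> (word_map G w \<circ> param c l))" if "w \<in> all_words" for w
  proof -
    have "i # w \<in> all_words" using that assms(2) by (auto simp: mem_all_words)
    then have "H1_01 (u \<circ> (word_map G (i # w) \<circ> param c l))"
      using assms(1) e cl unfolding admissible_def by blast
    moreover have "u \<circ> (word_map G (i # w) \<circ> param c l) = (u \<circ> G i) \<circ> (word_map G w \<circ> param c l)"
      by (auto simp: fun_eq_iff)
    ultimately show ?thesis by simp
  qed
  then show "case e of (c, l) \<Rightarrow> \<forall>w\<in>all_words. H1_01 (u \<circ> G i \<circ> (word_map G w \<circ> param c l))"
    using cl by simp
qed

lemma admissible_word_map:
  assumes "admissible K u" "w \<in> all_words"
  shows "admissible K (u \<circ> word_map G w)"
  using assms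
proof (induction w arbitrary: u)
  case (Cons i w)
  then show ?case
    using Cons.IH[OF admissible_G[of u i]] by (simp add: comp_word_map_Cons mem_all_words)
qed simp

lemma admissible_segment:
  assumes "admissible K u" "(c, l) \<in> edges1"
  shows "continuous_on {0..1} (u \<circ> param c l)" "H1_01 (u \<circ> param c l)"
    "s \<in> {0..1} \<Longrightarrow> t \<in> {0..1} \<Longrightarrow>
      (u (param c l t) - u (param c l s))\<^sup>2 \<le> \<bar>t - s\<bar> * dirichlet_01 (u \<circ> param c l)"
proof -
  have "param c l ` {0..1} \<subseteq> K" using param_in_K[OF assms(2)] by blast
  then have "continuous_on (param c l ` {0..1}) u"
    using assms(1) continuous_on_subset unfolding admissible_def by blast
  then show 1: "continuous_on {0..1} (u \<circ> param c l)"
    by (intro continuous_on_compose param_continuous)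
  have "[] \<in> all_words" by (simp add: mem_all_words)
  then have "H1_01 (u \<circ> (word_map G [] \<circ> param c l))"
    using assms unfolding admissible_def by blast
  then show 2: "H1_01 (u \<circ> param c l)" by simp
  show "(u (param c l t) - u (param c l s))\<^sup>2 \<le> \<bar>t - s\<bar> * dirichlet_01 (u \<circ> param c l)"
    if "s \<in> {0..1}" "t \<in> {0..1}"
    using dirichlet_01_bound[OF 2 1 that] by simp
qed

text \<open>Along a segment the squared difference of the end values is at most the Dirichlet
  integral: the affine interpolation minimises it.\<close>

lemma Q1_le_energy:
  assumes "harmonic_structure r0 lam rho" "admissible K u"
  shows "Q1 r0 lam rho u \<le> 1 / lam * (\<Sum>i\<in>{1..N}. Q_Sigma r0 (u \<circ> G i)) + D rho u"
proof -
  have "(u c - u (attach c l))\<^sup>2 / rho (c, l) \<le> 1 / rho (c, l) * dirichlet_01 (u \<circ> param c l)"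
    if "(c, l) \<in> edges1" for c l
  proof -
    have "(u c - u (attach c l))\<^sup>2 \<le> dirichlet_01 (u \<circ> param c l)"
      using admissible_segment(3)[OF assms(2) that, of 0 1] by simp
    moreover have "0 < rho (c, l)" using harmonic_structureD(4)[OF assms(1)] that by blast
    ultimately show ?thesis by (simp add: divide_right_mono)
  qed
  then have "(\<Sum>(c, l)\<in>edges1. (u c - u (attach c l))\<^sup>2 / rho (c, l)) \<le> D rho u"
    unfolding D_def by (intro sum_mono) auto
  then show ?thesis by (simp add: Q1_def)
qed

end

section \<open>Energies of the tails of a regular sequence\<close>

locale regular_sequence = stretched_fractal +
  fixes r0 :: "'a set \<Rightarrow> ereal" and lam :: "nat \<Rightarrow> real" and rho :: "nat \<Rightarrow> 'a \<times> nat \<Rightarrow> real"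
    and lam_max rho_max :: real
  assumes harmonic: "\<And>i. 1 \<le> i \<Longrightarrow> harmonic_structure r0 (lam i) (rho i)"
    and lam_le: "\<And>i. 1 \<le> i \<Longrightarrow> lam i \<le> lam_max"
    and lam_max_less: "lam_max < 1"
    and rho_le: "\<And>i e. 1 \<le> i \<Longrightarrow> e \<in> edges1 \<Longrightarrow> rho i e \<le> rho_max"
begin

text \<open>The form of the tail starting at \<open>Suc k\<close>; up to the factor
  \<open>1 / lam_prod 0 k\<close> it is the energy stored in a cell of level
  \<open>k\<close>.\<close>

definition shifted_energy :: "nat \<Rightarrow> nat \<Rightarrow> ('a \<Rightarrow> real) \<Rightarrow> real" where
  "shifted_energy k = energy_n r0 (\<lambda>i. lam (i + k)) (\<lambda>i. rho (i + k))"

definition lam_prod :: "nat \<Rightarrow> nat \<Rightarrow> real" where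
  "lam_prod k n = (\<Prod>i<n. lam (Suc (i + k)))"

lemma shifted_energy_0: "shifted_energy k 0 u = Q_Sigma r0 u"
  by (simp add: shifted_energy_def energy_n_0)

lemma shifted_energy_Suc:
  "shifted_energy k (Suc n) u =
     1 / lam (Suc k) * (\<Sum>i\<in>{1..N}. shifted_energy (Suc k) n (u \<circ> G i)) + D (rho (Suc k)) u"
  by (simp add: shifted_energy_def energy_n_Suc)

lemma shifted_energy_cong:
  "(\<And>x. x \<in> K \<Longrightarrow> u x = v x) \<Longrightarrow> shifted_energy k n u = shifted_energy k n v"
  unfolding shifted_energy_def
  by (rule energy_n_cong[where K = K]) (auto simp: V0_subset_K[THEN subsetD] G_in_K param_in_K)

lemma harmonic_Suc: "harmonic_structure r0 (lam (Suc k)) (rho (Suc k))"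
  by (intro harmonic) simp

lemmas lam_pos = harmonic_structureD(2)[OF harmonic_Suc]
lemmas r0_pos = harmonic_structureD(1)[OF harmonic_Suc]
lemmas rho_pos = harmonic_structureD(4)[OF harmonic_Suc]

lemma lam_prod_0 [simp]: "lam_prod k 0 = 1"
  by (simp add: lam_prod_def)

lemma lam_prod_Suc: "lam_prod k (Suc n) = lam (Suc k) * lam_prod (Suc k) n"
  unfolding lam_prod_def by (simp only: prod.lessThan_Suc_shift) simp

lemma lam_prod_pos: "0 < lam_prod k n"
  unfolding lam_prod_def by (intro prod_pos) (auto intro: lam_pos)

lemma shifted_energy_nonneg: "0 \<le> shifted_energy k n u"
proof (induction n arbitrary: k u)
  case 0
  then show ?case using Q_Sigma_nonneg[OF r0_pos] by (simp add: shifted_energy_0)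
next
  case (Suc n)
  then show ?case
    unfolding shifted_energy_Suc using lam_pos[of k]
    by (intro add_nonneg_nonneg mult_nonneg_nonneg sum_nonneg D_nonneg rho_pos) auto
qed

text \<open>The base case is the defining inequality of a harmonic structure combined with the
  segment estimate; the recursion over copies preserves the inequality.\<close>

lemma shifted_energy_mono_Suc:
  assumes "admissible K u"
  shows "shifted_energy k n u \<le> shifted_energy k (Suc n) u"
  using assms
proof (induction n arbitrary: k u)
  case 0
  have "shifted_energy k 0 u \<le> Q1 r0 (lam (Suc k)) (rho (Suc k)) u"
    using Q_Sigma_le_Q1[OF harmonic_Suc] by (simp add: shifted_energy_0)
  also have "\<dots> \<le> shifted_energy k (Suc 0) u"
    using Q1_le_energy[OF harmonic_Suc 0] by (simp add: shifted_energy_Suc shifted_energy_0)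
  finally show ?case .
next
  case (Suc n)
  show ?case
    unfolding shifted_energy_Suc[of k] using lam_pos[of k] Suc
    by (intro add_mono mult_left_mono sum_mono Suc.IH admissible_G order_refl) auto
qed

lemma shifted_energy_mono: "admissible K u \<Longrightarrow> n \<le> m \<Longrightarrow> shifted_energy k n u \<le> shifted_energy k m u"
  by (rule lift_Suc_mono_le[where f = "\<lambda>n. shifted_energy k n u"]) (auto intro: shifted_energy_mono_Suc)

lemma shifted_energy_cell:
  assumes "\<And>n. shifted_energy k n u \<le> B" "i \<in> {1..N}"
  shows "shifted_energy (Suc k) n (u \<circ> G i) \<le> lam (Suc k) * B"
proof -
  have "shifted_energy (Suc k) n (u \<circ> G i) \<le> (\<Sum>i\<in>{1..N}. shifted_energy (Suc k) n (u \<circ> G i))"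
    using assms(2) by (intro member_le_sum shifted_energy_nonneg) auto
  also have "\<dots> \<le> lam (Suc k) * shifted_energy k (Suc n) u"
    using lam_pos[of k] D_nonneg[OF rho_pos, of k u] by (simp add: shifted_energy_Suc distrib_left)
  also have "\<dots> \<le> lam (Suc k) * B"
    using assms(1) lam_pos[of k] by (intro mult_left_mono) auto
  finally show ?thesis .
qed

text \<open>Passing to a subcell multiplies an energy bound by the factor of that level. This is
  where the scaling of resistance by products of the lambdas originates.\<close>

lemma shifted_energy_word:
  assumes "\<And>n. shifted_energy k n u \<le> B" "w \<in> all_words"
  shows "shifted_energy (k + length w) n (u \<circ> word_map G w) \<le> lam_prod k (length w) * B"
  using assms
proof (induction w arbitrary: k u B n)
  case (Cons i w)
  then have i: "i \<in> {1..N}" "w \<in> all_words" by (auto simp: mem_all_words)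
  have "shifted_energy (Suc k + length w) n ((u \<circ> G i) \<circ> word_map G w) \<le>
      lam_prod (Suc k) (length w) * (lam (Suc k) * B)"
    by (rule Cons.IH[OF shifted_energy_cell[OF Cons.prems(1) i(1)] i(2)])
  then show ?case
    unfolding comp_word_map_Cons length_Cons lam_prod_Suc
    by (simp only: add_Suc add_Suc_right mult_ac)
qed simp

lemma dirichlet_le_energy:
  assumes "\<And>n. shifted_energy k n u \<le> B" "(c, l) \<in> edges1"
  shows "dirichlet_01 (u \<circ> param c l) \<le> rho_max * B"
proof -
  have "D (rho (Suc k)) u \<le> shifted_energy k (Suc 0) u"
    unfolding shifted_energy_Suc using lam_pos[of k]
    by (simp add: sum_nonneg shifted_energy_nonneg)
  then have D: "D (rho (Suc k)) u \<le> B" using assms(1)[of "Suc 0"] by linarith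
  have "dirichlet_01 (u \<circ> param c l) \<le> rho (Suc k) (c, l) * D (rho (Suc k)) u"
    by (rule D_ge[OF finite_edges1 rho_pos assms(2)])
  also have "\<dots> \<le> rho_max * B"
    using D D_nonneg[OF rho_pos, of k u] rho_le[of "Suc k" "(c, l)"] rho_pos[of k] assms(2)
    by (intro mult_mono) (auto intro: less_imp_le order_trans)
  finally show ?thesis .
qed

end

section \<open>Uniform oscillation bounds\<close>

lemma finite_uniform_bound:
  fixes d :: "'b \<Rightarrow> 'c \<Rightarrow> real"
  assumes "finite A" "\<And>z. z \<in> A \<Longrightarrow> \<exists>C\<ge>0. \<forall>j. d z j \<le> C * s j" "\<And>j. 0 \<le> s j"
  shows "\<exists>C\<ge>0. \<forall>z\<in>A. \<forall>j. d z j \<le> C * s j"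
  using assms(1,2)
proof (induction rule: finite_induct)
  case (insert a A)
  obtain C where C: "0 \<le> C" "\<And>j. d a j \<le> C * s j"
    using insert.prems[of a] by auto
  obtain C' where C': "0 \<le> C'" "\<And>z j. z \<in> A \<Longrightarrow> d z j \<le> C' * s j"
    using insert.IH insert.prems by auto
  have "d z j \<le> max C C' * s j" if "z \<in> insert a A" for z j
  proof -
    have "C * s j \<le> max C C' * s j" "C' * s j \<le> max C C' * s j"
      using assms(3)[of j] by (auto intro: mult_right_mono)
    then show ?thesis using that C(2)[of j] C'(2)[of z j] by (auto intro: order_trans)
  qed
  then show ?case using C(1) by (intro exI[of _ "max C C'"]) auto
qed auto

text \<open>Tychonoff. Functions on the finite vertex set are rendered as total functions, so the
  compact set of competitors below is a product over the whole space.\<close>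

lemma compact_fun_box:
  fixes A :: "'b \<Rightarrow> 'c::topological_space set"
  assumes "\<And>x. compact (A x)"
  shows "compact {f. \<forall>x. f x \<in> A x}"
proof -
  have "compactin (product_topology (\<lambda>_. euclidean) UNIV) (PiE UNIV A)"
    unfolding compactin_PiE using assms by simp
  then have "compact (PiE UNIV A)"
    by (simp add: euclidean_product_topology)
  moreover have "PiE UNIV A = {f. \<forall>x. f x \<in> A x}"
    by (auto simp: PiE_def Pi_def)
  ultimately show ?thesis by simp
qed

context stretching_data
begin

lemma Q_Sigma_continuous:
  "continuous_on UNIV (\<lambda>f :: 'a \<Rightarrow> real. Q_Sigma r0 (f \<circ> h))"
  unfolding Q_Sigma_def
proof (rule continuous_on_sum)
  fix e assume "e \<in> E0"
  then obtain x y where e: "e = {x, y}" by (rule E0_cases)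
  show "continuous_on UNIV (\<lambda>f. (Max ((f \<circ> h) ` e) - Min ((f \<circ> h) ` e))\<^sup>2 * real_of_ereal (1 / r0 e))"
    unfolding e Max_minus_Min_pair comp_apply
    by (intro continuous_intros continuous_on_product_coordinates)
qed

lemma Q1_continuous: "continuous_on UNIV (Q1 r0 lam rho)"
proof -
  have "continuous_on UNIV (\<lambda>f :: 'a \<Rightarrow> real. (f a - f b)\<^sup>2 / r)" for a b r
    unfolding divide_inverse by (intro continuous_intros continuous_on_product_coordinates)
  then show ?thesis
    unfolding Q1_def case_prod_unfold
    by (intro continuous_on_add continuous_on_mult_left continuous_on_sum Q_Sigma_continuous)
qed

end

context stretched_fractal
begin

lemma G_V0_in_V1: "i \<in> {1..N} \<Longrightarrow> x \<in> V0 \<Longrightarrow> G i x \<in> V1"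
  unfolding V1_def by blast

lemma Q1_mono:
  assumes "harmonic_structure r0 lam rho"
    and le: "\<And>x y. x \<in> V1 \<Longrightarrow> y \<in> V1 \<Longrightarrow> \<bar>g x - g y\<bar> \<le> \<bar>h x - h y\<bar>"
  shows "Q1 r0 lam rho g \<le> Q1 r0 lam rho h"
proof -
  note D = harmonic_structureD[OF assms(1)]
  have "Q_Sigma r0 (g \<circ> G i) \<le> Q_Sigma r0 (h \<circ> G i)" if "i \<in> {1..N}" for i
    using that by (intro Q_Sigma_mono D(1)) (auto intro!: le G_V0_in_V1)
  then have 1: "1 / lam * (\<Sum>i\<in>{1..N}. Q_Sigma r0 (g \<circ> G i)) \<le> 1 / lam * (\<Sum>i\<in>{1..N}. Q_Sigma r0 (h \<circ> G i))"
    using D(2) by (intro mult_left_mono sum_mono) auto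
  have "(g c - g (attach c l))\<^sup>2 / rho (c, l) \<le> (h c - h (attach c l))\<^sup>2 / rho (c, l)"
    if e: "(c, l) \<in> edges1" for c l
  proof (rule divide_right_mono)
    have "c \<in> V1" using edges1D(1)[OF e] by (simp add: V1_def)
    then show "(g c - g (attach c l))\<^sup>2 \<le> (h c - h (attach c l))\<^sup>2"
      using le attach_in_V1[OF e] by (simp add: abs_le_square_iff)
    show "0 \<le> rho (c, l)" using D(4) e by (auto simp: less_imp_le)
  qed
  then have "(\<Sum>(c, l)\<in>edges1. (g c - g (attach c l))\<^sup>2 / rho (c, l)) \<le>
      (\<Sum>(c, l)\<in>edges1. (h c - h (attach c l))\<^sup>2 / rho (c, l))"
    by (intro sum_mono) auto
  with 1 show ?thesis unfolding Q1_def by linarith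
qed

text \<open>A harmonic structure only prescribes an infimum; extensions need it attained. Clipping
  to the range of the boundary data and setting the values off \<open>V1\<close> to zero does not
  increase the form, so the search is confined to a compact box on which the form is
  continuous.\<close>

lemma Q1_minimizer:
  assumes h: "harmonic_structure r0 lam rho"
  shows "\<exists>f. (\<forall>x\<in>V0. f x = g x) \<and> Q1 r0 lam rho f = Q_Sigma r0 g"
proof -
  define M where "M = Max ((\<lambda>x. \<bar>g x\<bar>) ` V0)"
  have M: "\<bar>g x\<bar> \<le> M" if "x \<in> V0" for x
    unfolding M_def using that by (intro Max_ge) auto
  have "0 \<le> M" using V0_nonempty M abs_ge_zero order_trans by blast
  define A where "A x = (if x \<in> V0 then {g x} else if x \<in> V1 then {-M..M} else {0})" for x
  define S where "S = {f. \<forall>x. f x \<in> A x}"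
  have S: "compact S"
    unfolding S_def by (rule compact_fun_box) (simp add: A_def)
  have clip: "(\<lambda>x. if x \<in> V1 then max (-M) (min M (f x)) else 0) \<in> S"
    if "\<forall>x\<in>V0. f x = g x" for f
  proof -
    have "max (-M) (min M (f x)) = g x" if "x \<in> V0" for x
      using M[OF that] \<open>\<forall>x\<in>V0. f x = g x\<close> that by (auto simp: abs_le_iff)
    then show ?thesis
      using \<open>0 \<le> M\<close> V0_in_V1 by (auto simp: S_def A_def)
  qed
  have "S \<noteq> {}" using clip[of g] by blast
  moreover have "continuous_on S (Q1 r0 lam rho)"
    using Q1_continuous continuous_on_subset by blast
  ultimately obtain f0 where f0: "f0 \<in> S" "\<And>f. f \<in> S \<Longrightarrow> Q1 r0 lam rho f0 \<le> Q1 r0 lam rho f"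
    using continuous_attains_inf[OF S] by blast
  have f0g: "\<forall>x\<in>V0. f0 x = g x"
  proof
    fix x assume "x \<in> V0"
    moreover have "f0 x \<in> A x" using f0(1) by (simp add: S_def)
    ultimately show "f0 x = g x" by (simp add: A_def)
  qed
  have "Q1 r0 lam rho f0 \<le> Q1 r0 lam rho f" if "\<forall>x\<in>V0. f x = g x" for f
  proof -
    have "Q1 r0 lam rho f0 \<le> Q1 r0 lam rho (\<lambda>x. if x \<in> V1 then max (-M) (min M (f x)) else 0)"
      by (rule f0(2)[OF clip[OF that]])
    also have "\<dots> \<le> Q1 r0 lam rho f"
      by (rule Q1_mono[OF h]) (auto simp: max_def min_def)
    finally show ?thesis .
  qed
  then have "Q1 r0 lam rho f0 \<le> Inf {Q1 r0 lam rho f | f. \<forall>x\<in>V0. f x = g x}"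
    using f0g by (intro cInf_greatest) auto
  also have "\<dots> = Q_Sigma r0 g"
    by (rule harmonic_structureD(6)[OF h])
  finally have "Q1 r0 lam rho f0 \<le> Q_Sigma r0 g" .
  moreover have "Q_Sigma r0 g \<le> Q1 r0 lam rho f0"
    using Q_Sigma_le_Q1[OF h, of f0] Q_Sigma_cong[of f0 g r0] f0g by simp
  ultimately show ?thesis using f0g by (intro exI[of _ f0]) auto
qed

lemma edges1_nonempty: "edges1 \<noteq> {}"
proof -
  obtain c where "c \<in> critical" using critical_nonempty by blast
  then obtain l where "(c, l) \<in> edges1" by (rule critical_has_edge)
  then show ?thesis by blast
qed

end

context regular_sequence
begin

section \<open>Effective resistances in the first graph, uniformly in the level\<close>

abbreviation level_Q1 :: "nat \<Rightarrow> ('a \<Rightarrow> real) \<Rightarrow> real" where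
  "level_Q1 k \<equiv> Q1 r0 (lam (Suc k)) (rho (Suc k))"

lemma level_Q1_nonneg: "0 \<le> level_Q1 k f"
  by (rule Q1_nonneg[OF r0_pos lam_pos rho_pos])

lemma rho_max_pos: "0 < rho_max"
proof -
  obtain e where e: "e \<in> edges1" using edges1_nonempty by blast
  then have "0 < rho (Suc 0) e" using rho_pos by blast
  also have "\<dots> \<le> rho_max" using rho_le e by simp
  finally show ?thesis .
qed

lemma lam_max_pos: "0 < lam_max"
  using lam_pos[of 0] lam_le[of "Suc 0"] by linarith

text \<open>Each edge of finite resistance costs a constant, and these add up along the path. As
  \<open>r0\<close> is shared by the whole sequence, the constant does not see the level.\<close>

lemma V0_path_bound:
  assumes "(x, y) \<in> {(a, b). {a, b} \<in> E0 \<and> r0 {a, b} < \<infinity>}\<^sup>*"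
  shows "\<exists>C\<ge>0. \<forall>g. \<bar>g x - g y\<bar> \<le> C * sqrt (Q_Sigma r0 g)"
  using assms
proof (induction rule: rtrancl_induct)
  case base
  show ?case by (intro exI[of _ 0]) auto
next
  case (step y z)
  obtain C where C: "0 \<le> C" "\<And>g. \<bar>g x - g y\<bar> \<le> C * sqrt (Q_Sigma r0 g)"
    using step.IH by blast
  have yz: "{y, z} \<in> E0" "r0 {y, z} < \<infinity>" using step.hyps(2) by auto
  define \<kappa> where "\<kappa> = real_of_ereal (1 / r0 {y, z})"
  have "0 < r0 {y, z}" using r0_pos yz by blast
  then have \<kappa>: "0 < \<kappa>"
    using yz(2) unfolding \<kappa>_def by (cases "r0 {y, z}") (auto simp: one_ereal_def)
  have "\<bar>g y - g z\<bar> \<le> 1 / sqrt \<kappa> * sqrt (Q_Sigma r0 g)" for g :: "'a \<Rightarrow> real"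
  proof -
    have "(Max (g ` {y, z}) - Min (g ` {y, z}))\<^sup>2 * \<kappa> \<le> Q_Sigma r0 g"
      unfolding Q_Sigma_def \<kappa>_def using yz(1) r0_pos
      by (intro member_le_sum mult_nonneg_nonneg conductance_nonneg) auto
    then have "(g y - g z)\<^sup>2 * \<kappa> \<le> Q_Sigma r0 g"
      unfolding Max_minus_Min_pair by simp
    then have "sqrt ((g y - g z)\<^sup>2 * \<kappa>) \<le> sqrt (Q_Sigma r0 g)"
      by (rule real_sqrt_le_mono)
    then show ?thesis
      using \<kappa> by (simp add: real_sqrt_mult field_simps)
  qed
  then have "\<bar>g x - g z\<bar> \<le> (C + 1 / sqrt \<kappa>) * sqrt (Q_Sigma r0 g)" for g :: "'a \<Rightarrow> real"
    using C(2)[of g] by (smt (verit) distrib_right)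
  then show ?case
    using C(1) \<kappa> by (intro exI[of _ "C + 1 / sqrt \<kappa>"]) auto
qed

lemma V0_bound: "\<exists>C\<ge>0. \<forall>x\<in>V0. \<forall>y\<in>V0. \<forall>g. \<bar>g x - g y\<bar> \<le> C * sqrt (Q_Sigma r0 g)"
proof -
  have "\<exists>C\<ge>0. \<forall>z\<in>V0 \<times> V0. \<forall>g. (\<lambda>z g. \<bar>g (fst z) - g (snd z)\<bar>) z g \<le> C * sqrt (Q_Sigma r0 g)"
  proof (rule finite_uniform_bound)
    fix z assume "z \<in> V0 \<times> V0"
    then show "\<exists>C\<ge>0. \<forall>g. \<bar>g (fst z) - g (snd z)\<bar> \<le> C * sqrt (Q_Sigma r0 g)"
      by (intro V0_path_bound harmonic_structureD(5)[OF harmonic_Suc]) auto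
  qed (auto intro: Q_Sigma_nonneg[OF r0_pos])
  then show ?thesis by fastforce
qed

text \<open>Bounded effective resistance between two vertices, with one constant for all levels
  \<open>k\<close>.\<close>

definition linked :: "'a \<Rightarrow> 'a \<Rightarrow> bool" where
  "linked a b \<longleftrightarrow> (\<exists>C\<ge>0. \<forall>k f. \<bar>f a - f b\<bar> \<le> C * sqrt (level_Q1 k f))"

lemma linkedI: "0 \<le> C \<Longrightarrow> (\<And>k f. \<bar>f a - f b\<bar> \<le> C * sqrt (level_Q1 k f)) \<Longrightarrow> linked a b"
  unfolding linked_def by blast

lemma linked_sym: "linked a b \<Longrightarrow> linked b a"
  unfolding linked_def by (simp add: abs_minus_commute)

lemma linked_trans:
  assumes "linked a b" "linked b c"
  shows "linked a c"
proof -
  obtain C C' where C: "0 \<le> C" "\<And>k f. \<bar>f a - f b\<bar> \<le> C * sqrt (level_Q1 k f)"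
    and C': "0 \<le> C'" "\<And>k f. \<bar>f b - f c\<bar> \<le> C' * sqrt (level_Q1 k f)"
    using assms unfolding linked_def by blast
  show ?thesis
  proof (rule linkedI)
    fix k f
    show "\<bar>f a - f c\<bar> \<le> (C + C') * sqrt (level_Q1 k f)"
      using C(2)[of f k] C'(2)[of f k] by (smt (verit) distrib_right)
  qed (use C C' in simp)
qed

lemma linked_cell:
  assumes "i \<in> {1..N}" "x \<in> V0" "y \<in> V0"
  shows "linked (G i x) (G i y)"
proof -
  obtain C where C: "0 \<le> C" "\<And>x y g. x \<in> V0 \<Longrightarrow> y \<in> V0 \<Longrightarrow> \<bar>g x - g y\<bar> \<le> C * sqrt (Q_Sigma r0 g)"
    using V0_bound by blast
  show ?thesis
  proof (rule linkedI[OF C(1)])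
    fix k f
    have "Q_Sigma r0 (f \<circ> G i) \<le> lam (Suc k) * level_Q1 k f"
      by (rule Q1_ge_cell[OF harmonic_Suc assms(1)])
    also have "\<dots> \<le> 1 * level_Q1 k f"
      using harmonic_structureD(3)[OF harmonic_Suc, of k] level_Q1_nonneg by (intro mult_right_mono) auto
    finally have "C * sqrt (Q_Sigma r0 (f \<circ> G i)) \<le> C * sqrt (level_Q1 k f)"
      using C(1) by (intro mult_left_mono) auto
    then show "\<bar>f (G i x) - f (G i y)\<bar> \<le> C * sqrt (level_Q1 k f)"
      using C(2)[OF assms(2,3), of "f \<circ> G i"] by simp
  qed
qed

text \<open>Here the common upper bound on the segment resistances makes the constant independent of
  the level.\<close>

lemma linked_segment:
  assumes "(c, l) \<in> edges1"
  shows "linked c (attach c l)"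
proof (rule linkedI)
  fix k f
  have r: "0 < rho (Suc k) (c, l)" "rho (Suc k) (c, l) \<le> rho_max"
    using rho_pos rho_le assms by auto
  have "(\<lambda>(c, l). (f c - f (attach c l))\<^sup>2 / rho (Suc k) (c, l)) (c, l) \<le>
      (\<Sum>(c, l)\<in>edges1. (f c - f (attach c l))\<^sup>2 / rho (Suc k) (c, l))"
    using assms rho_pos[of k] by (intro member_le_sum) (auto simp: less_imp_le)
  also have "\<dots> \<le> level_Q1 k f"
    unfolding Q1_def using lam_pos[of k]
    by (simp add: sum_nonneg Q_Sigma_nonneg[OF r0_pos])
  finally have "(f c - f (attach c l))\<^sup>2 \<le> rho (Suc k) (c, l) * level_Q1 k f"
    using r by (simp add: field_simps)
  also have "\<dots> \<le> rho_max * level_Q1 k f"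
    using r level_Q1_nonneg by (intro mult_right_mono) auto
  finally have "sqrt ((f c - f (attach c l))\<^sup>2) \<le> sqrt (rho_max * level_Q1 k f)"
    by (rule real_sqrt_le_mono)
  then show "\<bar>f c - f (attach c l)\<bar> \<le> sqrt rho_max * sqrt (level_Q1 k f)"
    by (simp add: real_sqrt_mult)
qed (use rho_max_pos in simp)

lemma linked_attach_cell:
  assumes "(c, l) \<in> edges1" "x \<in> V0"
  shows "linked c (G (hd (cw c l)) x)"
proof -
  obtain p where "p \<in> postcritical" "attach c l = G (hd (cw c l)) (hat p)"
    using attach_cell[OF assms(1)] by blast
  then have "linked (attach c l) (G (hd (cw c l)) x)"
    using linked_cell[OF attach_in_cell(1)[OF assms(1)] _ assms(2), of "hat p"] by (simp add: V0_def)
  then show ?thesis by (rule linked_trans[OF linked_segment[OF assms(1)]])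
qed

text \<open>Two intersecting cells of X share a critical point, from which one segment leads into
  each of the two copies. Hence links propagate along the connected intersection graph.\<close>

lemma linked_cells:
  assumes x: "x \<in> V0" and i: "i \<in> {1..N}"
  shows "linked (G 1 x) (G i x)"
proof -
  define A where "A = {i \<in> {1..N}. linked (G 1 x) (G i x)}"
  have "A = {1..N}"
  proof (rule cells_connected)
    have "1 \<in> {1..N}" using N_ge_2 by simp
    then show "A \<noteq> {}" using linked_cell[OF _ x x] by (auto simp: A_def)
    fix i j assume ij: "i \<in> A" "j \<in> {1..N}" "F i ` X \<inter> F j ` X \<noteq> {}"
    show "j \<in> A"
    proof (cases "i = j")
      case False
      obtain c where c: "c \<in> F i ` X" "c \<in> F j ` X" using ij(3) by blast
      have i: "i \<in> {1..N}" "linked (G 1 x) (G i x)" using ij(1) by (auto simp: A_def)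
      have crit: "c \<in> critical" by (rule criticalI[OF i(1) ij(2) False c])
      obtain l where l: "(c, l) \<in> edges1" "hd (cw c l) = i"
        by (rule critical_letter[OF crit i(1) c(1)])
      obtain m where m: "(c, m) \<in> edges1" "hd (cw c m) = j"
        by (rule critical_letter[OF crit ij(2) c(2)])
      have "linked c (G i x)" "linked c (G j x)"
        using linked_attach_cell[OF l(1) x] linked_attach_cell[OF m(1) x] l(2) m(2) by auto
      then have "linked (G 1 x) (G j x)"
        using linked_trans[OF i(2) linked_trans[OF linked_sym]] by metis
      then show ?thesis using ij(2) by (simp add: A_def)
    qed (use ij in simp)
  qed (auto simp: A_def)
  then have "i \<in> A" using i by (simp only:)
  then show ?thesis by (simp add: A_def)
qed

lemma linked_V1:
  assumes "a \<in> V1" "b \<in> V1"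
  shows "linked a b"
proof -
  obtain x where x: "x \<in> V0" using V0_nonempty by blast
  have "linked (G 1 x) a" if a: "a \<in> V1" for a
  proof (cases "a \<in> critical")
    case True
    then obtain l where l: "(a, l) \<in> edges1" by (rule critical_has_edge)
    have "linked a (G (hd (cw a l)) x)" by (rule linked_attach_cell[OF l x])
    moreover have "linked (G 1 x) (G (hd (cw a l)) x)"
      by (rule linked_cells[OF x attach_in_cell(1)[OF l]])
    ultimately show ?thesis using linked_trans[OF _ linked_sym] by metis
  next
    case False
    then obtain i y where "i \<in> {1..N}" "y \<in> V0" "a = G i y"
      using a unfolding V1_def by blast
    then show ?thesis
      using linked_trans[OF linked_cells[OF x] linked_cell[OF _ x]] by simp
  qed
  then show ?thesis using linked_trans[OF linked_sym] assms by metis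
qed

lemma V1_bound: "\<exists>C\<ge>0. \<forall>a\<in>V1. \<forall>b\<in>V1. \<forall>k f. \<bar>f a - f b\<bar> \<le> C * sqrt (level_Q1 k f)"
proof -
  have "\<exists>C\<ge>0. \<forall>z\<in>V1 \<times> V1. \<forall>j. (\<lambda>z j. \<bar>snd j (fst z) - snd j (snd z)\<bar>) z j \<le> C * sqrt (level_Q1 (fst j) (snd j))"
  proof (rule finite_uniform_bound)
    fix z assume "z \<in> V1 \<times> V1"
    then have "linked (fst z) (snd z)" by (intro linked_V1) auto
    then show "\<exists>C\<ge>0. \<forall>j. \<bar>snd j (fst z) - snd j (snd z)\<bar> \<le> C * sqrt (level_Q1 (fst j) (snd j))"
      unfolding linked_def by auto
  qed (auto intro: level_Q1_nonneg)
  then show ?thesis by fastforce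
qed

lemma level_Q1_le_energy:
  assumes "admissible K u" "\<And>n. shifted_energy k n u \<le> B"
  shows "level_Q1 k u \<le> B"
proof -
  have "level_Q1 k u \<le> shifted_energy k (Suc 0) u"
    using Q1_le_energy[OF harmonic_Suc assms(1)] by (simp add: shifted_energy_Suc shifted_energy_0)
  then show ?thesis using assms(2)[of "Suc 0"] by linarith
qed

text \<open>Telescoping through the cells containing a point: each level contributes a geometric amount,
  and the remainder is an oscillation over a cell of diameter at most \<open>\<alpha> ^ n\<close> times that of \<open>K\<close>.\<close>

lemma oscillation_step:
  assumes C: "0 \<le> C" "\<And>a b k f. a \<in> V1 \<Longrightarrow> b \<in> V1 \<Longrightarrow> \<bar>f a - f b\<bar> \<le> C * sqrt (level_Q1 k f)"
    and v: "v \<in> V0"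
    and u: "admissible K u" "\<And>m. shifted_energy k m u \<le> B" and x: "x \<in> K"
  shows "\<exists>x'\<in>K. \<exists>v'\<in>K. dist x' v' \<le> \<alpha> ^ n * diameter K \<and>
    \<bar>u x - u v\<bar> \<le> (C + sqrt rho_max) * sqrt B * (\<Sum>j<n. sqrt lam_max ^ j) + \<bar>u x' - u v'\<bar>"
  using u x
proof (induction n arbitrary: k u B x)
  case 0
  have "v \<in> K" using v V0_subset_K by blast
  moreover have "dist x v \<le> diameter K"
    using 0 \<open>v \<in> K\<close> by (intro diameter_bounded_bound compact_imp_bounded K_compact)
  ultimately show ?case using 0 by force
next
  case (Suc n)
  have B: "0 \<le> B" using Suc.prems(2) shifted_energy_nonneg order_trans by blast
  have sC: "C * sqrt (level_Q1 k u) \<le> C * sqrt B"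
    using level_Q1_le_energy[OF Suc.prems(1,2)] C(1) by (intro mult_left_mono) auto
  have sum: "(\<Sum>j<Suc n. sqrt lam_max ^ j) = 1 + sqrt lam_max * (\<Sum>j<n. sqrt lam_max ^ j)"
    by (simp only: sum.lessThan_Suc_shift sum_distrib_left) simp
  have sum0: "0 \<le> (\<Sum>j<n. sqrt lam_max ^ j)"
    using lam_max_pos by (intro sum_nonneg) auto
  have v1: "v \<in> V1" using v V0_in_V1 by blast
  from Suc.prems(3) show ?case
  proof (cases rule: K_cases)
    case (cell i y)
    \<comment> \<open>Inside a copy the energy bound drops to \<open>lam_max * B\<close>; its square
      root supplies one more factor \<open>sqrt lam_max\<close> in the geometric sum.\<close>
    have "shifted_energy (Suc k) m (u \<circ> G i) \<le> lam_max * B" for m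
    proof -
      have "shifted_energy (Suc k) m (u \<circ> G i) \<le> lam (Suc k) * B"
        by (rule shifted_energy_cell[OF Suc.prems(2) cell(1)])
      also have "\<dots> \<le> lam_max * B"
        using B lam_le[of "Suc k"] by (intro mult_right_mono) auto
      finally show ?thesis .
    qed
    then obtain x' v' where xv: "x' \<in> K" "v' \<in> K" "dist x' v' \<le> \<alpha> ^ n * diameter K"
      "\<bar>(u \<circ> G i) y - (u \<circ> G i) v\<bar> \<le>
        (C + sqrt rho_max) * sqrt (lam_max * B) * (\<Sum>j<n. sqrt lam_max ^ j) + \<bar>(u \<circ> G i) x' - (u \<circ> G i) v'\<bar>"
      using Suc.IH[OF admissible_G[OF Suc.prems(1) cell(1)] _ cell(2)] by blast
    have "dist (G i x') (G i v') \<le> \<alpha> * (\<alpha> ^ n * diameter K)"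
      using dist_G_le[OF cell(1), of x' v'] mult_left_mono[OF xv(3), of \<alpha>] alpha by linarith
    then have 1: "dist (G i x') (G i v') \<le> \<alpha> ^ Suc n * diameter K" by (simp add: mult_ac)
    have "\<bar>u (G i v) - u v\<bar> \<le> C * sqrt B"
      using C(2)[OF G_V0_in_V1[OF cell(1) v] v1, of u k] sC by linarith
    also have "\<dots> \<le> (C + sqrt rho_max) * sqrt B"
      using B rho_max_pos by (intro mult_right_mono) auto
    finally have "\<bar>u x - u v\<bar> \<le> (C + sqrt rho_max) * sqrt B * (\<Sum>j<Suc n. sqrt lam_max ^ j)
        + \<bar>u (G i x') - u (G i v')\<bar>"
      using xv(4) cell(3) unfolding sum by (simp add: real_sqrt_mult algebra_simps)
    then show ?thesis
      using 1 xv(1,2) G_in_K[OF cell(1)] by blast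
  next
    case (segment c l)
    then obtain t where t: "t \<in> {0..1}" "x = param c l t" by (auto simp: seg_eq)
    have "(u x - u (attach c l))\<^sup>2 \<le> \<bar>t\<bar> * dirichlet_01 (u \<circ> param c l)"
      using admissible_segment(3)[OF Suc.prems(1) segment(1), of 0 t] t by simp
    also have "\<dots> \<le> 1 * (rho_max * B)"
      using dirichlet_le_energy[OF Suc.prems(2) segment(1)] t B rho_max_pos dirichlet_01_nonneg
      by (intro mult_mono) auto
    finally have "sqrt ((u x - u (attach c l))\<^sup>2) \<le> sqrt (rho_max * B)"
      by (intro real_sqrt_le_mono) simp
    then have 1: "\<bar>u x - u (attach c l)\<bar> \<le> sqrt rho_max * sqrt B"
      by (simp add: real_sqrt_mult)
    have "\<bar>u (attach c l) - u v\<bar> \<le> C * sqrt B"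
      using C(2)[OF attach_in_V1[OF segment(1)] v1, of u k] sC by linarith
    with 1 have "\<bar>u x - u v\<bar> \<le> (C + sqrt rho_max) * sqrt B * 1"
      by (simp add: algebra_simps)
    also have "\<dots> \<le> (C + sqrt rho_max) * sqrt B * (\<Sum>j<Suc n. sqrt lam_max ^ j)"
      unfolding sum using sum0 C(1) B rho_max_pos lam_max_pos by (intro mult_left_mono) auto
    \<comment> \<open>The descent ends on a segment, so the remaining oscillation can be taken at
      the trivial pair \<open>v\<close>, \<open>v\<close>.\<close>
    finally have "\<bar>u x - u v\<bar> \<le> (C + sqrt rho_max) * sqrt B * (\<Sum>j<Suc n. sqrt lam_max ^ j) + \<bar>u v - u v\<bar>"
      by simp
    moreover have "v \<in> K" using v V0_subset_K by blast
    moreover have "dist v v \<le> \<alpha> ^ Suc n * diameter K"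
      using alpha diameter_ge_0[OF compact_imp_bounded[OF K_compact]] by simp
    ultimately show ?thesis by blast
  qed
qed

text \<open>The telescoped sum is dominated by a geometric series with ratio
  \<open>sqrt lam_max\<close>, and the remainder tends to zero because \<open>u\<close> is uniformly
  continuous on K. Comparing both points with one vertex accounts for the factor 2.\<close>

lemma oscillation_bound:
  "\<exists>C>0. \<forall>k u B x y. admissible K u \<longrightarrow> (\<forall>n. shifted_energy k n u \<le> B) \<longrightarrow> x \<in> K \<longrightarrow> y \<in> K \<longrightarrow>
     (u x - u y)\<^sup>2 \<le> C * B"
proof -
  obtain C where C: "0 \<le> C" "\<And>a b k f. a \<in> V1 \<Longrightarrow> b \<in> V1 \<Longrightarrow> \<bar>f a - f b\<bar> \<le> C * sqrt (level_Q1 k f)"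
    using V1_bound by blast
  obtain v where v: "v \<in> V0" using V0_nonempty by blast
  define A where "A = (C + sqrt rho_max) * (1 / (1 - sqrt lam_max))"
  have lt: "0 < sqrt lam_max" "sqrt lam_max < 1"
    using lam_max_pos lam_max_less by auto
  have A: "0 < A"
    unfolding A_def using C(1) rho_max_pos lt by (intro mult_pos_pos add_nonneg_pos) auto
  have "\<bar>u x - u v\<bar> \<le> A * sqrt B"
    if u: "admissible K u" "\<And>n. shifted_energy k n u \<le> B" and x: "x \<in> K" for k u B x
  proof (rule field_le_epsilon)
    fix e :: real assume "0 < e"
    have B: "0 \<le> B" using u(2) shifted_energy_nonneg order_trans by blast
    have "uniformly_continuous_on K u"
      using u(1) K_compact by (intro compact_uniformly_continuous) (auto simp: admissible_def)
    then obtain d where d: "0 < d" "\<And>x y. x \<in> K \<Longrightarrow> y \<in> K \<Longrightarrow> dist y x < d \<Longrightarrow> dist (u y) (u x) < e"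
      using \<open>0 < e\<close> unfolding uniformly_continuous_on_def by blast
    have "(\<lambda>n. \<alpha> ^ n * diameter K) \<longlonglongrightarrow> 0 * diameter K"
      using alpha by (intro tendsto_intros LIMSEQ_realpow_zero) auto
    then have "eventually (\<lambda>n. \<alpha> ^ n * diameter K < d) sequentially"
      using d(1) by (intro order_tendstoD(2)) auto
    then obtain n where n: "\<alpha> ^ n * diameter K < d"
      using eventually_happens'[OF sequentially_bot] by blast
    obtain x' v' where xv: "x' \<in> K" "v' \<in> K" "dist x' v' \<le> \<alpha> ^ n * diameter K"
      "\<bar>u x - u v\<bar> \<le> (C + sqrt rho_max) * sqrt B * (\<Sum>j<n. sqrt lam_max ^ j) + \<bar>u x' - u v'\<bar>"
      using oscillation_step[OF C v u x, of n] by blast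
    have "(\<Sum>j<n. sqrt lam_max ^ j) \<le> (\<Sum>j. sqrt lam_max ^ j)"
      using lt by (intro sum_le_suminf summable_geometric) auto
    also have "\<dots> = 1 / (1 - sqrt lam_max)"
      using lt by (intro suminf_geometric) auto
    finally have "(C + sqrt rho_max) * sqrt B * (\<Sum>j<n. sqrt lam_max ^ j) \<le>
        (C + sqrt rho_max) * sqrt B * (1 / (1 - sqrt lam_max))"
      using C(1) rho_max_pos B by (intro mult_left_mono mult_nonneg_nonneg) auto
    also have "\<dots> = A * sqrt B" by (simp add: A_def)
    finally show "\<bar>u x - u v\<bar> \<le> A * sqrt B + e"
      using xv(4) d(2)[OF xv(2,1)] xv(3) n by (auto simp: dist_real_def)
  qed
  note osc = this
  have "(u x - u y)\<^sup>2 \<le> (2 * A)\<^sup>2 * B"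
    if u: "admissible K u" "\<forall>n. shifted_energy k n u \<le> B" and xy: "x \<in> K" "y \<in> K" for k u B x y
  proof -
    have B: "0 \<le> B" using u(2) shifted_energy_nonneg order_trans by blast
    have "\<bar>u x - u y\<bar> \<le> 2 * A * sqrt B"
      using osc[OF u(1) u(2)[rule_format] xy(1)] osc[OF u(1) u(2)[rule_format] xy(2)] by linarith
    then have "\<bar>u x - u y\<bar>\<^sup>2 \<le> (2 * A * sqrt B)\<^sup>2"
      by (intro power_mono) auto
    then show ?thesis
      using B by (simp add: power_mult_distrib)
  qed
  then show ?thesis
    using A by (intro exI[of _ "(2 * A)\<^sup>2"]) auto
qed

end

section \<open>Gluing and harmonic extension\<close>

text \<open>An injective continuous map on a compact set is a homeomorphism onto its image, so
  continuity can be checked in the parametrisation by copies and segments.\<close>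

lemma continuous_on_image_compact:
  fixes f :: "'b::topological_space \<Rightarrow> 'c::t2_space"
  assumes "compact S" "continuous_on S f" "inj_on f S" "continuous_on S (u \<circ> f)"
  shows "continuous_on (f ` S) u"
proof -
  have "continuous_on (f ` S) (inv_into S f)"
    using assms by (intro continuous_on_inv) (auto simp: inv_into_f_f)
  moreover have "inv_into S f ` f ` S = S"
    using assms(3) by (simp add: inv_into_image_cancel)
  then have "continuous_on (inv_into S f ` f ` S) (u \<circ> f)"
    using assms(4) by (simp only:)
  ultimately have "continuous_on (f ` S) ((u \<circ> f) \<circ> inv_into S f)"
    by (rule continuous_on_compose)
  then show ?thesis
    by (rule continuous_on_eq) (auto simp: f_inv_into_f)
qed

context stretched_fractal
begin

lemma continuous_on_K_I:
  assumes cells: "\<And>i. i \<in> {1..N} \<Longrightarrow> continuous_on K (u \<circ> G i)"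
    and segs: "\<And>c l. (c, l) \<in> edges1 \<Longrightarrow> continuous_on {0..1} (u \<circ> param c l)"
  shows "continuous_on K u"
proof -
  have cell: "continuous_on (G i ` K) u" "closed (G i ` K)" if i: "i \<in> {1..N}" for i
  proof -
    have "inj_on (G i) K" using G_inj[OF i] by (auto simp: inj_on_def)
    then show "continuous_on (G i ` K) u"
      by (intro continuous_on_image_compact K_compact G_continuous[OF i] cells[OF i])
    show "closed (G i ` K)"
      by (intro compact_imp_closed compact_continuous_image K_compact G_continuous[OF i])
  qed
  have seg: "continuous_on (seg (fst e) (snd e)) u" "closed (seg (fst e) (snd e))" if e: "e \<in> edges1" for e
  proof -
    obtain c l where cl: "e = (c, l)" by (cases e)
    then have cl': "(c, l) \<in> edges1" using e by simp
    have "inj_on (param c l) {0..1}" using param_inj[OF cl'] by (auto simp: inj_on_def)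
    then have "continuous_on (param c l ` {0..1}) u"
      by (intro continuous_on_image_compact param_continuous segs cl') auto
    then show "continuous_on (seg (fst e) (snd e)) u" by (simp add: seg_eq cl)
    show "closed (seg (fst e) (snd e))" by (simp add: seg_def)
  qed
  have "continuous_on (\<Union>i\<in>{1..N}. G i ` K) u" "continuous_on (\<Union>e\<in>edges1. seg (fst e) (snd e)) u"
    by (rule continuous_on_closed_Union; use cell seg in simp)+
  moreover have "closed (\<Union>i\<in>{1..N}. G i ` K)" "closed (\<Union>e\<in>edges1. seg (fst e) (snd e))"
    by (rule closed_UN; use cell seg in simp)+
  ultimately have "continuous_on ((\<Union>i\<in>{1..N}. G i ` K) \<union> (\<Union>e\<in>edges1. seg (fst e) (snd e))) u"
    by (intro continuous_on_closed_Un)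
  moreover have "K \<subseteq> (\<Union>i\<in>{1..N}. G i ` K) \<union> (\<Union>e\<in>edges1. seg (fst e) (snd e))"
  proof
    fix x assume "x \<in> K"
    then show "x \<in> (\<Union>i\<in>{1..N}. G i ` K) \<union> (\<Union>e\<in>edges1. seg (fst e) (snd e))"
    proof (cases rule: K_cases)
      case (segment c l)
      then have "x \<in> (\<Union>e\<in>edges1. seg (fst e) (snd e))" by (intro UN_I[of "(c, l)"]) auto
      then show ?thesis by simp
    next
      case (cell i y)
      then have "x \<in> (\<Union>i\<in>{1..N}. G i ` K)" by (intro UN_I[of i]) auto
      then show ?thesis by simp
    qed
  qed
  ultimately show ?thesis by (rule continuous_on_subset)
qed

lemma admissible_I:
  assumes cells: "\<And>i. i \<in> {1..N} \<Longrightarrow> admissible K (u \<circ> G i)"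
    and segs: "\<And>c l. (c, l) \<in> edges1 \<Longrightarrow> continuous_on {0..1} (u \<circ> param c l)"
      "\<And>c l. (c, l) \<in> edges1 \<Longrightarrow> H1_01 (u \<circ> param c l)"
  shows "admissible K u"
proof -
  have "continuous_on K u"
  proof (rule continuous_on_K_I)
    show "continuous_on K (u \<circ> G i)" if "i \<in> {1..N}" for i
      using cells[OF that] unfolding admissible_def by (rule conjunct1)
  qed (rule segs(1))
  moreover have "H1_01 (u \<circ> (word_map G w \<circ> param c l))" if e: "(c, l) \<in> edges1" and w: "w \<in> all_words" for c l w
  proof (cases w)
    case Nil
    then show ?thesis using segs(2)[OF e] by simp
  next
    case (Cons i v)
    then have i: "i \<in> {1..N}" "v \<in> all_words" using w by (auto simp: mem_all_words)
    have "H1_01 ((u \<circ> G i) \<circ> (word_map G v \<circ> param c l))"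
      using cells[OF i(1)] e i(2) unfolding admissible_def by blast
    moreover have "(u \<circ> G i) \<circ> (word_map G v \<circ> param c l) = u \<circ> (word_map G w \<circ> param c l)"
      by (auto simp: fun_eq_iff Cons)
    ultimately show ?thesis by simp
  qed
  ultimately show ?thesis unfolding admissible_def by blast
qed

lemma admissible_cong:
  assumes "\<And>x. x \<in> K \<Longrightarrow> u x = v x" "admissible K u"
  shows "admissible K v"
  unfolding admissible_def
proof (intro conjI ballI)
  show "continuous_on K v"
    using assms by (auto simp: admissible_def intro: continuous_on_eq)
  fix e assume e: "e \<in> edges1"
  obtain c l where cl: "e = (c, l)" by (cases e)
  have "H1_01 (v \<circ> (word_map G w \<circ> param c l))" if w: "w \<in> all_words" for w
  proof -
    have "H1_01 (u \<circ> (word_map G w \<circ> param c l))"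
      using assms(2) e cl w unfolding admissible_def by blast
    moreover have "(u \<circ> (word_map G w \<circ> param c l)) t = (v \<circ> (word_map G w \<circ> param c l)) t"
      if "t \<in> {0..1}" for t
      using assms(1)[OF word_map_G_in_K[OF w param_in_K[OF e[unfolded cl] that]]] by simp
    ultimately show ?thesis using H1_01_cong(1) by blast
  qed
  then show "case e of (c, l) \<Rightarrow> \<forall>w\<in>all_words. H1_01 (v \<circ> (word_map G w \<circ> param c l))"
    using cl by simp
qed

lemma admissible_const: "admissible K (\<lambda>_. a)"
proof -
  have "H1_01 ((\<lambda>_. a) \<circ> g)" for g :: "real \<Rightarrow> 'a"
    by (rule H1_01_affine(1)[of _ a 0]) simp
  then show ?thesis by (auto simp: admissible_def)
qed

text \<open>A relation at first, because a point may lie both in a copy and on a segment, or on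
  several segments; compatibility of the data makes it single-valued.\<close>

inductive glue_value :: "(nat \<Rightarrow> 'a \<Rightarrow> real) \<Rightarrow> ('a \<times> nat \<Rightarrow> real \<Rightarrow> real) \<Rightarrow> 'a \<Rightarrow> real \<Rightarrow> bool"
  for U v where
    cell: "i \<in> {1..N} \<Longrightarrow> y \<in> K \<Longrightarrow> glue_value U v (G i y) (U i y)"
  | segment: "(c, l) \<in> edges1 \<Longrightarrow> t \<in> {0..1} \<Longrightarrow> glue_value U v (param c l t) (v (c, l) t)"

definition glue :: "(nat \<Rightarrow> 'a \<Rightarrow> real) \<Rightarrow> ('a \<times> nat \<Rightarrow> real \<Rightarrow> real) \<Rightarrow> 'a \<Rightarrow> real" where
  "glue U v x = (SOME r. glue_value U v x r)"

definition compatible :: "(nat \<Rightarrow> 'a \<Rightarrow> real) \<Rightarrow> ('a \<times> nat \<Rightarrow> real \<Rightarrow> real) \<Rightarrow> bool" where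
  "compatible U v \<longleftrightarrow>
     (\<forall>c l i y. (c, l) \<in> edges1 \<longrightarrow> i \<in> {1..N} \<longrightarrow> y \<in> K \<longrightarrow> attach c l = G i y \<longrightarrow> v (c, l) 0 = U i y) \<and>
     (\<forall>c l l'. (c, l) \<in> edges1 \<longrightarrow> (c, l') \<in> edges1 \<longrightarrow> v (c, l) 1 = v (c, l') 1)"

lemma compatible_cell_segment:
  assumes "compatible U v" "i \<in> {1..N}" "y \<in> K" "(c, l) \<in> edges1" "t \<in> {0..1}" "G i y = param c l t"
  shows "U i y = v (c, l) t"
proof -
  have "param c l t \<in> G i ` K" using assms(3,6) by force
  then have "t = 0" by (rule param_in_cell[OF assms(4,5,2)])
  then have "attach c l = G i y" using assms(6) by simp
  then show ?thesis using assms \<open>t = 0\<close> unfolding compatible_def by metis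
qed

lemma glue_value_unique:
  assumes comp: "compatible U v" and "glue_value U v x r" "glue_value U v x r'"
  shows "r = r'"
  using assms(2)
proof cases
  case (cell i y)
  note c1 = cell
  from assms(3) show ?thesis
  proof cases
    case (cell j z)
    then show ?thesis using c1 cell_unique[of i j y z] by simp
  next
    case (segment c l t)
    then show ?thesis using c1 compatible_cell_segment[OF comp, of i y c l t] by simp
  qed
next
  case (segment c l t)
  note s1 = segment
  from assms(3) show ?thesis
  proof cases
    case (cell i y)
    then show ?thesis using s1 compatible_cell_segment[OF comp, of i y c l t] by simp
  next
    case (segment c' l' t')
    have "c = c' \<and> l = l' \<and> t = t' \<or> c = c' \<and> t = 1 \<and> t' = 1"
      using s1 segment by (intro param_eq_param) auto
    then show ?thesis
    proof
      assume a: "c = c' \<and> t = 1 \<and> t' = 1"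
      have "v (c, l) 1 = v (c, l') 1"
        using comp s1(3) segment(3) a unfolding compatible_def by metis
      then show ?thesis using s1(2) segment(2) a by simp
    qed (use s1 segment in simp)
  qed
qed

lemma glue_eq:
  assumes "compatible U v" "glue_value U v x r"
  shows "glue U v x = r"
  unfolding glue_def using assms(2) glue_value_unique[OF assms(1)] by (intro some_equality) auto

lemma glue_cell: "compatible U v \<Longrightarrow> i \<in> {1..N} \<Longrightarrow> y \<in> K \<Longrightarrow> glue U v (G i y) = U i y"
  by (intro glue_eq glue_value.cell)

lemma glue_segment: "compatible U v \<Longrightarrow> (c, l) \<in> edges1 \<Longrightarrow> t \<in> {0..1} \<Longrightarrow> glue U v (param c l t) = v (c, l) t"
  by (intro glue_eq glue_value.segment)

text \<open>Seen from its copy, an attachment point is a vertex. Compatibility thus concerns only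
  values on \<open>V0\<close>, where extensions are prescribed.\<close>

lemma attach_eq_cell_imp_V0:
  assumes "(c, l) \<in> edges1" "i \<in> {1..N}" "y \<in> K" "attach c l = G i y"
  shows "y \<in> V0"
proof -
  obtain p where p: "p \<in> postcritical" "attach c l = G (hd (cw c l)) (hat p)"
    using attach_cell[OF assms(1)] by blast
  then have "y = hat p"
    using cell_unique(2)[OF assms(2) attach_in_cell(1)[OF assms(1)] assms(3) hat_in_K[OF p(1)]] assms(4) by simp
  then show ?thesis using p by (simp add: V0_def)
qed

lemma V0_in_cell:
  assumes "x \<in> V0"
  obtains i y where "i \<in> {1..N}" "y \<in> V0" "x = G i y"
proof -
  obtain p where "p \<in> postcritical" "x = hat p" using assms by (auto simp: V0_def)
  then obtain i p' where "i \<in> {1..N}" "p' \<in> postcritical" "x = G i (hat p')"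
    using V0_cell[of p] by blast
  then show thesis by (intro that) (auto simp: V0_def)
qed

end

section \<open>Harmonic extension as a uniform limit\<close>

context regular_sequence
begin

lemma shifted_energy_const: "shifted_energy k n (\<lambda>_. a) = 0"
proof (induction n arbitrary: k)
  case 0
  show ?case unfolding shifted_energy_0 by (rule Q_Sigma_const) simp
next
  case (Suc n)
  have d: "dirichlet_01 ((\<lambda>_. a) \<circ> g) = 0" for g :: "real \<Rightarrow> 'a"
    using H1_01_affine(2)[of "(\<lambda>_. a) \<circ> g" a 0] by simp
  have "D r (\<lambda>_. a) = 0" for r
    unfolding D_def d by simp
  moreover have "(\<lambda>_. a) \<circ> G i = (\<lambda>_. a)" for i by auto
  ultimately show ?case by (simp add: shifted_energy_Suc Suc.IH)
qed

definition minimizer :: "nat \<Rightarrow> ('a \<Rightarrow> real) \<Rightarrow> 'a \<Rightarrow> real" where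
  "minimizer k g = (SOME f. (\<forall>x\<in>V0. f x = g x) \<and> level_Q1 k f = Q_Sigma r0 g)"

lemma minimizer_V0: "x \<in> V0 \<Longrightarrow> minimizer k g x = g x"
  and minimizer_Q1: "level_Q1 k (minimizer k g) = Q_Sigma r0 g"
  using someI_ex[OF Q1_minimizer[OF harmonic_Suc[of k], of g]] unfolding minimizer_def by blast+

text \<open>A Tietze extension serving as the initial guess inside a cell. The range condition
  bounds its distance from the boundary values by their oscillation.\<close>

definition coarse :: "('a \<Rightarrow> real) \<Rightarrow> 'a \<Rightarrow> real" where
  "coarse g = (SOME f. continuous_on UNIV f \<and> (\<forall>x\<in>V0. f x = g x) \<and> (\<forall>x. f x \<in> {Min (g ` V0)..Max (g ` V0)}))"

lemma coarse:
  "continuous_on UNIV (coarse g)" "x \<in> V0 \<Longrightarrow> coarse g x = g x"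
  "coarse g y \<in> {Min (g ` V0)..Max (g ` V0)}"
proof -
  have c: "continuous_on V0 g"
    by (rule continuous_on_finite) simp
  have ne: "cbox (Min (g ` V0)) (Max (g ` V0)) \<noteq> {}"
  proof -
    obtain x where "x \<in> V0" using V0_nonempty by blast
    then have "Min (g ` V0) \<le> g x" "g x \<le> Max (g ` V0)" by auto
    then show ?thesis by auto
  qed
  have clo: "closedin (top_of_set UNIV) V0"
    by (simp add: finite_imp_closed)
  obtain f where "continuous_on UNIV f" "\<And>x. x \<in> V0 \<Longrightarrow> f x = g x"
    "\<And>x. f x \<in> cbox (Min (g ` V0)) (Max (g ` V0))"
    using Tietze_closed_interval[OF c clo ne] by auto
  then have "\<exists>f. continuous_on UNIV f \<and> (\<forall>x\<in>V0. f x = g x) \<and> (\<forall>x. f x \<in> {Min (g ` V0)..Max (g ` V0)})"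
    by (intro exI[of _ f]) auto
  from someI_ex[OF this]
  show "continuous_on UNIV (coarse g)" "x \<in> V0 \<Longrightarrow> coarse g x = g x"
    "coarse g y \<in> {Min (g ` V0)..Max (g ` V0)}"
    unfolding coarse_def by blast+
qed

definition affine_part :: "('a \<Rightarrow> real) \<Rightarrow> 'a \<times> nat \<Rightarrow> real \<Rightarrow> real" where
  "affine_part f e t = f (attach (fst e) (snd e)) + (f (fst e) - f (attach (fst e) (snd e))) * t"

text \<open>Energy is minimised on \<open>n\<close> successive levels, with affine interpolation on
  the segments; the cells of level \<open>n\<close> are filled by the coarse guess.\<close>

primrec approx_ext :: "nat \<Rightarrow> nat \<Rightarrow> ('a \<Rightarrow> real) \<Rightarrow> 'a \<Rightarrow> real" where
  "approx_ext 0 k g = coarse g"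
| "approx_ext (Suc n) k g =
     glue (\<lambda>i. approx_ext n (Suc k) (minimizer k g \<circ> G i)) (affine_part (minimizer k g))"

lemma compatible_affine_part:
  assumes "\<And>i y. i \<in> {1..N} \<Longrightarrow> y \<in> V0 \<Longrightarrow> U i y = f (G i y)"
  shows "compatible U (affine_part f)"
  unfolding compatible_def using assms attach_eq_cell_imp_V0 by (auto simp: affine_part_def)

lemma approx_ext_V0: "x \<in> V0 \<Longrightarrow> approx_ext n k g x = g x"
proof (induction n arbitrary: k g x)
  case 0
  then show ?case by (simp add: coarse)
next
  case (Suc n)
  obtain i y where iy: "i \<in> {1..N}" "y \<in> V0" "x = G i y" using Suc.prems by (rule V0_in_cell)
  have "compatible (\<lambda>i. approx_ext n (Suc k) (minimizer k g \<circ> G i)) (affine_part (minimizer k g))"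
    by (rule compatible_affine_part) (simp add: Suc.IH)
  then have "approx_ext (Suc n) k g x = approx_ext n (Suc k) (minimizer k g \<circ> G i) y"
    using iy V0_subset_K by (auto simp: glue_cell)
  also have "\<dots> = minimizer k g x" using Suc.IH[OF iy(2)] iy(3) by simp
  finally show ?case using minimizer_V0[OF Suc.prems] by simp
qed

lemma approx_ext_compatible:
  "compatible (\<lambda>i. approx_ext n (Suc k) (minimizer k g \<circ> G i)) (affine_part (minimizer k g))"
  by (rule compatible_affine_part) (simp add: approx_ext_V0)

lemma approx_ext_cell:
  "i \<in> {1..N} \<Longrightarrow> y \<in> K \<Longrightarrow> approx_ext (Suc n) k g (G i y) = approx_ext n (Suc k) (minimizer k g \<circ> G i) y"
  using glue_cell[OF approx_ext_compatible] by simp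

lemma approx_ext_segment:
  "(c, l) \<in> edges1 \<Longrightarrow> t \<in> {0..1} \<Longrightarrow>
    approx_ext (Suc n) k g (param c l t) = affine_part (minimizer k g) (c, l) t"
  using glue_segment[OF approx_ext_compatible] by simp

lemma affine_part_continuous: "continuous_on A (affine_part f e)"
  unfolding affine_part_def by (intro continuous_intros)

lemma approx_ext_continuous: "continuous_on K (approx_ext n k g)"
proof (induction n arbitrary: k g)
  case 0
  show ?case using continuous_on_subset[OF coarse(1) subset_UNIV] by simp
next
  case (Suc n)
  show ?case
  proof (rule continuous_on_K_I)
    show "continuous_on K (approx_ext (Suc n) k g \<circ> G i)" if "i \<in> {1..N}" for i
      by (rule continuous_on_eq[OF Suc.IH]) (simp only: comp_apply approx_ext_cell[OF that])
    show "continuous_on {0..1} (approx_ext (Suc n) k g \<circ> param c l)" if "(c, l) \<in> edges1" for c l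
      by (rule continuous_on_eq[OF affine_part_continuous]) (simp only: comp_apply approx_ext_segment[OF that])
  qed
qed

lemma minimizer_cell_energy:
  assumes "i \<in> {1..N}"
  shows "Q_Sigma r0 (minimizer k g \<circ> G i) \<le> lam_max * Q_Sigma r0 g"
proof -
  have "Q_Sigma r0 (minimizer k g \<circ> G i) \<le> lam (Suc k) * Q_Sigma r0 g"
    using Q1_ge_cell[OF harmonic_Suc[of k] assms, of "minimizer k g"] by (simp add: minimizer_Q1)
  also have "\<dots> \<le> lam_max * Q_Sigma r0 g"
    using lam_le[of "Suc k"] Q_Sigma_nonneg[OF r0_pos] by (intro mult_right_mono) auto
  finally show ?thesis .
qed

text \<open>Successive approximations differ only inside the n-cells. There both are controlled by
  the oscillation of the minimiser on the vertices of the cell, whose energy has dropped by at least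
  the factor \<open>lam_max ^ n\<close>.\<close>

lemma approx_ext_Cauchy:
  "\<exists>A. \<forall>n k g. \<forall>x\<in>K. \<bar>approx_ext (Suc n) k g x - approx_ext n k g x\<bar> \<le> A * sqrt lam_max ^ n * sqrt (Q_Sigma r0 g)"
proof -
  obtain C0 where C0: "0 \<le> C0" "\<And>x y g. x \<in> V0 \<Longrightarrow> y \<in> V0 \<Longrightarrow> \<bar>g x - g y\<bar> \<le> C0 * sqrt (Q_Sigma r0 g)"
    using V0_bound by blast
  obtain C1 where C1: "0 \<le> C1" "\<And>a b k f. a \<in> V1 \<Longrightarrow> b \<in> V1 \<Longrightarrow> \<bar>f a - f b\<bar> \<le> C1 * sqrt (level_Q1 k f)"
    using V1_bound by blast
  obtain v where v: "v \<in> V0" using V0_nonempty by blast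
  have v1: "v \<in> V1" using v V0_in_V1 by blast
  \<comment> \<open>Both approximations are compared with the value at the vertex \<open>v\<close>:
    \<open>C0\<close> is for the coarse guess, \<open>C0 + C1\<close> for the function refined
    once.\<close>
  define A where "A = C0 + (C0 + C1)"
  have lm: "0 \<le> sqrt lam_max" "sqrt lam_max \<le> 1" using lam_max_pos lam_max_less by auto
  have coarse_v: "\<bar>coarse g x - g w\<bar> \<le> C0 * sqrt (Q_Sigma r0 g)" if w: "w \<in> V0" for g x w
  proof -
    have "Min (g ` V0) \<in> g ` V0" "Max (g ` V0) \<in> g ` V0"
      using V0_nonempty by (auto intro!: Min_in Max_in)
    then obtain a b where ab: "a \<in> V0" "b \<in> V0" "Min (g ` V0) = g a" "Max (g ` V0) = g b" by auto
    then show ?thesis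
      using C0(2)[OF ab(1) w, of g] C0(2)[OF ab(2) w, of g] coarse(3)[of g x] by auto
  qed
  have main: "\<bar>approx_ext (Suc n) k g x - approx_ext n k g x\<bar> \<le> A * sqrt lam_max ^ n * sqrt (Q_Sigma r0 g)"
    if "x \<in> K" for n k g x
    using that
  proof (induction n arbitrary: k g x)
    case 0
    let ?m = "minimizer k g"
    have Qg: "0 \<le> Q_Sigma r0 g" by (rule Q_Sigma_nonneg[OF r0_pos])
    have m: "\<bar>?m a - ?m v\<bar> \<le> C1 * sqrt (Q_Sigma r0 g)" if "a \<in> V1" for a
      using C1(2)[OF that v1, of ?m k] by (simp add: minimizer_Q1)
    have "\<bar>approx_ext (Suc 0) k g x - ?m v\<bar> \<le> (C0 + C1) * sqrt (Q_Sigma r0 g)"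
      using 0
    proof (cases rule: K_cases)
      case (cell i y)
      have "\<bar>coarse (?m \<circ> G i) y - (?m \<circ> G i) v\<bar> \<le> C0 * sqrt (Q_Sigma r0 (?m \<circ> G i))"
        by (rule coarse_v[OF v])
      also have "\<dots> \<le> C0 * sqrt (1 * Q_Sigma r0 g)"
      proof -
        have "lam_max * Q_Sigma r0 g \<le> 1 * Q_Sigma r0 g"
          using lam_max_less Qg by (intro mult_right_mono) auto
        then show ?thesis
          using minimizer_cell_energy[OF cell(1), of k g] C0(1) by (intro mult_left_mono real_sqrt_le_mono) auto
      qed
      finally show ?thesis
        using m[OF G_V0_in_V1[OF cell(1) v]] cell by (simp add: approx_ext_cell distrib_right del: approx_ext.simps(2))
    next
      case (segment c l)
      then obtain t where t: "t \<in> {0..1}" "x = param c l t" by (auto simp: seg_eq)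
      have c1: "c \<in> V1" using edges1D(1)[OF segment(1)] by (simp add: V1_def)
      have eq: "approx_ext (Suc 0) k g x - ?m v = (1 - t) * (?m (attach c l) - ?m v) + t * (?m c - ?m v)"
        using approx_ext_segment[OF segment(1) t(1)] t(2) by (simp add: affine_part_def algebra_simps del: approx_ext.simps)
      have "\<bar>(1 - t) * (?m (attach c l) - ?m v) + t * (?m c - ?m v)\<bar> \<le> (1 - t) * \<bar>?m (attach c l) - ?m v\<bar> + t * \<bar>?m c - ?m v\<bar>"
        using t(1) abs_triangle_ineq[of "(1 - t) * (?m (attach c l) - ?m v)" "t * (?m c - ?m v)"]
        by (simp add: abs_mult)
      also have "\<dots> \<le> C1 * sqrt (Q_Sigma r0 g)"
      proof (rule convex_bound_le)
        show "\<bar>?m (attach c l) - ?m v\<bar> \<le> C1 * sqrt (Q_Sigma r0 g)"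
          by (rule m[OF attach_in_V1[OF segment(1)]])
        show "\<bar>?m c - ?m v\<bar> \<le> C1 * sqrt (Q_Sigma r0 g)"
          by (rule m[OF c1])
      qed (use t(1) in auto)
      also have "\<dots> \<le> (C0 + C1) * sqrt (Q_Sigma r0 g)"
        using C0(1) Qg by (intro mult_right_mono) auto
      finally show ?thesis unfolding eq .
    qed
    moreover have "\<bar>approx_ext 0 k g x - ?m v\<bar> \<le> C0 * sqrt (Q_Sigma r0 g)"
      using coarse_v[OF v] minimizer_V0[OF v] by simp
    ultimately show ?case
      unfolding A_def power_0 mult_1_right distrib_right by linarith
  next
    case (Suc n)
    have A: "0 \<le> A" using C0 C1 by (simp add: A_def)
    show ?case
      using Suc.prems
    proof (cases rule: K_cases)
      case (cell i y)
      have "\<bar>approx_ext (Suc (Suc n)) k g x - approx_ext (Suc n) k g x\<bar> =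
          \<bar>approx_ext (Suc n) (Suc k) (minimizer k g \<circ> G i) y - approx_ext n (Suc k) (minimizer k g \<circ> G i) y\<bar>"
        using cell by (simp add: approx_ext_cell del: approx_ext.simps(2))
      also have "\<dots> \<le> A * sqrt lam_max ^ n * sqrt (Q_Sigma r0 (minimizer k g \<circ> G i))"
        by (rule Suc.IH[OF cell(2)])
      also have "\<dots> \<le> A * sqrt lam_max ^ n * sqrt (lam_max * Q_Sigma r0 g)"
        using A lm minimizer_cell_energy[OF cell(1), of k g] by (intro mult_left_mono) auto
      finally show ?thesis by (simp add: real_sqrt_mult mult_ac)
    next
      case (segment c l)
      then obtain t where t: "t \<in> {0..1}" "x = param c l t" by (auto simp: seg_eq)
      have "approx_ext (Suc (Suc n)) k g x = approx_ext (Suc n) k g x"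
        unfolding t(2) by (simp only: approx_ext_segment[OF segment(1) t(1)])
      then show ?thesis using A lm Q_Sigma_nonneg[OF r0_pos, of g] by simp
    qed
  qed
  then show ?thesis by blast
qed

definition harmonic_ext :: "nat \<Rightarrow> ('a \<Rightarrow> real) \<Rightarrow> 'a \<Rightarrow> real" where
  "harmonic_ext k g x = lim (\<lambda>n. approx_ext n k g x)"

lemma harmonic_ext_uniform_limit:
  "uniform_limit K (\<lambda>n. approx_ext n k g) (harmonic_ext k g) sequentially"
proof -
  obtain A where A: "\<And>n k g x. x \<in> K \<Longrightarrow>
      \<bar>approx_ext (Suc n) k g x - approx_ext n k g x\<bar> \<le> A * sqrt lam_max ^ n * sqrt (Q_Sigma r0 g)"
    using approx_ext_Cauchy by blast
  define f where "f n x = approx_ext (Suc n) k g x - approx_ext n k g x" for n x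
  have lt: "norm (sqrt lam_max) < 1" using lam_max_pos lam_max_less by simp
  have "uniform_limit K (\<lambda>n x. \<Sum>i<n. f i x) (\<lambda>x. suminf (\<lambda>i. f i x)) sequentially"
  proof (rule Weierstrass_m_test)
    show "norm (f n x) \<le> A * sqrt lam_max ^ n * sqrt (Q_Sigma r0 g)" if "x \<in> K" for n x
      using A[OF that] by (simp only: f_def real_norm_def)
    show "summable (\<lambda>n. A * sqrt lam_max ^ n * sqrt (Q_Sigma r0 g))"
      by (intro summable_mult summable_mult2 summable_geometric lt)
  qed
  moreover have "(\<Sum>i<n. f i x) = approx_ext n k g x - approx_ext 0 k g x" for n x
    unfolding f_def by (rule sum_lessThan_telescope)
  ultimately have "uniform_limit K (\<lambda>n x. approx_ext n k g x - approx_ext 0 k g x) (\<lambda>x. suminf (\<lambda>i. f i x)) sequentially"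
    by simp
  then have "uniform_limit K (\<lambda>n x. approx_ext 0 k g x + (approx_ext n k g x - approx_ext 0 k g x))
      (\<lambda>x. approx_ext 0 k g x + suminf (\<lambda>i. f i x)) sequentially"
    by (intro uniform_limit_add uniform_limit_const)
  then have u: "uniform_limit K (\<lambda>n. approx_ext n k g) (\<lambda>x. approx_ext 0 k g x + suminf (\<lambda>i. f i x)) sequentially"
    by simp
  moreover have "harmonic_ext k g x = approx_ext 0 k g x + suminf (\<lambda>i. f i x)" if "x \<in> K" for x
    unfolding harmonic_ext_def by (intro limI tendsto_uniform_limitI[OF u that])
  ultimately show ?thesis
    by (subst uniform_limit_cong'[of _ _ "\<lambda>n. approx_ext n k g"]) (auto simp del: approx_ext.simps)
qed

lemma harmonic_ext_tendsto: "x \<in> K \<Longrightarrow> (\<lambda>n. approx_ext n k g x) \<longlonglongrightarrow> harmonic_ext k g x"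
  by (rule tendsto_uniform_limitI[OF harmonic_ext_uniform_limit])

lemma harmonic_ext_continuous: "continuous_on K (harmonic_ext k g)"
  by (rule uniform_limit_theorem[OF _ harmonic_ext_uniform_limit])
    (auto intro!: always_eventually approx_ext_continuous)

lemma harmonic_ext_V0: "x \<in> V0 \<Longrightarrow> harmonic_ext k g x = g x"
  unfolding harmonic_ext_def by (intro limI) (simp add: approx_ext_V0)

text \<open>The self-similarity of the approximations survives the limit: inside a copy the function
  is again a harmonic extension, for the next tail and for boundary data given by the
  minimiser.\<close>

lemma harmonic_ext_cell:
  assumes "i \<in> {1..N}" "y \<in> K"
  shows "harmonic_ext k g (G i y) = harmonic_ext (Suc k) (minimizer k g \<circ> G i) y"
proof -
  have "(\<lambda>n. approx_ext (Suc n) k g (G i y)) \<longlonglongrightarrow> harmonic_ext k g (G i y)"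
    using harmonic_ext_tendsto[OF G_in_K[OF assms]] by (rule LIMSEQ_Suc)
  moreover have "(\<lambda>n. approx_ext (Suc n) k g (G i y)) \<longlonglongrightarrow> harmonic_ext (Suc k) (minimizer k g \<circ> G i) y"
    using harmonic_ext_tendsto[OF assms(2)] by (simp only: approx_ext_cell[OF assms])
  ultimately show ?thesis by (rule LIMSEQ_unique)
qed

lemma harmonic_ext_segment:
  assumes "(c, l) \<in> edges1" "t \<in> {0..1}"
  shows "harmonic_ext k g (param c l t) = affine_part (minimizer k g) (c, l) t"
proof -
  have "(\<lambda>n. approx_ext (Suc n) k g (param c l t)) \<longlonglongrightarrow> harmonic_ext k g (param c l t)"
    using harmonic_ext_tendsto[OF param_in_K[OF assms]] by (rule LIMSEQ_Suc)
  moreover have "(\<lambda>n. approx_ext (Suc n) k g (param c l t)) \<longlonglongrightarrow> affine_part (minimizer k g) (c, l) t"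
    by (simp only: approx_ext_segment[OF assms] tendsto_const)
  ultimately show ?thesis by (rule LIMSEQ_unique)
qed

lemma harmonic_ext_segment_H1:
  assumes "(c, l) \<in> edges1"
  shows "H1_01 (harmonic_ext k g \<circ> param c l)"
    "dirichlet_01 (harmonic_ext k g \<circ> param c l) = (minimizer k g c - minimizer k g (attach c l))\<^sup>2"
proof -
  have "(harmonic_ext k g \<circ> param c l) t =
      minimizer k g (attach c l) + (minimizer k g c - minimizer k g (attach c l)) * t" if "t \<in> {0..1}" for t
    using harmonic_ext_segment[OF assms that] by (simp add: affine_part_def)
  note a = H1_01_affine[OF this]
  show "H1_01 (harmonic_ext k g \<circ> param c l)"
    "dirichlet_01 (harmonic_ext k g \<circ> param c l) = (minimizer k g c - minimizer k g (attach c l))\<^sup>2"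
    by (rule a; assumption)+
qed

lemma harmonic_ext_admissible: "admissible K (harmonic_ext k g)"
proof -
  have "H1_01 (harmonic_ext k g \<circ> (word_map G w \<circ> param c l))"
    if "(c, l) \<in> edges1" "w \<in> all_words" for c l w k g
    using that
  proof (induction w arbitrary: k g)
    case Nil
    then show ?case
      using harmonic_ext_segment_H1(1)[OF Nil(1)] by (simp only: word_map_Nil id_comp)
  next
    case (Cons i w)
    then have i: "i \<in> {1..N}" "w \<in> all_words" by (auto simp: mem_all_words)
    have *: "(harmonic_ext k g \<circ> (word_map G (i # w) \<circ> param c l)) t =
        (harmonic_ext (Suc k) (minimizer k g \<circ> G i) \<circ> (word_map G w \<circ> param c l)) t" if "t \<in> {0..1}" for t
      using harmonic_ext_cell[OF i(1) word_map_G_in_K[OF i(2) param_in_K[OF Cons.prems(1) that]]] by simp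
    have "H1_01 (harmonic_ext k g \<circ> (word_map G (i # w) \<circ> param c l)) =
        H1_01 (harmonic_ext (Suc k) (minimizer k g \<circ> G i) \<circ> (word_map G w \<circ> param c l))"
      by (rule H1_01_cong(1)) (rule *)
    then show ?case by (simp only: Cons.IH[OF Cons.prems(1) i(2)])
  qed
  then show ?thesis
    unfolding admissible_def using harmonic_ext_continuous by blast
qed

text \<open>Every refinement attains the infimum, which a harmonic structure equates with the form
  one level up. So the approximating energies are constant in \<open>n\<close>, and the total energy
  is that of the boundary data.\<close>

lemma harmonic_ext_energy: "shifted_energy k n (harmonic_ext k g) = Q_Sigma r0 g"
proof (induction n arbitrary: k g)
  case 0
  show ?case
    unfolding shifted_energy_0 by (rule Q_Sigma_cong) (rule harmonic_ext_V0)
next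
  case (Suc n)
  have "shifted_energy (Suc k) n (harmonic_ext k g \<circ> G i) = Q_Sigma r0 (minimizer k g \<circ> G i)"
    if "i \<in> {1..N}" for i
  proof -
    have "shifted_energy (Suc k) n (harmonic_ext k g \<circ> G i) =
        shifted_energy (Suc k) n (harmonic_ext (Suc k) (minimizer k g \<circ> G i))"
      by (rule shifted_energy_cong) (simp only: comp_apply harmonic_ext_cell[OF that])
    then show ?thesis by (simp only: Suc.IH)
  qed
  moreover have "D (rho (Suc k)) (harmonic_ext k g) =
      (\<Sum>(c, l)\<in>edges1. (minimizer k g c - minimizer k g (attach c l))\<^sup>2 / rho (Suc k) (c, l))"
    unfolding D_def by (rule sum.cong) (auto simp: harmonic_ext_segment_H1)
  ultimately have "shifted_energy k (Suc n) (harmonic_ext k g) = level_Q1 k (minimizer k g)"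
    by (simp add: shifted_energy_Suc Q1_def)
  then show ?case by (simp add: minimizer_Q1)
qed

end

section \<open>Cutoff functions\<close>

context regular_sequence
begin

lemma glue_energy:
  assumes U: "\<And>i. i \<in> {1..N} \<Longrightarrow> admissible K (U i)"
    "\<And>i n. i \<in> {1..N} \<Longrightarrow> shifted_energy (Suc k) n (U i) \<le> B i"
    and v: "\<And>e. e \<in> edges1 \<Longrightarrow> continuous_on {0..1} (v e)" "\<And>e. e \<in> edges1 \<Longrightarrow> H1_01 (v e)"
    and comp: "compatible U v"
  shows "admissible K (glue U v)"
    "shifted_energy k n (glue U v) \<le>
      1 / lam (Suc k) * (\<Sum>i\<in>{1..N}. B i) + (\<Sum>e\<in>edges1. 1 / rho (Suc k) e * dirichlet_01 (v e))"
proof -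
  have cell: "(glue U v \<circ> G i) x = U i x" if "i \<in> {1..N}" "x \<in> K" for i x
    using glue_cell[OF comp that] by simp
  have seg: "(glue U v \<circ> param c l) t = v (c, l) t" if "(c, l) \<in> edges1" "t \<in> {0..1}" for c l t
    using glue_segment[OF comp that] by simp
  show g: "admissible K (glue U v)"
  proof (rule admissible_I)
    show "admissible K (glue U v \<circ> G i)" if "i \<in> {1..N}" for i
      by (rule admissible_cong[OF _ U(1)[OF that]]) (rule cell[OF that, symmetric])
    show "continuous_on {0..1} (glue U v \<circ> param c l)" if "(c, l) \<in> edges1" for c l
      by (rule continuous_on_eq[OF v(1)[OF that]]) (rule seg[OF that, symmetric])
    show "H1_01 (glue U v \<circ> param c l)" if "(c, l) \<in> edges1" for c l
    proof -
      have "H1_01 (glue U v \<circ> param c l) = H1_01 (v (c, l))"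
        by (rule H1_01_cong(1)) (rule seg[OF that])
      then show ?thesis using v(2)[OF that] by simp
    qed
  qed
  have E: "shifted_energy (Suc k) n (glue U v \<circ> G i) \<le> B i" if "i \<in> {1..N}" for i n
  proof -
    have "shifted_energy (Suc k) n (glue U v \<circ> G i) = shifted_energy (Suc k) n (U i)"
      by (rule shifted_energy_cong) (rule cell[OF that])
    then show ?thesis using U(2)[OF that] by simp
  qed
  have D: "D (rho (Suc k)) (glue U v) = (\<Sum>e\<in>edges1. 1 / rho (Suc k) e * dirichlet_01 (v e))"
    unfolding D_def
  proof (rule sum.cong[OF refl])
    fix e assume e: "e \<in> edges1"
    obtain c l where cl: "e = (c, l)" by (cases e)
    have "dirichlet_01 (glue U v \<circ> param c l) = dirichlet_01 (v (c, l))"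
      by (rule H1_01_cong(2)) (rule seg[OF e[unfolded cl]])
    then show "(case e of (c, l) \<Rightarrow> 1 / rho (Suc k) (c, l) * dirichlet_01 (glue U v \<circ> param c l)) =
        1 / rho (Suc k) e * dirichlet_01 (v e)"
      by (simp add: cl)
  qed
  \<comment> \<open>The recursion evaluates the energy at a positive index; monotonicity transfers
    the bound to every \<open>n\<close>, zero included.\<close>
  have "shifted_energy k n (glue U v) \<le> shifted_energy k (Suc n) (glue U v)"
    by (rule shifted_energy_mono_Suc[OF g])
  also have "\<dots> \<le> 1 / lam (Suc k) * (\<Sum>i\<in>{1..N}. B i) + (\<Sum>e\<in>edges1. 1 / rho (Suc k) e * dirichlet_01 (v e))"
    unfolding shifted_energy_Suc D using lam_pos[of k] E
    by (intro add_right_mono mult_left_mono sum_mono) auto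
  finally show "shifted_energy k n (glue U v) \<le>
      1 / lam (Suc k) * (\<Sum>i\<in>{1..N}. B i) + (\<Sum>e\<in>edges1. 1 / rho (Suc k) e * dirichlet_01 (v e))" .
qed

text \<open>The cells of level \<open>n\<close> with a boundary point in \<open>T\<close>. On all
  other cells the cutoff for \<open>T\<close> vanishes, so only these can contribute to its
  energy.\<close>

definition touched :: "nat \<Rightarrow> 'a set \<Rightarrow> nat list set" where
  "touched n T = {w \<in> words n. word_map F w ` postcritical \<inter> T \<noteq> {}}"

definition total_conductance :: real where
  "total_conductance = (\<Sum>e\<in>E0. real_of_ereal (1 / r0 e))"

lemma total_conductance_nonneg: "0 \<le> total_conductance"
  unfolding total_conductance_def using r0_pos by (intro sum_nonneg conductance_nonneg) auto

lemma finite_touched [simp]: "finite (touched n T)"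
  by (simp add: touched_def)

lemma touched_alt: "touched n T = {w \<in> words n. \<exists>p\<in>postcritical. word_map F w p \<in> T}"
  unfolding touched_def by blast

lemma card_touched_Suc: "card (touched (Suc n) T) = (\<Sum>i\<in>{1..N}. card (touched n {p. F i p \<in> T}))"
proof -
  have "touched (Suc n) T = (\<lambda>(i, w). i # w) ` (SIGMA i:{1..N}. touched n {p. F i p \<in> T})"
    unfolding touched_alt words_Suc by (auto simp: image_iff)
  then show ?thesis
    by (simp add: card_image[OF inj_on_Cons_pair] card_SigmaI)
qed

text \<open>The clusters of segments meeting at level \<open>n\<close> correspond to points of the unstretched set \<open>X\<close>;
  the indicator of a set of such points is extended into the \<open>n\<close>-cells by harmonic functions.\<close>

lemma cutoff_exists:
  "\<exists>u. admissible K u \<and>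
    (\<forall>w\<in>words n. word_map F w ` postcritical \<subseteq> T \<longrightarrow> (\<forall>x\<in>K. u (word_map G w x) = 1)) \<and>
    (\<forall>w\<in>words n. word_map F w ` postcritical \<inter> T = {} \<longrightarrow> (\<forall>x\<in>K. u (word_map G w x) = 0)) \<and>
    (\<forall>p\<in>postcritical. u (hat p) = of_bool (p \<in> T)) \<and>
    (\<forall>m. shifted_energy k m u \<le> total_conductance / lam_prod k n * card (touched n T))"
proof (induction n arbitrary: k T)
  case 0
  consider "postcritical \<subseteq> T" | "postcritical \<inter> T = {}" | "\<not> postcritical \<subseteq> T" "postcritical \<inter> T \<noteq> {}"
    by blast
  then show ?case
  proof cases
    case 1
    have ne: "postcritical \<inter> T \<noteq> {}" using 1 postcritical_nonempty by blast
    show ?thesis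
      by (rule exI[of _ "\<lambda>_. 1"])
        (use 1 ne in \<open>auto simp: admissible_const shifted_energy_const total_conductance_nonneg\<close>)
  next
    case 2
    have ne: "\<not> postcritical \<subseteq> T" using 2 postcritical_nonempty by blast
    show ?thesis
      by (rule exI[of _ "\<lambda>_. 0"])
        (use 2 ne in \<open>auto simp: admissible_const shifted_energy_const total_conductance_nonneg\<close>)
  next
    case 3
    \<comment> \<open>\<open>T\<close> consists of points of X but the boundary data live on
      stretched vertices; since \<open>hat\<close> is injective, the value at \<open>hat p\<close>
      depends on \<open>p\<close> alone.\<close>
    define g where "g x = (of_bool (\<exists>p\<in>postcritical. p \<in> T \<and> x = hat p) :: real)" for x
    have "touched 0 T = {[]}" using 3 by (auto simp: touched_def)
    moreover have "Q_Sigma r0 g \<le> total_conductance"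
      unfolding total_conductance_def by (rule Q_Sigma_indicator_le[OF r0_pos]) (simp add: g_def of_bool_def)
    moreover have "harmonic_ext k g (hat p) = of_bool (p \<in> T)" if p: "p \<in> postcritical" for p
    proof -
      have "hat p \<in> V0" using p by (simp add: V0_def)
      moreover have "g (hat p) = of_bool (p \<in> T)"
        unfolding g_def using p hat_inj[OF p] by (intro arg_cong[of _ _ of_bool]) blast
      ultimately show ?thesis by (simp add: harmonic_ext_V0)
    qed
    ultimately show ?thesis
      using 3 by (intro exI[of _ "harmonic_ext k g"]) (auto simp: harmonic_ext_admissible harmonic_ext_energy)
  qed
next
  case (Suc n)
  \<comment> \<open>The induction hypothesis is applied in each copy to the part of \<open>T\<close>
    seen from there.\<close>
  define T' where "T' i = {p. F i p \<in> T}" for i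
  have "\<forall>i. \<exists>u. admissible K u \<and>
    (\<forall>w\<in>words n. word_map F w ` postcritical \<subseteq> T' i \<longrightarrow> (\<forall>x\<in>K. u (word_map G w x) = 1)) \<and>
    (\<forall>w\<in>words n. word_map F w ` postcritical \<inter> T' i = {} \<longrightarrow> (\<forall>x\<in>K. u (word_map G w x) = 0)) \<and>
    (\<forall>p\<in>postcritical. u (hat p) = of_bool (p \<in> T' i)) \<and>
    (\<forall>m. shifted_energy (Suc k) m u \<le> total_conductance / lam_prod (Suc k) n * card (touched n (T' i)))"
    using Suc.IH by (intro allI)
  from choice[OF this] obtain U where U: "\<And>i. admissible K (U i)"
    "\<And>i w x. w \<in> words n \<Longrightarrow> word_map F w ` postcritical \<subseteq> T' i \<Longrightarrow> x \<in> K \<Longrightarrow> U i (word_map G w x) = 1"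
    "\<And>i w x. w \<in> words n \<Longrightarrow> word_map F w ` postcritical \<inter> T' i = {} \<Longrightarrow> x \<in> K \<Longrightarrow> U i (word_map G w x) = 0"
    "\<And>i p. p \<in> postcritical \<Longrightarrow> U i (hat p) = of_bool (p \<in> T' i)"
    "\<And>i m. shifted_energy (Suc k) m (U i) \<le> total_conductance / lam_prod (Suc k) n * card (touched n (T' i))"
    by metis
  \<comment> \<open>Each segment carries the constant value decided by its critical point. It stores
    no energy however small its resistance is, and all segments at one point agree.\<close>
  define v :: "'a \<times> nat \<Rightarrow> real \<Rightarrow> real" where "v e t = of_bool (fst e \<in> T)" for e t
  have comp: "compatible U v"
    unfolding compatible_def
  proof (intro conjI allI impI)
    fix c l i y assume a: "(c, l) \<in> edges1" "i \<in> {1..N}" "y \<in> K" "attach c l = G i y"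
    have "y \<in> V0" by (rule attach_eq_cell_imp_V0[OF a])
    then obtain p where p: "p \<in> postcritical" "y = hat p" by (auto simp: V0_def)
    have "c = F i p"
      by (rule attach_G_hat[OF a(1) p(1) a(2)]) (simp add: a(4) p(2))
    then show "v (c, l) 0 = U i y"
      using U(4)[OF p(1)] p(2) by (simp add: v_def T'_def)
  qed (simp add: v_def)
  have v: "continuous_on {0..1} (v e)" "H1_01 (v e)" "dirichlet_01 (v e) = 0" for e
    using H1_01_affine[of "v e" "of_bool (fst e \<in> T)" 0] by (auto simp: v_def[abs_def])
  define u where "u = glue U v"
  note ge = glue_energy[OF U(1) U(5) v(1) v(2) comp, folded u_def]
  have cell: "u (word_map G (i # w) x) = U i (word_map G w x)"
    if "i \<in> {1..N}" "w \<in> words n" "x \<in> K" for i w x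
    unfolding u_def word_map_Cons using that words_subset
    by (intro glue_cell comp word_map_G_in_K) auto
  have energy: "shifted_energy k m u \<le> total_conductance / lam_prod k (Suc n) * card (touched (Suc n) T)" for m
  proof -
    have "shifted_energy k m u \<le>
        1 / lam (Suc k) * (\<Sum>i\<in>{1..N}. total_conductance / lam_prod (Suc k) n * card (touched n (T' i)))"
      using ge(2)[of m] by (simp add: v(3))
    also have "\<dots> = total_conductance / lam_prod k (Suc n) * card (touched (Suc n) T)"
      unfolding card_touched_Suc T'_def lam_prod_Suc by (simp add: sum_distrib_left)
    finally show ?thesis .
  qed
  have hats: "u (hat p) = of_bool (p \<in> T)" if p: "p \<in> postcritical" for p
  proof -
    obtain i p' where i: "i \<in> {1..N}" "p' \<in> postcritical" "hat p = G i (hat p')"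
      using V0_cell[OF p] by blast
    have "p = F i p'" by (rule hat_G_hat[OF p i(2,1,3)])
    moreover have "u (hat p) = U i (hat p')"
      unfolding u_def i(3) by (rule glue_cell[OF comp i(1) hat_in_K[OF i(2)]])
    ultimately show ?thesis using U(4)[OF i(2)] by (simp add: T'_def)
  qed
  have one: "u (word_map G w x) = 1"
    if w: "w \<in> words (Suc n)" and T: "word_map F w ` postcritical \<subseteq> T" and x: "x \<in> K" for w x
  proof -
    obtain i w' where iw: "i \<in> {1..N}" "w' \<in> words n" "w = i # w'"
      using w by (auto simp: words_Suc)
    then have "word_map F w' ` postcritical \<subseteq> T' i" using T by (auto simp: T'_def)
    then show ?thesis using cell[OF iw(1,2) x] U(2)[OF iw(2) _ x] iw(3) by simp
  qed
  have zero: "u (word_map G w x) = 0"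
    if w: "w \<in> words (Suc n)" and T: "word_map F w ` postcritical \<inter> T = {}" and x: "x \<in> K" for w x
  proof -
    obtain i w' where iw: "i \<in> {1..N}" "w' \<in> words n" "w = i # w'"
      using w by (auto simp: words_Suc)
    then have "word_map F w' ` postcritical \<inter> T' i = {}" using T by (auto simp: T'_def)
    then show ?thesis using cell[OF iw(1,2) x] U(3)[OF iw(2) _ x] iw(3) by simp
  qed
  show ?case
    using ge(1) one zero hats energy by (intro exI[of _ u] conjI ballI allI impI)
qed

text \<open>A touched cell shares one of the finitely many boundary points of the cell of
  \<open>w\<close>, and each point lies in a number of cells bounded independently of the
  level.\<close>

lemma card_touched_cell:
  assumes "w \<in> all_words"
  shows "card (touched n (word_map F w ` postcritical)) \<le> card postcritical * max 1 (card critical_codes)"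
proof -
  let ?W = "\<lambda>p. {v \<in> words n. word_map F w p \<in> word_map F v ` X}"
  have "touched n (word_map F w ` postcritical) \<subseteq> (\<Union>p\<in>postcritical. ?W p)"
  proof
    fix v assume "v \<in> touched n (word_map F w ` postcritical)"
    then obtain p p' where "v \<in> words n" "p \<in> postcritical" "p' \<in> postcritical"
      "word_map F w p = word_map F v p'"
      unfolding touched_def by force
    then show "v \<in> (\<Union>p\<in>postcritical. ?W p)"
      using postcritical_subset_X by auto
  qed
  then have "card (touched n (word_map F w ` postcritical)) \<le> card (\<Union>p\<in>postcritical. ?W p)"
    by (intro card_mono) (auto simp: finite_postcritical)
  also have "\<dots> \<le> (\<Sum>p\<in>postcritical. card (?W p))"
    by (rule card_UN_le[OF finite_postcritical])
  also have "\<dots> \<le> (\<Sum>p\<in>postcritical. max 1 (card critical_codes))"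
    by (intro sum_mono card_cells_at_point)
  finally show ?thesis by simp
qed

text \<open>The trapezoid vanishes at both ends of the segment, so zero continues it to the rest of
  K and a single segment holds all of the energy.\<close>

lemma segment_bump_exists:
  assumes e: "(c, l) \<in> edges1" and st: "0 \<le> s" "s < t" "t \<le> 3 / 4"
  shows "\<exists>u. admissible K u \<and> u (param c l s) = 0 \<and> u (param c l t) = 1 \<and>
    (\<forall>m. shifted_energy k m u \<le> 1 / rho (Suc k) (c, l) * (5 / (t - s)))"
proof -
  obtain f where f: "continuous_on {0..1} f" "H1_01 f" "dirichlet_01 f \<le> 5 / (t - s)"
    "f 0 = 0" "f 1 = 0" "f s = 0" "f t = 1"
    using trapezoid_01[OF st] by blast
  define v where "v e = (if e = (c, l) then f else (\<lambda>_. 0))" for e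
  have comp: "compatible (\<lambda>_ _. 0) v"
    unfolding compatible_def v_def using f by auto
  have z: "H1_01 (\<lambda>_. 0)" "dirichlet_01 (\<lambda>_. 0) = 0"
    using H1_01_affine[of "\<lambda>_. 0" 0 0] by auto
  have v: "continuous_on {0..1} (v e)" "H1_01 (v e)" for e
    using f z by (auto simp: v_def)
  have e0: "shifted_energy (Suc k) n (\<lambda>_. 0) \<le> 0" for n
    by (simp add: shifted_energy_const)
  note ge = glue_energy[where B = "\<lambda>_. 0", OF admissible_const e0 v(1) v(2) comp]
  have "(\<Sum>e\<in>edges1. 1 / rho (Suc k) e * dirichlet_01 (v e)) = 1 / rho (Suc k) (c, l) * dirichlet_01 f"
    by (subst sum.remove[OF finite_edges1 e]) (simp add: v_def z)
  also have "\<dots> \<le> 1 / rho (Suc k) (c, l) * (5 / (t - s))"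
    using f(3) rho_pos[of k] e by (intro mult_left_mono) (auto simp: less_imp_le)
  finally have "shifted_energy k m (glue (\<lambda>_ _. 0) v) \<le> 1 / rho (Suc k) (c, l) * (5 / (t - s))" for m
    using ge(2)[of m] by simp
  moreover have "glue (\<lambda>_ _. 0) v (param c l s) = 0" "glue (\<lambda>_ _. 0) v (param c l t) = 1"
    using glue_segment[OF comp e, of s] glue_segment[OF comp e, of t] st f by (auto simp: v_def)
  ultimately show ?thesis using ge(1) by blast
qed

end

section \<open>The resistance metric\<close>

context regular_sequence
begin

abbreviation R :: "'a \<Rightarrow> 'a \<Rightarrow> real" where
  "R \<equiv> resistance r0 lam rho"

abbreviation total_energy :: "('a \<Rightarrow> real) \<Rightarrow> real" where
  "total_energy \<equiv> energy r0 lam rho"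

lemma shifted_energy_unshifted: "shifted_energy 0 n u = energy_n r0 lam rho n u"
  by (simp add: shifted_energy_def)

lemma domainD:
  assumes "u \<in> domain r0 lam rho"
  shows "admissible K u" "shifted_energy 0 n u \<le> total_energy u"
proof -
  show g: "admissible K u"
    using assms unfolding domain_def admissible_def by blast
  have "convergent (\<lambda>n. shifted_energy 0 n u)"
    using assms unfolding domain_def shifted_energy_unshifted by blast
  then have "(\<lambda>n. shifted_energy 0 n u) \<longlonglongrightarrow> total_energy u"
    unfolding energy_def shifted_energy_unshifted by (simp add: convergent_LIMSEQ_iff)
  then show "shifted_energy 0 n u \<le> total_energy u"
    by (rule incseq_le[rotated]) (auto simp: incseq_def intro: shifted_energy_mono[OF g])
qed

lemma domainI:
  assumes g: "admissible K u" and B: "\<And>n. shifted_energy 0 n u \<le> B"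
  shows "u \<in> domain r0 lam rho" "total_energy u \<le> B"
proof -
  have inc: "incseq (\<lambda>n. shifted_energy 0 n u)"
    by (auto simp: incseq_def intro: shifted_energy_mono[OF g])
  then obtain L where L: "(\<lambda>n. shifted_energy 0 n u) \<longlonglongrightarrow> L"
    using incseq_convergent[OF inc, of B] B by blast
  then have "convergent (\<lambda>n. shifted_energy 0 n u)" by (auto simp: convergent_def)
  then show "u \<in> domain r0 lam rho"
    using g unfolding domain_def admissible_def shifted_energy_unshifted by blast
  have "total_energy u = L"
    using L unfolding energy_def shifted_energy_unshifted by (rule limI)
  moreover have "L \<le> B"
    by (rule LIMSEQ_le_const2[OF L]) (use B in blast)
  ultimately show "total_energy u \<le> B" by simp
qed

text \<open>The oscillation bound is used twice: distinct values force positive energy, so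
  \<open>u\<close> is a competitor, and the quotients are bounded, so the real supremum is a genuine
  one.\<close>

lemma resistance_ge:
  assumes u: "admissible K u" "\<And>n. shifted_energy 0 n u \<le> B" and xy: "x \<in> K" "y \<in> K" "u x \<noteq> u y"
  shows "(u x - u y)\<^sup>2 / B \<le> R x y"
proof -
  obtain C where C: "0 < C" "\<And>u B x y. admissible K u \<Longrightarrow> (\<forall>n. shifted_energy 0 n u \<le> B) \<Longrightarrow> x \<in> K \<Longrightarrow> y \<in> K \<Longrightarrow>
     (u x - u y)\<^sup>2 \<le> C * B"
    using oscillation_bound by blast
  note d = domainI[OF u]
  have le: "(u x - u y)\<^sup>2 \<le> C * total_energy u"
    if "u \<in> domain r0 lam rho" for u
    using C(2)[OF domainD(1)[OF that] _ xy(1,2)] domainD(2)[OF that] by blast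
  have "0 < (u x - u y)\<^sup>2" using xy(3) by simp
  also have "\<dots> \<le> C * total_energy u" by (rule le[OF d(1)])
  finally have pos: "0 < total_energy u" using C(1) by (simp add: zero_less_mult_iff)
  have "(u x - u y)\<^sup>2 / B \<le> (u x - u y)\<^sup>2 / total_energy u"
    using pos d(2) by (intro divide_left_mono) auto
  also have "\<dots> \<le> R x y"
    unfolding resistance_def
  proof (rule cSup_upper)
    show "(u x - u y)\<^sup>2 / total_energy u \<in>
        {\<bar>u x - u y\<bar>\<^sup>2 / total_energy u | u. u \<in> domain r0 lam rho \<and> total_energy u > 0}"
      using d(1) pos by auto
    show "bdd_above {\<bar>u x - u y\<bar>\<^sup>2 / total_energy u | u. u \<in> domain r0 lam rho \<and> total_energy u > 0}"
      by (rule bdd_aboveI[of _ C]) (auto simp: divide_le_eq dest: le)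
  qed
  finally show ?thesis .
qed

text \<open>A supremum over the empty set of reals would carry no information; a bump on one segment
  shows that competitors exist.\<close>

lemma positive_energy_exists:
  "\<exists>u. u \<in> domain r0 lam rho \<and> 0 < total_energy u"
proof -
  obtain c l where e: "(c, l) \<in> edges1" using edges1_nonempty by (metis ex_in_conv surj_pair)
  obtain u where u: "admissible K u" "u (param c l 0) = 0" "u (param c l (1/2)) = 1"
    "\<And>m. shifted_energy 0 m u \<le> 1 / rho (Suc 0) (c, l) * (5 / (1/2 - 0))"
    using segment_bump_exists[OF e, of 0 "1/2" 0] by auto
  obtain C where C: "0 < C" "\<And>u B x y. admissible K u \<Longrightarrow> (\<forall>n. shifted_energy 0 n u \<le> B) \<Longrightarrow> x \<in> K \<Longrightarrow> y \<in> K \<Longrightarrow>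
     (u x - u y)\<^sup>2 \<le> C * B"
    using oscillation_bound by blast
  have d: "u \<in> domain r0 lam rho"
    by (rule domainI(1)[OF u(1,4)])
  have "(u (param c l 0) - u (param c l (1/2)))\<^sup>2 \<le> C * total_energy u"
    by (rule C(2)[OF u(1)]) (use domainD(2)[OF d] param_in_K[OF e, of 0] param_in_K[OF e, of "1/2"] in auto)
  then have "0 < C * total_energy u" unfolding u(2,3) by simp
  then have "0 < total_energy u" using C(1) by (simp add: zero_less_mult_iff)
  then show ?thesis using d by blast
qed

lemma resistance_le:
  assumes "\<And>u B. admissible K u \<Longrightarrow> (\<And>n. shifted_energy 0 n u \<le> B) \<Longrightarrow> (u x - u y)\<^sup>2 \<le> C * B"
  shows "R x y \<le> C"
  unfolding resistance_def
proof (rule cSup_least)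
  show "{\<bar>u x - u y\<bar>\<^sup>2 / total_energy u | u. u \<in> domain r0 lam rho \<and> total_energy u > 0} \<noteq> {}"
    using positive_energy_exists by blast
  fix z assume "z \<in> {\<bar>u x - u y\<bar>\<^sup>2 / total_energy u | u. u \<in> domain r0 lam rho \<and> total_energy u > 0}"
  then obtain u where u: "u \<in> domain r0 lam rho" "0 < total_energy u" "z = \<bar>u x - u y\<bar>\<^sup>2 / total_energy u" by blast
  have "(u x - u y)\<^sup>2 \<le> C * total_energy u"
    by (rule assms[OF domainD(1)[OF u(1)] domainD(2)[OF u(1)]])
  then show "z \<le> C" using u(2,3) by (simp add: divide_le_eq)
qed

lemma resistance_nonneg:
  assumes "x \<in> K" "y \<in> K"
  shows "0 \<le> R x y"
proof -
  obtain u where u: "u \<in> domain r0 lam rho" "0 < total_energy u" using positive_energy_exists by blast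
  show ?thesis
  proof (cases "u x = u y")
    case False
    have "0 \<le> (u x - u y)\<^sup>2 / total_energy u" using u by simp
    also have "\<dots> \<le> R x y"
      by (rule resistance_ge[OF domainD[OF u(1)] assms False])
    finally show ?thesis .
  next
    case True
    obtain C where C: "0 < C" "\<And>u B x y. admissible K u \<Longrightarrow> (\<forall>n. shifted_energy 0 n u \<le> B) \<Longrightarrow> x \<in> K \<Longrightarrow> y \<in> K \<Longrightarrow>
       (u x - u y)\<^sup>2 \<le> C * B"
      using oscillation_bound by blast
    have "(u x - u y)\<^sup>2 \<le> C * total_energy u" if "u \<in> domain r0 lam rho" for u
      using C(2)[OF domainD(1)[OF that] _ assms] domainD(2)[OF that] by blast
    then have "bdd_above {\<bar>u x - u y\<bar>\<^sup>2 / total_energy u | u. u \<in> domain r0 lam rho \<and> total_energy u > 0}"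
      by (intro bdd_aboveI[of _ C]) (auto simp: divide_le_eq)
    moreover have "0 \<in> {\<bar>u x - u y\<bar>\<^sup>2 / total_energy u | u. u \<in> domain r0 lam rho \<and> total_energy u > 0}"
    proof (rule CollectI, intro exI conjI)
      show "0 = \<bar>u x - u y\<bar>\<^sup>2 / total_energy u" using True by simp
    qed (use u in auto)
    ultimately show ?thesis
      unfolding resistance_def by (intro cSup_upper)
  qed
qed

lemma resistance_sym: "R x y = R y x"
  unfolding resistance_def by (simp add: abs_minus_commute)

section \<open>Resistance estimates for cells and segments\<close>

lemma lam_prod_le_1: "lam_prod k n \<le> 1"
  unfolding lam_prod_def
  by (intro prod_le_1) (auto intro: less_imp_le lam_pos harmonic_structureD(3)[OF harmonic_Suc])

text \<open>Restricted to the cell, a function has energy at most \<open>lam_prod\<close> times its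
  total energy, and the oscillation bound holds with one constant for all tails.\<close>

lemma resistance_cell_le:
  "\<exists>C>0. \<forall>w\<in>all_words. \<forall>x\<in>K. \<forall>y\<in>K. R (word_map G w x) (word_map G w y) \<le> C * lam_prod 0 (length w)"
proof -
  obtain C where C: "0 < C" "\<And>k u B x y. admissible K u \<Longrightarrow> (\<forall>n. shifted_energy k n u \<le> B) \<Longrightarrow> x \<in> K \<Longrightarrow> y \<in> K \<Longrightarrow>
     (u x - u y)\<^sup>2 \<le> C * B"
    using oscillation_bound by blast
  have "R (word_map G w x) (word_map G w y) \<le> C * lam_prod 0 (length w)"
    if w: "w \<in> all_words" and xy: "x \<in> K" "y \<in> K" for w x y
  proof (rule resistance_le)
    fix u B assume u: "admissible K u" "\<And>n. shifted_energy 0 n u \<le> B"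
    have "((u \<circ> word_map G w) x - (u \<circ> word_map G w) y)\<^sup>2 \<le> C * (lam_prod 0 (length w) * B)"
      by (rule C(2)[OF admissible_word_map[OF u(1) w] _ xy]) (use shifted_energy_word[OF u(2) w] in blast)
    then show "(u (word_map G w x) - u (word_map G w y))\<^sup>2 \<le> C * lam_prod 0 (length w) * B"
      by (simp add: mult.assoc)
  qed
  then show ?thesis using C(1) by blast
qed

text \<open>Segments are Lipschitz curves for the resistance metric. As the products of the lambdas
  are at most one, a single constant works on all levels.\<close>

lemma resistance_segment_le:
  assumes e: "(c, l) \<in> edges1" and w: "w \<in> all_words" and st: "s \<in> {0..1}" "t \<in> {0..1}"
  shows "R (word_map G w (param c l s)) (word_map G w (param c l t)) \<le> rho_max * \<bar>s - t\<bar>"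
proof (rule resistance_le)
  fix u B assume u: "admissible K u" "\<And>n. shifted_energy 0 n u \<le> B"
  let ?u = "u \<circ> word_map G w"
  have B: "0 \<le> B" using u(2) shifted_energy_nonneg order_trans by blast
  have "(?u (param c l s) - ?u (param c l t))\<^sup>2 \<le> \<bar>s - t\<bar> * dirichlet_01 (?u \<circ> param c l)"
    by (rule admissible_segment(3)[OF admissible_word_map[OF u(1) w] e st(2,1)])
  also have "\<dots> \<le> \<bar>s - t\<bar> * (rho_max * B)"
  proof (rule mult_left_mono)
    have "dirichlet_01 (?u \<circ> param c l) \<le> rho_max * (lam_prod 0 (length w) * B)"
      by (rule dirichlet_le_energy[OF shifted_energy_word[OF u(2) w] e])
    also have "\<dots> \<le> rho_max * (1 * B)"
      using rho_max_pos lam_prod_le_1[of 0 "length w"] B by (intro mult_left_mono mult_right_mono) auto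
    finally show "dirichlet_01 (?u \<circ> param c l) \<le> rho_max * B" by simp
  qed simp
  finally show "(u (word_map G w (param c l s)) - u (word_map G w (param c l t)))\<^sup>2 \<le> rho_max * \<bar>s - t\<bar> * B"
    by (simp add: mult_ac)
qed

text \<open>The trapezoid separates the two points; its descending part occupies the last quarter of
  the segment, whence the restriction to parameters up to 3/4.\<close>

lemma resistance_segment_ge:
  assumes e: "(c, l) \<in> edges1" and st: "s \<in> {0..3/4}" "t \<in> {0..3/4}"
  shows "rho (Suc 0) (c, l) / 5 * \<bar>s - t\<bar> \<le> R (param c l s) (param c l t)"
proof -
  have lt: "rho (Suc 0) (c, l) / 5 * (t - s) \<le> R (param c l s) (param c l t)"
    if st: "0 \<le> s" "s < t" "t \<le> 3/4" for s t
  proof -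
    obtain u where u: "admissible K u" "u (param c l s) = 0" "u (param c l t) = 1"
      "\<And>m. shifted_energy 0 m u \<le> 1 / rho (Suc 0) (c, l) * (5 / (t - s))"
      using segment_bump_exists[OF e st, of 0] by auto
    have "(u (param c l s) - u (param c l t))\<^sup>2 / (1 / rho (Suc 0) (c, l) * (5 / (t - s))) \<le> R (param c l s) (param c l t)"
      by (rule resistance_ge[OF u(1,4)]) (use u st param_in_K[OF e] in auto)
    then show ?thesis using u(2,3) by simp
  qed
  consider "s < t" | "s = t" | "t < s" by linarith
  then show ?thesis
  proof cases
    case 1
    then show ?thesis using lt[of s t] st by simp
  next
    case 2
    then show ?thesis using resistance_nonneg[OF param_in_K[OF e] param_in_K[OF e], of s s] st by simp
  next
    case 3
    then show ?thesis using lt[of t s] st resistance_sym[of "param c l s"] by simp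
  qed
qed

text \<open>The cutoff for the boundary points of the cell of \<open>w\<close> is one on that cell
  and zero on every cell sharing none of them. Its energy is at most a constant over
  \<open>lam_prod\<close> because boundedly many cells are touched.\<close>

lemma resistance_separated_cells:
  "\<exists>c>0. \<forall>n. \<forall>w\<in>words n. \<forall>v\<in>words n. v \<notin> touched n (word_map F w ` postcritical) \<longrightarrow>
     (\<forall>x\<in>K. \<forall>y\<in>K. c * lam_prod 0 n \<le> R (word_map G w x) (word_map G v y))"
proof -
  \<comment> \<open>The summand 1 makes \<open>M\<close> positive without a separate argument that
    the total conductance is.\<close>
  define M where "M = (total_conductance + 1) * (card postcritical * max 1 (card critical_codes))"
  have "0 < card postcritical" using finite_postcritical postcritical_nonempty by (simp add: card_gt_0_iff)
  then have "0 < real (card postcritical * max 1 (card critical_codes))" by simp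
  then have M: "0 < M" unfolding M_def using total_conductance_nonneg by (intro mult_pos_pos) linarith+
  have "1 / M * lam_prod 0 n \<le> R (word_map G w x) (word_map G v y)"
    if w: "w \<in> words n" and v: "v \<in> words n" "v \<notin> touched n (word_map F w ` postcritical)"
      and xy: "x \<in> K" "y \<in> K" for n w v x y
  proof -
    define T where "T = word_map F w ` postcritical"
    obtain u where u: "admissible K u" "\<forall>w\<in>words n. word_map F w ` postcritical \<subseteq> T \<longrightarrow> (\<forall>x\<in>K. u (word_map G w x) = 1)"
      "\<forall>w\<in>words n. word_map F w ` postcritical \<inter> T = {} \<longrightarrow> (\<forall>x\<in>K. u (word_map G w x) = 0)"
      "\<forall>m. shifted_energy 0 m u \<le> total_conductance / lam_prod 0 n * card (touched n T)"
      using cutoff_exists[of n T 0] by (elim exE conjE)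
    have E: "shifted_energy 0 m u \<le> M / lam_prod 0 n" for m
    proof -
      have "real (card (touched n T)) \<le> real (card postcritical * max 1 (card critical_codes))"
        unfolding T_def using card_touched_cell[of w n] w words_subset by (intro of_nat_mono) blast
      then have "total_conductance * card (touched n T) \<le> M"
        unfolding M_def using total_conductance_nonneg by (intro mult_mono) auto
      then have "total_conductance * card (touched n T) / lam_prod 0 n \<le> M / lam_prod 0 n"
        using lam_prod_pos[of 0 n] by (intro divide_right_mono) auto
      then show ?thesis using u(4)[rule_format, of m] by simp
    qed
    have w1: "u (word_map G w x) = 1" using u(2) w xy(1) by (simp add: T_def)
    have "word_map F v ` postcritical \<inter> T = {}" using v by (simp add: touched_def T_def)
    then have v0: "u (word_map G v y) = 0" using u(3) v(1) xy(2) by blast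
    have inK: "word_map G w x \<in> K" "word_map G v y \<in> K"
      using w v(1) xy words_subset by (auto intro!: word_map_G_in_K)
    have "(u (word_map G w x) - u (word_map G v y))\<^sup>2 / (M / lam_prod 0 n) \<le> R (word_map G w x) (word_map G v y)"
      by (rule resistance_ge[OF u(1) E inK]) (simp add: w1 v0)
    then show ?thesis by (simp add: w1 v0)
  qed
  then show ?thesis using M by (intro exI[of _ "1 / M"]) auto
qed

end

section \<open>Hausdorff measures and coverings\<close>

lemma diam_wrt_ge:
  assumes "x \<in> U" "y \<in> U" "\<And>x y. x \<in> U \<Longrightarrow> y \<in> U \<Longrightarrow> d x y \<le> C"
  shows "d x y \<le> diam_wrt d U"
proof -
  have "(\<lambda>(x, y). d x y) (x, y) \<le> (SUP (x, y)\<in>U \<times> U. d x y)"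
    using assms by (intro cSUP_upper bdd_aboveI[of _ C]) auto
  then show ?thesis using assms(1) by (auto simp: diam_wrt_def)
qed

lemma diam_wrt_le:
  assumes "0 \<le> b" "\<And>x y. x \<in> U \<Longrightarrow> y \<in> U \<Longrightarrow> d x y \<le> b"
  shows "diam_wrt d U \<le> b"
proof (cases "U = {}")
  case False
  then have "(SUP (x, y)\<in>U \<times> U. d x y) \<le> b"
    using assms by (intro cSUP_least) auto
  then show ?thesis using False by (simp add: diam_wrt_def)
qed (simp add: diam_wrt_def assms)

lemma diam_wrt_nonneg:
  assumes "\<And>x y. x \<in> U \<Longrightarrow> y \<in> U \<Longrightarrow> 0 \<le> d x y" "\<And>x y. x \<in> U \<Longrightarrow> y \<in> U \<Longrightarrow> d x y \<le> C"
  shows "0 \<le> diam_wrt d U"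
proof (cases "U = {}")
  case False
  then obtain x where "x \<in> U" by blast
  then show ?thesis using diam_wrt_ge[of x U x d C] assms by (meson order_trans)
qed (simp add: diam_wrt_def)

text \<open>Coverings are sequences, so a finite family is enumerated and continued by empty sets,
  which contribute \<open>0 powr s = 0\<close>.\<close>

lemma hausdorff_premeasure_le_finite:
  fixes A :: "'i \<Rightarrow> 'a set"
  assumes I: "finite I" and A: "\<And>i. i \<in> I \<Longrightarrow> A i \<subseteq> S" "S \<subseteq> (\<Union>i\<in>I. A i)"
    and b: "\<And>i x y. i \<in> I \<Longrightarrow> x \<in> A i \<Longrightarrow> y \<in> A i \<Longrightarrow> d x y \<le> b i" "\<And>i. i \<in> I \<Longrightarrow> 0 \<le> b i \<and> b i \<le> \<delta>"
    and d: "\<And>x y. x \<in> S \<Longrightarrow> y \<in> S \<Longrightarrow> 0 \<le> d x y" and s: "0 < s"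
  shows "hausdorff_premeasure d s \<delta> S \<le> ennreal (\<Sum>i\<in>I. b i powr s)"
proof -
  obtain h where h: "bij_betw h {0..<card I} I"
    using ex_bij_betw_nat_finite[OF I] by blast
  define U where "U j = (if j < card I then A (h j) else {})" for j
  have hI: "h j \<in> I" if "j < card I" for j
    using bij_betwE[OF h] that by simp
  have cover: "S \<subseteq> (\<Union>j. U j)"
  proof
    fix x assume "x \<in> S"
    then obtain i where i: "i \<in> I" "x \<in> A i" using A(2) by blast
    then obtain j where "j < card I" "i = h j"
      using bij_betw_imp_surj_on[OF h] by force
    then show "x \<in> (\<Union>j. U j)" using i by (auto simp: U_def intro!: exI[of _ j])
  qed
  have U: "U j \<subseteq> S \<and> (\<forall>x\<in>U j. \<forall>y\<in>U j. d x y \<le> \<delta>)" for j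
  proof (cases "j < card I")
    case True
    then show ?thesis
      using A(1)[OF hI[OF True]] b(1)[OF hI[OF True]] b(2)[OF hI[OF True]]
      by (fastforce simp: U_def)
  qed (simp add: U_def)
  have "hausdorff_premeasure d s \<delta> S \<le> (\<Sum>j. ennreal (diam_wrt d (U j) powr s))"
    unfolding hausdorff_premeasure_def by (rule INF_lower) (use cover U in blast)
  also have "\<dots> = (\<Sum>j\<in>{0..<card I}. ennreal (diam_wrt d (U j) powr s))"
    by (rule suminf_finite) (auto simp: U_def diam_wrt_def)
  also have "\<dots> \<le> (\<Sum>j\<in>{0..<card I}. ennreal (b (h j) powr s))"
  proof (rule sum_mono)
    fix j assume j: "j \<in> {0..<card I}"
    then have i: "h j \<in> I" using hI by simp
    have "0 \<le> diam_wrt d (A (h j))"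
      using d A(1)[OF i] b(1)[OF i] by (intro diam_wrt_nonneg[of _ _ "b (h j)"]) auto
    moreover have "diam_wrt d (A (h j)) \<le> b (h j)"
      using b(1)[OF i] b(2)[OF i] by (intro diam_wrt_le) auto
    ultimately show "ennreal (diam_wrt d (U j) powr s) \<le> ennreal (b (h j) powr s)"
      using j s by (intro ennreal_leI) (auto simp: U_def intro!: powr_mono2)
  qed
  also have "\<dots> = ennreal (\<Sum>j\<in>{0..<card I}. b (h j) powr s)"
    by (rule sum_ennreal) simp
  also have "(\<Sum>j\<in>{0..<card I}. b (h j) powr s) = (\<Sum>i\<in>I. b i powr s)"
    by (rule sum.reindex_bij_betw[OF h])
  finally show ?thesis .
qed

lemma hausdorff_measure_zeroI:
  assumes "\<And>\<delta> \<epsilon>. 0 < \<delta> \<Longrightarrow> 0 < \<epsilon> \<Longrightarrow> hausdorff_premeasure d s \<delta> S \<le> ennreal \<epsilon>"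
  shows "hausdorff_measure d s S = 0"
proof -
  have "hausdorff_premeasure d s \<delta> S \<le> 0" if "0 < \<delta>" for \<delta>
    by (rule ennreal_le_epsilon) (use assms[OF that] in simp)
  then have "hausdorff_measure d s S \<le> 0"
    unfolding hausdorff_measure_def by (intro SUP_least) auto
  then show ?thesis by simp
qed

lemma hausdorff_measure_zero_cover:
  assumes "hausdorff_measure d s S = 0" "0 < \<delta>" "0 < (\<epsilon> :: real)"
  obtains U :: "nat \<Rightarrow> 'a set" where "S \<subseteq> (\<Union>i. U i)" "\<And>i. U i \<subseteq> S"
    "\<And>i x y. x \<in> U i \<Longrightarrow> y \<in> U i \<Longrightarrow> d x y \<le> \<delta>"
    "(\<Sum>i. ennreal (diam_wrt d (U i) powr s)) < ennreal \<epsilon>"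
proof -
  have "hausdorff_premeasure d s \<delta> S \<le> hausdorff_measure d s S"
    unfolding hausdorff_measure_def using assms(2) by (intro SUP_upper) simp
  also have "\<dots> < ennreal \<epsilon>" using assms by simp
  finally show thesis
    unfolding hausdorff_premeasure_def INF_less_iff using that by blast
qed

lemma hausdorff_dim_eqI:
  assumes "\<And>s. m < s \<Longrightarrow> hausdorff_measure d s S = 0" "0 \<le> m"
    and "\<And>s. 0 < s \<Longrightarrow> s < m \<Longrightarrow> hausdorff_measure d s S \<noteq> 0"
  shows "hausdorff_dim d S = ereal m"
  unfolding hausdorff_dim_def
proof (rule antisym)
  let ?A = "{ereal s | s. s > 0 \<and> hausdorff_measure d s S = 0}"
  show "Inf ?A \<le> ereal m"
  proof (rule ereal_le_epsilon2)
    fix e :: real assume "0 < e"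
    then have "ereal (m + e) \<in> ?A" using assms(1)[of "m + e"] assms(2) by auto
    then have "Inf ?A \<le> ereal (m + e)" by (rule Inf_lower)
    then show "Inf ?A \<le> ereal m + ereal e" by simp
  qed
  show "ereal m \<le> Inf ?A"
  proof (rule Inf_greatest)
    fix z assume "z \<in> ?A"
    then obtain s where "z = ereal s" "0 < s" "hausdorff_measure d s S = 0" by blast
    then show "ereal m \<le> z" using assms(3)[of s] by (cases "s < m") auto
  qed
qed

text \<open>The sets \<open>J i\<close> need not be measurable; each is enlarged to the closed
  interval of length \<open>r i\<close> starting at its infimum, and countable subadditivity
  applies.\<close>

lemma interval_cover_le_suminf:
  fixes a b :: real and r :: "nat \<Rightarrow> real"
  assumes "{a..b} \<subseteq> (\<Union>i. J i)" "a \<le> b"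
    and "\<And>i t t'. t \<in> J i \<Longrightarrow> t' \<in> J i \<Longrightarrow> \<bar>t - t'\<bar> \<le> r i" "\<And>i. 0 \<le> r i"
  shows "ennreal (b - a) \<le> (\<Sum>i. ennreal (r i))"
proof -
  have bdd: "bdd_below (J i)" for i
  proof (cases "J i = {}")
    case False
    then obtain t where "t \<in> J i" by blast
    then show ?thesis
      using assms(3)[of _ i t] by (intro bdd_belowI[of _ "t - r i"]) (force simp: abs_le_iff)
  qed simp
  define I where "I i = {Inf (J i)..Inf (J i) + r i}" for i
  have JI: "J i \<subseteq> I i" for i
  proof
    fix t assume t: "t \<in> J i"
    have "t - r i \<le> Inf (J i)"
    proof (rule cInf_greatest)
      fix t' assume "t' \<in> J i"
      then show "t - r i \<le> t'" using assms(3)[OF t, of t'] by linarith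
    qed (use t in blast)
    then show "t \<in> I i" using cInf_lower[OF t bdd] by (simp add: I_def)
  qed
  have "ennreal (b - a) = emeasure lborel {a..b}" using assms(2) by simp
  also have "\<dots> \<le> emeasure lborel (\<Union>i. I i)"
  proof (rule emeasure_mono)
    show "{a..b} \<subseteq> (\<Union>i. I i)" using assms(1) JI by blast
  qed (simp add: I_def)
  also have "\<dots> \<le> (\<Sum>i. emeasure lborel (I i))"
    by (rule emeasure_subadditive_countably) (auto simp: I_def)
  also have "\<dots> = (\<Sum>i. ennreal (r i))"
    using assms(4) by (simp add: I_def)
  finally show ?thesis .
qed

section \<open>A Kraft inequality for families of words\<close>

context self_similar_set
begin

text \<open>Each word of length \<open>n i\<close> has weight \<open>1 / N ^ n i\<close>, the
  uniform measure of its cylinder. What counts for \<open>w\<close> are its extensions,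
  \<open>w\<close> itself included.\<close>

definition cylinder_mass :: "(nat \<Rightarrow> nat) \<Rightarrow> (nat \<Rightarrow> nat list set) \<Rightarrow> nat list \<Rightarrow> ennreal" where
  "cylinder_mass n B w = (\<Sum>i. ennreal (card {v \<in> B i. \<exists>z. v = w @ z} / real N ^ n i))"

text \<open>The complement of a union of cylinders of total mass less than one is nonempty: descend along
  words \<open>w\<close> whose cylinder is not exhausted by the subcylinders taken away.\<close>

lemma kraft_avoiding_code:
  assumes B: "\<And>i. B i \<subseteq> words (n i)"
    and mass: "(\<Sum>i. ennreal (card (B i) / real N ^ n i)) < 1"
  shows "\<exists>\<omega>. range \<omega> \<subseteq> {1..N} \<and> (\<forall>i. map \<omega> [0..<n i] \<notin> B i)"
proof -
  let ?m = "cylinder_mass n B"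
  \<comment> \<open>The removed mass inside the cylinder of \<open>w\<close> is less than the mass
    of the cylinder: something is left over there.\<close>
  define bad where "bad w \<longleftrightarrow> ?m w < ennreal (1 / real N ^ length w)" for w
  have N0: "0 < real N" using N_ge_2 by simp
  have fin: "finite (B i)" for i by (rule finite_subset[OF B]) simp
  have child: "\<exists>j\<in>{1..N}. bad (w @ [j])" if "bad w" for w
  \<comment> \<open>If all N children were exhausted, so would be the parent: the masses of the
    children add up to that of \<open>w\<close>, and extensions of different children are disjoint
    families of extensions of \<open>w\<close>.\<close>
  proof (rule ccontr)
    assume "\<not> (\<exists>j\<in>{1..N}. bad (w @ [j]))"
    then have ge: "ennreal (1 / real N ^ Suc (length w)) \<le> ?m (w @ [j])" if "j \<in> {1..N}" for j
      using that by (auto simp: bad_def not_less)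
    have "ennreal (1 / real N ^ length w) = ennreal (\<Sum>j\<in>{1..N}. 1 / real N ^ Suc (length w))"
      using N0 by simp
    also have "\<dots> = (\<Sum>j\<in>{1..N}. ennreal (1 / real N ^ Suc (length w)))"
      by (rule sum_ennreal[symmetric]) simp
    also have "\<dots> \<le> (\<Sum>j\<in>{1..N}. ?m (w @ [j]))"
      by (rule sum_mono) (rule ge)
    also have "\<dots> = (\<Sum>i. \<Sum>j\<in>{1..N}. ennreal (card {v \<in> B i. \<exists>z. v = (w @ [j]) @ z} / real N ^ n i))"
      unfolding cylinder_mass_def by (rule suminf_sum[symmetric]) simp
    also have "\<dots> \<le> ?m w"
      unfolding cylinder_mass_def
    proof (rule suminf_le)
      fix i
      have "(\<Sum>j\<in>{1..N}. card {v \<in> B i. \<exists>z. v = (w @ [j]) @ z}) = card (\<Union>j\<in>{1..N}. {v \<in> B i. \<exists>z. v = (w @ [j]) @ z})"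
        by (rule card_UN_disjoint[symmetric]) (auto intro: finite_subset[OF _ fin[of i]])
      also have "\<dots> \<le> card {v \<in> B i. \<exists>z. v = w @ z}"
        by (rule card_mono) (auto intro: finite_subset[OF _ fin[of i]])
      finally have "real (\<Sum>j\<in>{1..N}. card {v \<in> B i. \<exists>z. v = (w @ [j]) @ z}) \<le> real (card {v \<in> B i. \<exists>z. v = w @ z})"
        by (rule of_nat_mono)
      then have "(\<Sum>j\<in>{1..N}. card {v \<in> B i. \<exists>z. v = (w @ [j]) @ z} / real N ^ n i) \<le> card {v \<in> B i. \<exists>z. v = w @ z} / real N ^ n i"
        unfolding sum_divide_distrib[symmetric] of_nat_sum[symmetric] using N0 by (intro divide_right_mono) auto
      then show "(\<Sum>j\<in>{1..N}. ennreal (card {v \<in> B i. \<exists>z. v = (w @ [j]) @ z} / real N ^ n i)) \<le>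
          ennreal (card {v \<in> B i. \<exists>z. v = w @ z} / real N ^ n i)"
        by (subst sum_ennreal) (auto intro: ennreal_leI)
    qed simp_all
    finally show False using that by (simp add: bad_def)
  qed
  have "\<forall>w. \<exists>j. bad w \<longrightarrow> j \<in> {1..N} \<and> bad (w @ [j])" using child by blast
  from choice[OF this] obtain next_letter where nl: "\<And>w. bad w \<Longrightarrow> next_letter w \<in> {1..N} \<and> bad (w @ [next_letter w])"
    by blast
  define p where "p = rec_nat [] (\<lambda>_ w. w @ [next_letter w])"
  have p0: "p 0 = []" and pS: "p (Suc k) = p k @ [next_letter (p k)]" for k
    by (simp_all add: p_def)
  have "bad []" unfolding bad_def using mass by (simp add: cylinder_mass_def)
  then have badp: "bad (p k)" for k
    by (induction k) (auto simp: p0 pS nl)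
  define \<omega> where "\<omega> k = next_letter (p k)" for k
  have map: "map \<omega> [0..<k] = p k" for k
    by (induction k) (auto simp: p0 pS \<omega>_def)
  have "map \<omega> [0..<n i] \<notin> B i" for i
  proof
    assume "map \<omega> [0..<n i] \<in> B i"
    \<comment> \<open>A word of \<open>B i\<close> on the path extends itself, with
      \<open>z = []\<close>, and alone exhausts its own cylinder.\<close>
    then have "p (n i) \<in> {v \<in> B i. \<exists>z. v = p (n i) @ z}" by (simp add: map)
    then have "1 \<le> card {v \<in> B i. \<exists>z. v = p (n i) @ z}"
      using finite_subset[OF _ fin[of i], of "{v \<in> B i. \<exists>z. v = p (n i) @ z}"]
      by (auto simp: Suc_le_eq card_gt_0_iff)
    then have "ennreal (1 / real N ^ n i) \<le> ennreal (card {v \<in> B i. \<exists>z. v = p (n i) @ z} / real N ^ n i)"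
      using N0 by (intro ennreal_leI divide_right_mono) auto
    also have "\<dots> = (\<Sum>i\<in>{i}. ennreal (card {v \<in> B i. \<exists>z. v = p (n i) @ z} / real N ^ n i))" by simp
    also have "\<dots> \<le> ?m (p (n i))"
    proof -
      let ?f = "\<lambda>j. ennreal (card {v \<in> B j. \<exists>z. v = p (n i) @ z} / real N ^ n j)"
      have "sum ?f {i} \<le> suminf ?f" by (rule sum_le_suminf) auto
      then show ?thesis by (simp add: cylinder_mass_def)
    qed
    finally have "\<not> bad (p (n i))"
      using map[of "n i"] length_map[of \<omega> "[0..<n i]"] by (simp add: bad_def not_less)
    then show False using badp by blast
  qed
  moreover have "range \<omega> \<subseteq> {1..N}" using nl badp by (auto simp: \<omega>_def)
  ultimately show ?thesis by blast
qed

end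

section \<open>The Hausdorff dimension\<close>

context stretched_fractal
begin

lemma word_map_G_continuous: "w \<in> all_words \<Longrightarrow> continuous_on A (word_map G w)"
proof (induction w)
  case (Cons i w)
  then have i: "i \<in> {1..N}" "w \<in> all_words" by (auto simp: mem_all_words)
  have "continuous_on A (G i \<circ> word_map G w)"
    by (intro continuous_on_compose Cons.IH[OF i(2)] G_continuous[OF i(1)])
  moreover have "G i \<circ> word_map G w = word_map G (i # w)" by (auto simp: fun_eq_iff)
  ultimately show ?case by simp
qed (simp add: id_def)

lemma code_point_exists:
  assumes "range \<omega> \<subseteq> {1..N}"
  shows "\<exists>x. \<forall>n. x \<in> word_map G (map \<omega> [0..<n]) ` K"
proof -
  define C where "C n = word_map G (map \<omega> [0..<n]) ` K" for n
  have w: "map \<omega> [0..<n] \<in> all_words" for n using assms by (auto simp: mem_all_words)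
  have "C (Suc n) \<subseteq> C n" for n
  proof
    fix x assume "x \<in> C (Suc n)"
    then obtain y where y: "y \<in> K" "x = word_map G (map \<omega> [0..<n]) (G (\<omega> n) y)"
      by (auto simp: C_def word_map_append)
    have "\<omega> n \<in> {1..N}" using assms by blast
    then show "x \<in> C n" using y G_in_K by (auto simp: C_def)
  qed
  then have "C n \<subseteq> C m" if "m \<le> n" for m n
    using that by (rule lift_Suc_antimono_le)
  moreover have "compact (C n)" "C n \<noteq> {}" for n
    unfolding C_def using K_nonempty
    by (auto intro!: compact_continuous_image word_map_G_continuous w K_compact)
  ultimately have "\<Inter> (range C) \<noteq> {}" by (intro compact_nest)
  then show ?thesis by (auto simp: C_def)
qed

text \<open>Supplies the covering for the upper bound: the cells of level \<open>n\<close> together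
  with the finitely many segments of lower levels.\<close>

lemma K_decomposition:
  assumes "x \<in> K"
  shows "(\<exists>w\<in>words n. x \<in> word_map G w ` K) \<or>
    (\<exists>w\<in>(\<Union>k<n. words k). \<exists>e\<in>edges1. \<exists>t\<in>{0..1}. x = word_map G w (param (fst e) (snd e) t))"
  using assms
proof (induction n arbitrary: x)
  case (Suc n)
  show ?case
    using Suc.prems
  proof (cases rule: K_cases)
    case (segment c l)
    then obtain t where t: "t \<in> {0..1}" "x = param c l t" by (auto simp: seg_eq)
    have "[] \<in> (\<Union>k<Suc n. words k)" by (intro UN_I[of 0]) auto
    moreover have "x = word_map G [] (param (fst (c, l)) (snd (c, l)) t)" using t by simp
    ultimately show ?thesis using segment(1) t(1) by blast
  next
    case (cell i y)
    from Suc.IH[OF cell(2)] show ?thesis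
    proof
      assume "\<exists>w\<in>words n. y \<in> word_map G w ` K"
      then obtain w z where w: "w \<in> words n" "z \<in> K" "y = word_map G w z" by blast
      have "i # w \<in> words (Suc n)" using w(1) cell(1) by (auto simp: words_Suc)
      moreover have "x = word_map G (i # w) z" using w(3) cell(3) by simp
      ultimately show ?thesis using w(2) by blast
    next
      assume "\<exists>w\<in>(\<Union>k<n. words k). \<exists>e\<in>edges1. \<exists>t\<in>{0..1}. y = word_map G w (param (fst e) (snd e) t)"
      then obtain k w e t where w: "k < n" "w \<in> words k" "e \<in> edges1" "t \<in> {0..1}"
        "y = word_map G w (param (fst e) (snd e) t)" by blast
      have "i # w \<in> words (Suc k)" using w(2) cell(1) by (auto simp: words_Suc)
      then have "i # w \<in> (\<Union>k<Suc n. words k)" using w(1) by (intro UN_I[of "Suc k"]) auto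
      moreover have "x = word_map G (i # w) (param (fst e) (snd e) t)" using w(5) cell(3) by simp
      ultimately show ?thesis using w(3,4) by blast
    qed
  qed
qed auto

end

section \<open>Growth of the products and the upper bound for the dimension\<close>

context regular_sequence
begin

text \<open>Summability makes the product of the quotients \<open>lam (Suc i) / L\<close> converge
  absolutely, and its limit is nonzero because no factor vanishes. The partial products and their
  inverses are then both bounded.\<close>

lemma lam_prod_asymptotics:
  assumes L: "0 < L" and sum: "summable (\<lambda>k. \<bar>L - lam (Suc k)\<bar>)"
  shows "\<exists>c>0. \<forall>n. c * L ^ n \<le> lam_prod 0 n" "\<exists>c>0. \<forall>n. lam_prod 0 n \<le> c * L ^ n"
proof -
  define a where "a i = lam (Suc i) / L" for i
  define x where "x n = (\<Prod>i<n. a i)" for n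
  have a: "0 < a i" for i using lam_pos[of i] L by (simp add: a_def)
  have norm_eq: "norm (a i - 1) = \<bar>L - lam (Suc i)\<bar> * (1 / L)" for i
  proof -
    have "a i - 1 = - ((L - lam (Suc i)) * (1 / L))" using L by (simp add: a_def field_simps)
    then show ?thesis using L by (simp add: abs_mult)
  qed
  have "summable (\<lambda>i. norm (a i - 1))"
    unfolding norm_eq by (rule summable_mult2[OF sum])
  then have conv: "convergent_prod a"
    by (intro abs_convergent_prod_imp_convergent_prod summable_imp_abs_convergent_prod)
  have "(\<lambda>n. \<Prod>i\<le>n. a i) \<longlonglongrightarrow> prodinf a" by (rule convergent_prod_LIMSEQ[OF conv])
  then have "(\<lambda>n. x (Suc n)) \<longlonglongrightarrow> prodinf a" by (simp only: x_def lessThan_Suc_atMost)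
  then have lim: "x \<longlonglongrightarrow> prodinf a" by (rule LIMSEQ_imp_Suc)
  have nz: "prodinf a \<noteq> 0"
    using a by (intro prodinf_nonzero[OF conv]) (auto simp: less_le)
  have x: "0 < x n" for n unfolding x_def using a by (intro prod_pos) auto
  have prod: "lam_prod 0 n = x n * L ^ n" for n
    using L by (simp add: lam_prod_def x_def a_def prod_dividef)
  obtain c where c: "0 < c" "\<And>n. norm (x n) \<le> c"
    using convergent_imp_Bseq[OF convergentI[OF lim]] unfolding Bseq_def by blast
  then have "lam_prod 0 n \<le> c * L ^ n" for n
    unfolding prod using L abs_le_D1[OF c(2)[of n, unfolded real_norm_def]] by (intro mult_right_mono) auto
  then show "\<exists>c>0. \<forall>n. lam_prod 0 n \<le> c * L ^ n" using c(1) by blast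
  obtain c where c: "0 < c" "\<And>n. norm (inverse (x n)) \<le> c"
    using convergent_imp_Bseq[OF convergentI[OF tendsto_inverse[OF lim nz]]] unfolding Bseq_def by blast
  have "1 / c * L ^ n \<le> lam_prod 0 n" for n
  proof -
    have "inverse (x n) \<le> c" using c(2)[of n] x[of n] by simp
    then have "1 / c \<le> x n" using x[of n] c(1) by (simp add: field_simps)
    then show ?thesis unfolding prod using L by (intro mult_right_mono) auto
  qed
  then show "\<exists>c>0. \<forall>n. c * L ^ n \<le> lam_prod 0 n" using c(1) by (intro exI[of _ "1 / c"]) auto
qed

text \<open>Two parameters are fixed in this order: \<open>n\<close>, so that the cells contribute
  little because \<open>N * L powr s < 1\<close>; then \<open>m\<close>, the number of pieces per
  segment of lower level. The number of such segments depends on \<open>n\<close>, but their total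
  contribution decays like \<open>m powr (1 - s)\<close>, as \<open>s > 1\<close>.\<close>

lemma hausdorff_measure_eq_0:
  assumes L: "0 < L" "L < 1" and sum: "summable (\<lambda>k. \<bar>L - lam (Suc k)\<bar>)"
    and s: "1 < s" "real N * L powr s < 1"
  shows "hausdorff_measure R s K = 0"
proof (rule hausdorff_measure_zeroI)
  fix \<delta> \<epsilon> :: real assume \<delta>: "0 < \<delta>" and \<epsilon>: "0 < \<epsilon>"
  obtain C where C: "0 < C" "\<And>w x y. w \<in> all_words \<Longrightarrow> x \<in> K \<Longrightarrow> y \<in> K \<Longrightarrow>
      R (word_map G w x) (word_map G w y) \<le> C * lam_prod 0 (length w)"
    using resistance_cell_le by blast
  obtain c where c: "0 < c" "\<And>n. lam_prod 0 n \<le> c * L ^ n"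
    using lam_prod_asymptotics(2)[OF L(1) sum] by blast
  define b where "b n = C * c * L ^ n" for n
  have b0: "0 < b n" for n using C(1) c(1) L by (simp add: b_def)
  have b_lim: "b \<longlonglongrightarrow> C * c * 0"
    unfolding b_def[abs_def] using L by (intro tendsto_intros LIMSEQ_realpow_zero) auto
  have "N ^ n * b n powr s = (C * c) powr s * (real N * L powr s) ^ n" for n
  proof -
    have "(L ^ n) powr s = (L powr s) ^ n"
      using L by (simp add: powr_realpow[symmetric] powr_powr mult.commute)
    then show ?thesis
      using C(1) c(1) L by (simp add: b_def powr_mult power_mult_distrib)
  qed
  moreover have "(\<lambda>n. (C * c) powr s * (real N * L powr s) ^ n) \<longlonglongrightarrow> (C * c) powr s * 0"
    using s by (intro tendsto_intros LIMSEQ_realpow_zero) auto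
  ultimately have "(\<lambda>n. N ^ n * b n powr s) \<longlonglongrightarrow> 0" by simp
  then have "\<forall>\<^sub>F n in sequentially. N ^ n * b n powr s < \<epsilon> / 2"
    using \<epsilon> by (intro order_tendstoD(2)) auto
  moreover have "\<forall>\<^sub>F n in sequentially. b n < \<delta>"
    using b_lim \<delta> by (intro order_tendstoD(2)) auto
  ultimately have "\<forall>\<^sub>F n in sequentially. N ^ n * b n powr s < \<epsilon> / 2 \<and> b n < \<delta>"
    by (rule eventually_conj)
  then obtain n where n: "N ^ n * b n powr s < \<epsilon> / 2" "b n < \<delta>"
    using eventually_happens'[OF sequentially_bot] by blast
  define W where "W = (\<Union>k<n. words k)"
  have W: "finite W" "W \<subseteq> all_words" using words_subset by (auto simp: W_def)
  define S where "S = real (card W * card edges1)"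
  have "(\<lambda>m. S * rho_max powr s * real m powr (1 - s)) \<longlonglongrightarrow> S * rho_max powr s * 0"
    using s by (intro tendsto_intros tendsto_neg_powr filterlim_real_sequentially) auto
  then have "\<forall>\<^sub>F m in sequentially. S * rho_max powr s * real m powr (1 - s) < \<epsilon> / 2"
    using \<epsilon> by (intro order_tendstoD(2)) auto
  moreover have "\<forall>\<^sub>F m in sequentially. rho_max / real m < \<delta>"
    using lim_const_over_n[of rho_max] \<delta> by (intro order_tendstoD(2)) auto
  moreover have "\<forall>\<^sub>F m in sequentially. (0::nat) < m"
    by (rule eventually_gt_at_top)
  ultimately have "\<forall>\<^sub>F m in sequentially. S * rho_max powr s * real m powr (1 - s) < \<epsilon> / 2 \<and> rho_max / real m < \<delta> \<and> 0 < m"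
    by eventually_elim auto
  then obtain m where m: "S * rho_max powr s * real m powr (1 - s) < \<epsilon> / 2" "rho_max / real m < \<delta>" "0 < m"
    using eventually_happens'[OF sequentially_bot] by blast
  \<comment> \<open>The left summand indexes cells; the right one consists of a word, a segment and
    the number of one of its \<open>m\<close> pieces.\<close>
  define I where "I = words n <+> (W \<times> edges1 \<times> {..<m})"
  define A where "A = case_sum (\<lambda>w. word_map G w ` K)
    (\<lambda>(w, e, j). (\<lambda>t. word_map G w (param (fst e) (snd e) t)) ` {real j / real m..real (Suc j) / real m})"
  define B where "B = case_sum (\<lambda>w :: nat list. b n) (\<lambda>z :: nat list \<times> ('a \<times> nat) \<times> nat. rho_max / real m)"
  have piece: "{real j / real m..real (Suc j) / real m} \<subseteq> {0..1}" if "j < m" for j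
  proof -
    have "real (Suc j) / real m \<le> 1" using that m(3) by simp
    moreover have "0 \<le> real j / real m" by simp
    ultimately show ?thesis by auto
  qed
  have "hausdorff_premeasure R s \<delta> K \<le> ennreal (\<Sum>i\<in>I. B i powr s)"
  proof (rule hausdorff_premeasure_le_finite)
    show "finite I" unfolding I_def using W by simp
    show "A i \<subseteq> K" if i: "i \<in> I" for i
    proof (cases i)
      case (Inl w)
      then show ?thesis
        using i words_subset word_map_G_in_K by (auto simp: A_def I_def)
    next
      case (Inr z)
      then obtain w e j where z: "i = Inr (w, e, j)" "w \<in> W" "e \<in> edges1" "j < m"
        using i by (auto simp: I_def)
      have "word_map G w (param (fst e) (snd e) t) \<in> K" if "t \<in> {real j / real m..real (Suc j) / real m}" for t
        using z W(2) subsetD[OF piece[OF z(4)] that] by (intro word_map_G_in_K param_in_K) auto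
      then show ?thesis by (auto simp: A_def z(1))
    qed
    show "K \<subseteq> (\<Union>i\<in>I. A i)"
    proof
      fix x assume "x \<in> K"
      from K_decomposition[OF this, of n] show "x \<in> (\<Union>i\<in>I. A i)"
      proof
        assume "\<exists>w\<in>words n. x \<in> word_map G w ` K"
        then obtain w where "w \<in> words n" "x \<in> word_map G w ` K" by blast
        then show ?thesis by (intro UN_I[of "Inl w"]) (auto simp: I_def A_def)
      next
        assume "\<exists>w\<in>(\<Union>k<n. words k). \<exists>e\<in>edges1. \<exists>t\<in>{0..1}. x = word_map G w (param (fst e) (snd e) t)"
        then obtain w e t where w: "w \<in> W" "e \<in> edges1" "t \<in> {0..1}" "x = word_map G w (param (fst e) (snd e) t)"
          unfolding W_def by blast
        obtain j where j: "j < m" "t \<in> {real j / real m..real (Suc j) / real m}"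
        proof (cases "t = 1")
          case True
          then show thesis using m(3) by (intro that[of "m - 1"]) auto
        next
          case False
          define j where "j = nat \<lfloor>t * real m\<rfloor>"
          have j: "real j \<le> t * real m" "t * real m < real j + 1"
            using w(3) unfolding j_def by (auto simp: of_nat_nat)
          have "t * real m < 1 * real m" using False w(3) m(3) by (intro mult_strict_right_mono) auto
          then have "j < m" using j(1) by simp
          moreover have "real j / real m \<le> t" "t \<le> real (Suc j) / real m"
            using j m(3) by (auto simp: field_simps)
          ultimately show thesis by (intro that[of j]) auto
        qed
        show ?thesis
          using w j by (intro UN_I[of "Inr (w, e, j)"]) (auto simp: I_def A_def)
      qed
    qed
    show "R x y \<le> B i" if i: "i \<in> I" and xy: "x \<in> A i" "y \<in> A i" for i x y
    proof (cases i)
      case (Inl w)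
      then have w: "w \<in> words n" using i by (auto simp: I_def)
      obtain x' y' where "x' \<in> K" "y' \<in> K" "x = word_map G w x'" "y = word_map G w y'"
        using xy by (auto simp: A_def Inl)
      then have "R x y \<le> C * lam_prod 0 n"
        using C(2)[of w x' y'] w words_subset by (auto simp: words_def)
      also have "\<dots> \<le> b n" unfolding b_def using c(2)[of n] C(1) by (simp add: mult.assoc)
      finally show ?thesis by (simp add: B_def Inl)
    next
      case (Inr z)
      then obtain w e j where z: "i = Inr (w, e, j)" "w \<in> W" "e \<in> edges1" "j < m"
        using i by (auto simp: I_def)
      obtain t t' where t: "t \<in> {real j / real m..real (Suc j) / real m}" "t' \<in> {real j / real m..real (Suc j) / real m}"
        "x = word_map G w (param (fst e) (snd e) t)" "y = word_map G w (param (fst e) (snd e) t')"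
        using xy by (auto simp: A_def z(1))
      have "R x y \<le> rho_max * \<bar>t - t'\<bar>"
        unfolding t(3,4) using z W(2) subsetD[OF piece[OF z(4)] t(1)] subsetD[OF piece[OF z(4)] t(2)]
        by (intro resistance_segment_le) auto
      also have "\<dots> \<le> rho_max * (1 / real m)"
      proof (rule mult_left_mono)
        have "real (Suc j) / real m = real j / real m + 1 / real m" by (simp add: add_divide_distrib)
        then show "\<bar>t - t'\<bar> \<le> 1 / real m" using t(1,2) by (auto simp: abs_le_iff)
      qed (use rho_max_pos in simp)
      finally show ?thesis by (simp add: B_def z(1))
    qed
    show "0 \<le> B i \<and> B i \<le> \<delta>" if "i \<in> I" for i
      using n(2) m(2) b0[of n] rho_max_pos by (cases i) (auto simp: B_def less_imp_le)
    show "0 \<le> R x y" if "x \<in> K" "y \<in> K" for x y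
      by (rule resistance_nonneg[OF that])
  qed (use s in simp)
  also have "(\<Sum>i\<in>I. B i powr s) = N ^ n * b n powr s + S * rho_max powr s * real m powr (1 - s)"
  proof -
    have "real m * (rho_max / real m) powr s = rho_max powr s * real m powr (1 - s)"
      using m(3) rho_max_pos by (simp add: powr_divide powr_diff)
    then have "real (card W * (card edges1 * m)) * (rho_max / real m) powr s = S * (rho_max powr s * real m powr (1 - s))"
      by (simp add: S_def)
    then show ?thesis
      unfolding I_def using W(1)
      by (subst sum.Plus) (simp_all add: B_def card_words card_cartesian_product mult.assoc)
  qed
  also have "ennreal \<dots> \<le> ennreal \<epsilon>"
    using n(1) m(1) by (intro ennreal_leI) linarith
  finally show "hausdorff_premeasure R s \<delta> K \<le> ennreal \<epsilon>" .
qed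

section \<open>Lower bounds for the dimension\<close>

lemma resistance_bounded: "\<exists>C>0. \<forall>x\<in>K. \<forall>y\<in>K. R x y \<le> C"
proof -
  obtain C where C: "0 < C" "\<And>w x y. w \<in> all_words \<Longrightarrow> x \<in> K \<Longrightarrow> y \<in> K \<Longrightarrow>
      R (word_map G w x) (word_map G w y) \<le> C * lam_prod 0 (length w)"
    using resistance_cell_le by blast
  have "R x y \<le> C" if "x \<in> K" "y \<in> K" for x y
    using C(2)[of "[]", OF _ that] by (simp add: mem_all_words)
  then show ?thesis using C(1) by blast
qed

lemma diam_R:
  assumes "U \<subseteq> K"
  shows "x \<in> U \<Longrightarrow> y \<in> U \<Longrightarrow> R x y \<le> diam_wrt R U" "0 \<le> diam_wrt R U"
proof -
  obtain C where C: "\<And>x y. x \<in> K \<Longrightarrow> y \<in> K \<Longrightarrow> R x y \<le> C" using resistance_bounded by blast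
  show "R x y \<le> diam_wrt R U" if "x \<in> U" "y \<in> U"
    using that C assms by (intro diam_wrt_ge) auto
  show "0 \<le> diam_wrt R U"
    using C assms resistance_nonneg by (intro diam_wrt_nonneg) blast+
qed

text \<open>A first-level segment contains a curve on which resistance dominates a multiple of the
  parameter distance. A covering of small s-sum would cover the interval up to 3/4 by sets of
  smaller total length.\<close>

lemma hausdorff_measure_neq_0_segment:
  assumes s: "0 < s" "s < 1"
  shows "hausdorff_measure R s K \<noteq> 0"
proof
  assume 0: "hausdorff_measure R s K = 0"
  obtain c l where e: "(c, l) \<in> edges1" using edges1_nonempty by (metis ex_in_conv surj_pair)
  define \<kappa> where "\<kappa> = rho (Suc 0) (c, l) / 5"
  have \<kappa>: "0 < \<kappa>" using rho_pos[of 0] e by (auto simp: \<kappa>_def)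
  \<comment> \<open>Chosen so that the rescaled lengths sum to at most 1/2, short of 3/4.\<close>
  define \<epsilon> where "\<epsilon> = \<kappa> powr s / 2"
  have \<epsilon>: "0 < \<epsilon>" using \<kappa> by (simp add: \<epsilon>_def)
  obtain U where U: "K \<subseteq> (\<Union>i. U i)" "\<And>i. U i \<subseteq> K"
    "\<And>i x y. x \<in> U i \<Longrightarrow> y \<in> U i \<Longrightarrow> R x y \<le> \<kappa>"
    "(\<Sum>i. ennreal (diam_wrt R (U i) powr s)) < ennreal \<epsilon>"
    by (rule hausdorff_measure_zero_cover[OF 0 \<kappa> \<epsilon>]) blast
  define r where "r i = diam_wrt R (U i)" for i
  have r: "0 \<le> r i" "r i \<le> \<kappa>" for i
    unfolding r_def using diam_R(2)[OF U(2)] diam_wrt_le[of \<kappa> "U i" R] \<kappa> U(3) by auto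
  define J where "J i = {t \<in> {0..3/4}. param c l t \<in> U i}" for i
  have "ennreal (3/4 - 0) \<le> (\<Sum>i. ennreal (r i / \<kappa>))"
  proof (rule interval_cover_le_suminf)
    show "{0..3/4} \<subseteq> (\<Union>i. J i)"
    proof
      fix t :: real assume t: "t \<in> {0..3/4}"
      then have "param c l t \<in> K" by (intro param_in_K[OF e]) auto
      then obtain i where "param c l t \<in> U i" using U(1) by blast
      then show "t \<in> (\<Union>i. J i)" using t by (auto simp: J_def)
    qed
    show "\<bar>t - t'\<bar> \<le> r i / \<kappa>" if "t \<in> J i" "t' \<in> J i" for i t t'
    proof -
      have "\<kappa> * \<bar>t - t'\<bar> \<le> R (param c l t) (param c l t')"
        unfolding \<kappa>_def using that by (intro resistance_segment_ge[OF e]) (auto simp: J_def)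
      also have "\<dots> \<le> r i"
        unfolding r_def using that by (intro diam_R(1)[OF U(2)]) (auto simp: J_def)
      finally show ?thesis using \<kappa> by (simp add: field_simps)
    qed
    show "0 \<le> r i / \<kappa>" for i using r \<kappa> by simp
  qed simp
  also have "\<dots> \<le> (\<Sum>i. ennreal (1 / \<kappa> powr s) * ennreal (r i powr s))"
  proof (rule suminf_le)
    fix i
    have "0 \<le> r i / \<kappa>" "r i / \<kappa> \<le> 1" using r[of i] \<kappa> by auto
    \<comment> \<open>The covering scale \<kappa> makes the ratio at most one, so lowering the
      exponent from 1 to \<open>s\<close> increases the power.\<close>
    then have "(r i / \<kappa>) powr 1 \<le> (r i / \<kappa>) powr s" "(r i / \<kappa>) powr 1 = r i / \<kappa>"
      using s by (intro powr_mono' powr_one; simp)+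
    then have "r i / \<kappa> \<le> (r i / \<kappa>) powr s" by linarith
    also have "\<dots> = 1 / \<kappa> powr s * r i powr s"
      using r[of i] \<kappa> by (simp add: powr_divide)
    finally show "ennreal (r i / \<kappa>) \<le> ennreal (1 / \<kappa> powr s) * ennreal (r i powr s)"
      by (subst ennreal_mult[symmetric]) (auto intro: ennreal_leI)
  qed simp_all
  also have "\<dots> = ennreal (1 / \<kappa> powr s) * (\<Sum>i. ennreal (r i powr s))"
    by (rule ennreal_suminf_cmult)
  also have "\<dots> \<le> ennreal (1 / \<kappa> powr s) * ennreal \<epsilon>"
    using U(4) unfolding r_def by (intro mult_left_mono) auto
  also have "\<dots> = ennreal (1 / 2)"
    using \<kappa> \<epsilon> by (subst ennreal_mult[symmetric]) (auto simp: \<epsilon>_def)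
  finally have "(3/4 - 0 :: real) \<le> 1 / 2"
    by (subst (asm) ennreal_le_iff) auto
  then show False by simp
qed

text \<open>Each covering set is assigned a level at which separated cells are farther apart than
  its diameter, so it meets boundedly many cells of that level. Their uniform mass is comparable to
  the s-th power of the diameter. If the total stays below one, some code avoids all these cells,
  and its point is not covered.\<close>

lemma hausdorff_measure_neq_0_cells:
  assumes L: "0 < L" "L < 1" and sum: "summable (\<lambda>k. \<bar>L - lam (Suc k)\<bar>)"
    and s: "0 < s" "1 < real N * L powr s"
  shows "hausdorff_measure R s K \<noteq> 0"
proof
  assume 0: "hausdorff_measure R s K = 0"
  obtain a where a: "0 < a" "\<And>n w v x y. w \<in> words n \<Longrightarrow> v \<in> words n \<Longrightarrow>
     v \<notin> touched n (word_map F w ` postcritical) \<Longrightarrow> x \<in> K \<Longrightarrow> y \<in> K \<Longrightarrow>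
     a * lam_prod 0 n \<le> R (word_map G w x) (word_map G v y)"
    using resistance_separated_cells by blast
  obtain c' where c': "0 < c'" "\<And>n. c' * L ^ n \<le> lam_prod 0 n"
    using lam_prod_asymptotics(1)[OF L(1) sum] by blast
  define c where "c = a * c'"
  have c: "0 < c" using a c' by (simp add: c_def)
  have sep: "c * L ^ n \<le> R (word_map G w x) (word_map G v y)"
    if "w \<in> words n" "v \<in> words n" "v \<notin> touched n (word_map F w ` postcritical)" "x \<in> K" "y \<in> K" for n w v x y
  proof -
    have "c * L ^ n \<le> a * lam_prod 0 n"
      using c'(2)[of n] a(1) by (simp add: c_def mult.assoc)
    then show ?thesis using a(2)[OF that] by linarith
  qed
  define M where "M = real (card postcritical * max 1 (card critical_codes))"
  have N1: "1 < real N" using N_ge_2 by simp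
  have M: "0 < M" using finite_postcritical postcritical_nonempty by (simp add: M_def card_gt_0_iff)
  \<comment> \<open>The factor \<open>N\<close> compensates for the level being one less than the
    first level at which \<open>c * L ^ n\<close> reaches the diameter.\<close>
  define A where "A = M * real N * (1 / c) powr s"
  have A: "0 < A" using M N1 c by (simp add: A_def)
  \<comment> \<open>The diameters contribute at most 1/4 to the mass and the correction terms below
    1/2, which leaves the total at 3/4.\<close>
  define \<epsilon> where "\<epsilon> = 1 / (4 * A)"
  have \<epsilon>: "0 < \<epsilon>" using A by (simp add: \<epsilon>_def)
  \<comment> \<open>A covering scale below \<open>c\<close> ensures \<open>r i < c * L ^ 0\<close>,
    so the search for the level does not stop at zero.\<close>
  have c2: "0 < c / 2" using c by simp
  obtain U where U: "K \<subseteq> (\<Union>i. U i)" "\<And>i. U i \<subseteq> K"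
    "\<And>i x y. x \<in> U i \<Longrightarrow> y \<in> U i \<Longrightarrow> R x y \<le> c / 2"
    "(\<Sum>i. ennreal (diam_wrt R (U i) powr s)) < ennreal \<epsilon>"
    by (rule hausdorff_measure_zero_cover[OF 0 c2 \<epsilon>]) blast
  define r where "r i = diam_wrt R (U i)" for i
  have r: "0 \<le> r i" "r i < c" for i
  proof -
    show "0 \<le> r i" unfolding r_def by (rule diam_R(2)[OF U(2)])
    have "r i \<le> c / 2" unfolding r_def using c2 U(3) by (intro diam_wrt_le) auto
    then show "r i < c" using c by linarith
  qed
  \<comment> \<open>The terms \<open>(1/2) ^ (i + 2)\<close> pay for sets of diameter zero, which
    admit arbitrarily deep levels but have no positive power to charge.\<close>
  have "\<exists>n. r i < c * L ^ n \<and> M / real N ^ n \<le> A * r i powr s + (1/2) ^ (i + 2)" for i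
  proof (cases "r i = 0")
    case True
    have "(\<lambda>n. M * (1 / real N) ^ n) \<longlonglongrightarrow> M * 0"
      using N1 by (intro tendsto_intros LIMSEQ_realpow_zero) auto
    then have "\<forall>\<^sub>F n in sequentially. M * (1 / real N) ^ n < (1/2) ^ (i + 2)"
      by (intro order_tendstoD(2)) auto
    then obtain n where "M * (1 / real N) ^ n < (1/2) ^ (i + 2)"
      using eventually_happens'[OF sequentially_bot] by blast
    then show ?thesis using True c L s by (intro exI[of _ n]) (auto simp: power_one_over field_simps)
  next
    case False
    then have ri: "0 < r i" using r(1)[of i] by simp
    have "(\<lambda>n. c * L ^ n) \<longlonglongrightarrow> c * 0"
      using L by (intro tendsto_intros LIMSEQ_realpow_zero) auto
    then have "\<forall>\<^sub>F n in sequentially. c * L ^ n < r i"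
      using ri by (intro order_tendstoD(2)) auto
    then have ex: "\<exists>n. c * L ^ n \<le> r i"
      using eventually_happens'[OF sequentially_bot] less_imp_le by blast
    \<comment> \<open>The first level at which \<open>c * L ^ n\<close> no longer exceeds the
      diameter; its predecessor still separates cells and is the one used.\<close>
    define n' where "n' = (LEAST n. c * L ^ n \<le> r i)"
    have n': "c * L ^ n' \<le> r i" unfolding n'_def by (rule LeastI_ex[OF ex])
    have "n' \<noteq> 0" using n' r(2)[of i] by (cases n') auto
    then obtain n where n: "n' = Suc n" by (cases n') auto
    have "\<not> c * L ^ n \<le> r i" using not_less_Least[of n "\<lambda>n. c * L ^ n \<le> r i"] n by (simp add: n'_def)
    then have 1: "r i < c * L ^ n" by simp
    have "(1 / real N) ^ Suc n \<le> (L powr s) ^ Suc n"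
    proof (rule power_mono)
      show "1 / real N \<le> L powr s" using s(2) N1 by (simp add: field_simps)
    qed (use N1 in simp)
    also have "\<dots> = (L ^ Suc n) powr s"
      using L by (simp add: powr_powr mult.commute powr_realpow[symmetric] del: power_Suc)
    also have "\<dots> \<le> (1 / c * r i) powr s"
      using n' n c L s by (intro powr_mono2) (auto simp: field_simps)
    also have "\<dots> = (1 / c) powr s * r i powr s"
      by (rule powr_mult)
    finally have "M * real N * (1 / real N) ^ Suc n \<le> M * real N * ((1 / c) powr s * r i powr s)"
      using M N1 by (intro mult_left_mono) auto
    then have "M / real N ^ n \<le> A * r i powr s"
      using N1 by (simp add: A_def power_one_over mult.assoc)
    moreover have "0 \<le> (1/2 :: real) ^ (i + 2)" by simp
    ultimately show ?thesis using 1 by (intro exI[of _ n]) linarith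
  qed
  then have "\<exists>n. \<forall>i. r i < c * L ^ n i \<and> M / real N ^ n i \<le> A * r i powr s + (1/2) ^ (i + 2)"
    by (intro choice allI)
  then obtain n where n: "\<And>i. r i < c * L ^ n i" "\<And>i. M / real N ^ n i \<le> A * r i powr s + (1/2) ^ (i + 2)"
    by blast
  define B where "B i = {w \<in> words (n i). word_map G w ` K \<inter> U i \<noteq> {}}" for i
  have card: "real (card (B i)) \<le> M" for i
  proof (cases "B i = {}")
    case True
    then show ?thesis using M by simp
  next
    case False
    then obtain w x where w: "w \<in> words (n i)" "x \<in> K" "word_map G w x \<in> U i" by (auto simp: B_def)
    have "B i \<subseteq> touched (n i) (word_map F w ` postcritical)"
    proof
      fix v assume "v \<in> B i"
      then obtain y where v: "v \<in> words (n i)" "y \<in> K" "word_map G v y \<in> U i" by (auto simp: B_def)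
      show "v \<in> touched (n i) (word_map F w ` postcritical)"
      proof (rule ccontr)
        assume "v \<notin> touched (n i) (word_map F w ` postcritical)"
        then have "c * L ^ n i \<le> R (word_map G w x) (word_map G v y)"
          by (rule sep[OF w(1) v(1) _ w(2) v(2)])
        also have "\<dots> \<le> r i" unfolding r_def by (rule diam_R(1)[OF U(2) w(3) v(3)])
        finally show False using n(1)[of i] by simp
      qed
    qed
    then have "card (B i) \<le> card (touched (n i) (word_map F w ` postcritical))"
      by (intro card_mono) auto
    also have "\<dots> \<le> card postcritical * max 1 (card critical_codes)"
      using w(1) words_subset by (intro card_touched_cell) blast
    finally show ?thesis unfolding M_def by (rule of_nat_mono)
  qed
  have half: "(\<lambda>i. (1/2 :: real) ^ (i + 2)) sums (1/2)"
    using sums_mult[OF geometric_sums[of "1/2 :: real"], of "1/4"] by (simp add: power_add power2_eq_square mult.commute)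
  have "(\<Sum>i. ennreal (card (B i) / real N ^ n i)) \<le> (\<Sum>i. ennreal A * ennreal (r i powr s) + ennreal ((1/2) ^ (i + 2)))"
  proof (rule suminf_le)
    fix i
    have "card (B i) / real N ^ n i \<le> M / real N ^ n i"
      using card[of i] by (intro divide_right_mono) auto
    also have "\<dots> \<le> A * r i powr s + (1/2) ^ (i + 2)" by (rule n(2))
    finally have "ennreal (card (B i) / real N ^ n i) \<le> ennreal (A * r i powr s + (1/2) ^ (i + 2))"
      by (rule ennreal_leI)
    also have "\<dots> = ennreal A * ennreal (r i powr s) + ennreal ((1/2) ^ (i + 2))"
      using A by (simp add: ennreal_plus ennreal_mult)
    finally show "ennreal (card (B i) / real N ^ n i) \<le> ennreal A * ennreal (r i powr s) + ennreal ((1/2) ^ (i + 2))" .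
  qed simp_all
  also have "\<dots> = ennreal A * (\<Sum>i. ennreal (r i powr s)) + (\<Sum>i. ennreal ((1/2) ^ (i + 2)))"
    by (subst suminf_add[symmetric]) (simp_all add: ennreal_suminf_cmult)
  also have "(\<Sum>i. ennreal ((1/2) ^ (i + 2))) = ennreal (1/2)"
    by (rule suminf_ennreal_eq[OF _ half]) simp
  also have "ennreal A * (\<Sum>i. ennreal (r i powr s)) + ennreal (1/2) \<le> ennreal A * ennreal \<epsilon> + ennreal (1/2)"
    using U(4) unfolding r_def by (intro add_right_mono mult_left_mono) auto
  also have "\<dots> = ennreal (3/4)"
  proof -
    have "ennreal A * ennreal \<epsilon> = ennreal (A * \<epsilon>)"
      using A \<epsilon> by (simp add: ennreal_mult)
    also have "A * \<epsilon> = 1 / 4" using A by (simp add: \<epsilon>_def)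
    finally have "ennreal A * ennreal \<epsilon> + ennreal (1/2) = ennreal (1/4) + ennreal (1/2)" by (simp only:)
    also have "\<dots> = ennreal (1/4 + 1/2)" by (rule ennreal_plus[symmetric]) auto
    finally show ?thesis by simp
  qed
  also have "\<dots> < 1" by (simp add: ennreal_less_one_iff)
  finally have mass: "(\<Sum>i. ennreal (card (B i) / real N ^ n i)) < 1" .
  have "B i \<subseteq> words (n i)" for i by (auto simp: B_def)
  from kraft_avoiding_code[OF this mass] obtain \<omega> where \<omega>: "range \<omega> \<subseteq> {1..N}" "\<And>i. map \<omega> [0..<n i] \<notin> B i"
    by blast
  obtain x where x: "\<And>k. x \<in> word_map G (map \<omega> [0..<k]) ` K" using code_point_exists[OF \<omega>(1)] by blast
  have "x \<in> K" using x[of 0] by simp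
  then obtain i where "x \<in> U i" using U(1) by blast
  moreover have "map \<omega> [0..<n i] \<in> words (n i)" using \<omega>(1) by (auto simp: words_def)
  ultimately have "map \<omega> [0..<n i] \<in> B i" using x[of "n i"] by (auto simp: B_def)
  then show False using \<omega>(2) by blast
qed

lemma hausdorff_dim_R:
  assumes L: "0 < L" "L < 1" and sum: "summable (\<lambda>k. \<bar>L - lam (Suc k)\<bar>)"
  shows "hausdorff_dim R K = ereal (max 1 (ln (real N) / - ln L))"
proof (rule hausdorff_dim_eqI)
  have N1: "1 < real N" using N_ge_2 by simp
  have lnL: "0 < - ln L" using L by simp
  \<comment> \<open>In this form both comparisons of \<open>s\<close> with the quotient of
    logarithms amount to the sign of one exponent.\<close>
  have powr: "real N * L powr s = exp (ln (real N) - s * (- ln L))" for s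
    using N1 L by (simp add: exp_add powr_def)
  show "hausdorff_measure R s K = 0" if "max 1 (ln (real N) / - ln L) < s" for s
  proof (rule hausdorff_measure_eq_0[OF L sum])
    show "1 < s" using that by simp
    have "ln (real N) / - ln L < s"
      by (rule le_less_trans[OF max.cobounded2 that])
    then have "ln (real N) < s * (- ln L)"
      by (simp only: pos_divide_less_eq[OF lnL])
    then show "real N * L powr s < 1" unfolding powr by simp
  qed
  show "hausdorff_measure R s K \<noteq> 0" if s: "0 < s" "s < max 1 (ln (real N) / - ln L)" for s
  proof (cases "s < 1")
    case True
    then show ?thesis by (rule hausdorff_measure_neq_0_segment[OF s(1)])
  next
    case False
    then have "s < ln (real N) / - ln L" using s(2) by simp
    then have "s * (- ln L) < ln (real N)" by (simp only: pos_less_divide_eq[OF lnL])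
    then have "1 < real N * L powr s" unfolding powr by simp
    then show ?thesis by (rule hausdorff_measure_neq_0_cells[OF L sum s(1)])
  qed
qed simp

end

theorem theorem6p4:
  fixes N :: nat
    and F :: "nat \<Rightarrow> 'a::euclidean_space \<Rightarrow> 'a"
    and q :: "nat \<Rightarrow> 'a"
    and X K :: "'a set"
    and \<alpha> :: real
    and cw :: "'a \<Rightarrow> nat \<Rightarrow> nat list" and ci :: "'a \<Rightarrow> nat \<Rightarrow> nat"
    and pw :: "'a \<Rightarrow> nat list" and pj :: "'a \<Rightarrow> nat"
    and r0 :: "'a set \<Rightarrow> ereal"
    and lam :: "nat \<Rightarrow> real"
    and rho :: "nat \<Rightarrow> 'a \<times> nat \<Rightarrow> real"
    and lam_max lam_lim :: real
  assumes "stretched_fractal N F q X \<alpha> cw ci pw pj K"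
    and "stretching_data.regular_harmonic_sequence N F q X \<alpha> cw ci pw pj r0 lam rho"
    and "lam_max < 1"
    and "\<And>i. i \<ge> 1 \<Longrightarrow> lam i \<le> lam_max"
    and "0 < lam_lim" and "lam_lim \<le> lam_max"
    and "summable (\<lambda>k. \<bar>lam_lim - lam (Suc k)\<bar>)"
  shows "hausdorff_dim (stretched_fractal.resistance N F q X \<alpha> cw ci pw pj K r0 lam rho) K
           = ereal (max 1 (ln (real N) / (- ln lam_lim)))"
proof -
  interpret stretched_fractal N F q X \<alpha> cw ci pw pj K by (rule assms(1))
  have "bdd_above {rho i e | i e. i \<ge> 1 \<and> e \<in> edges1}"
    using assms(2) by (simp add: regular_harmonic_sequence_def)
  then obtain b where b: "\<And>i e. 1 \<le> i \<Longrightarrow> e \<in> edges1 \<Longrightarrow> rho i e \<le> b"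
    unfolding bdd_above_def by blast
  interpret regular_sequence N F q X \<alpha> cw ci pw pj K r0 lam rho lam_max b
  proof
    show "harmonic_structure r0 (lam i) (rho i)" if "1 \<le> i" for i
      using assms(2) that by (simp add: regular_harmonic_sequence_def harmonic_sequence_def)
  qed (use assms(3,4) b in auto)
  show ?thesis
    by (rule hausdorff_dim_R) (use assms in auto)
qed

end
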